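(* Let $x\in\mathcal{T}\mathrm{Gr}(2,n)$, $J=J(x)$, and $ij\notin J$. Let $T$ be a tree with $x\in\overline{\mathscr C_T}$, let $\preceq$ be a partial order on $[n]\smallsetminus\{i,j\}$ having the cherry property on $T$ with respect to $i,j$, and let $I$ be compatible with $\preceq$ and $J(ij)$. The inclusion $\overline{\mu}\colon R(ij)/\mathfrak a_J\hookrightarrow K[u_{kl}:kl\in I\smallsetminus J][u_{kl}^{-1}:kl\in H\smallsetminus J]$ induces an isomorphism $$\overline{\mu}\colon\ (R(ij)/\mathfrak a_J)_{S_{(J\cup\{ij\})^c}}\ \xrightarrow{\ \sim\ }\ \bigl(K[u_{kl}:kl\in I\smallsetminus J][u_{kl}^{-1}:kl\in H\smallsetminus J]\bigr)_S .$$
   Context: $K$ is a field complete with respect to a non-Archimedean absolute value $|\cdot|$ (possibly trivial). Pairs $kl\in\binom{[n]}2$ are unordered. $\mathrm{Gr}(2,n)\subset\mathbb{P}_K^{\binom n2-1}$ is embedded by Plücker coordinates $p_{kl}$ ($p_{lk}=-p_{kl}$); $^{\mathrm{an}}$ is Berkovich analytification. $\overline{\mathbb R}=\mathbb R\cup\{-\infty\}$, $\log0=-\infty$. $\mathbb{TP}^{N}=(\overline{\mathbb R}^{N+1}\smallsetminus\{(-\infty,\dots,-\infty)\})/\mathbb R\cdot(1,\dots,1)$. $\mathrm{trop}\colon\mathrm{Gr}(2,n)^{\mathrm{an}}\to\mathbb{TP}^{\binom n2-1}$ sends $\gamma$ over $\{p_{ij}\ne0\}$ to the class of $x$ with $x_{kl}-x_{ij}=\log\gamma(p_{kl}/p_{ij})$;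 $\mathcal{T}\mathrm{Gr}(2,n)$ is its image. For $x\in\mathcal{T}\mathrm{Gr}(2,n)$, $J(x)=\{kl:x_{kl}=-\infty\}$. $R(ij)=K[u_{kl}:kl\in I(ij)]$ (polynomial ring), $u_{kl}=p_{kl}/p_{ij}$, $I(ij)=\{il,jl:l\ne i,j\}$, is the coordinate ring of $\{p_{ij}\ne0\}\subset\mathrm{Gr}(2,n)$; for $k,l\notin\{i,j\}$, $u_{kl}=u_{ik}u_{jl}-u_{il}u_{jk}\in R(ij)$. $\mathfrak a_J\subset R(ij)$ is the ideal generated by $\{u_{kl}:kl\in J\}$ (a prime ideal). $S_{(J\cup\{ij\})^c}$ is the multiplicative set generated by the residue classes of all $u_{kl}$ with $kl\notin J\cup\{ij\}$. The left-hand ring of the isomorphism is the coordinate ring of $\mathrm{Gr}_J(2,n)$, the (reduced) locally closed subscheme of $\mathrm{Gr}(2,n)$ where exactly the Plücker coordinates in $J$ vanish. Trees: a tree $T$ on $n$ leaves is a finite connected acyclic graph without degree-two vertices whose leaves are labeled bijectively by $[n]$; inner edges are those not ending in a leaf. $\mathscr{C}_T\subset\mathbb R^{\binom n2}/\mathbb R\cdot(1,\dots,1)\subset\mathbb{TP}^{\binom n2-1}$ is the set of classes of vectors $x$ for which there is $\omega\colon E(T)\to\mathbb R$, nonnegative on inner edges, with $x_{kl}$ the sum of $\omega(e)$ over the edges $e$ of the path from $k$ to $l$; $\overline{\mathscr C_T}$ is its closure in $\mathbb{TP}^{\binom n2-1}$ (quotient topology, $[-\infty,a)$ being basic neighborhoods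 of $-\infty$). Given $i\ne j$, let $v_1,\dots,v_m$ be the internal vertices of the path from $i$ to $j$ in $T$, and let $T_a$ be the set of leaves $l\neq i,j$ whose path to the $i$–$j$ path first meets it at $v_a$. A quartet $\{a,b,c,d\}$ of $T$ is the subtree spanned by four leaves (degree-two vertices suppressed); a cherry is a pair of leaves adjacent to the same vertex. A partial order $\preceq$ on $[n]\smallsetminus\{i,j\}$ has the cherry property on $T$ with respect to $i,j$ if: leaves in different $T_a,T_b$ are incomparable; $\preceq$ is total on each $T_a$; and whenever $k\prec l\prec v$, either $\{k,l\}$ or $\{l,v\}$ is a cherry of the quartet $\{i,k,l,v\}$. Put $J(ij)=J\cap I(ij)$. A set $I\subset\binom{[n]}2$ of size $2(n-2)$ with $ij\notin I$ is compatible with $\preceq$ and $J(ij)$ if for each $a$ and each $k\in T_a$ exactly one of the following holds: (i) $ik,jk\in I$, and for all $l\prec k$ we have $il\in J(ij)$ or $jl\in J(ij)$; (ii) $ik\notin I$, $jl\in I$ for all $l\in T_a$, there is $t\prec k$ in $T_a$ with $it,jt\notin J(ij)$, and for the maximal such $t$, $kt\in I$; (iii) the same as (ii) with the roles of $i$ and $j$ exchanged. Let $H=I\cap I(ij)$. The elements $u_{kl}$, $kl\in I$, are algebraically independent over $K$ in the fraction field of $R(ij)$, and $\mu\colon R(ij)\hookrightarrow K[u_{kl}:kl\in I][u_{kl}^{-1}:kl\in H\smallsetminus J]$ is the inclusion inside this fraction field. The ideal generated by $\mu(\mathfrak a_J)$ equals $\langle u_{kl}:kl\in I\cap J\rangle$,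 and $\overline\mu$ is the injective map induced by $\mu$ on quotients by $\mathfrak a_J$ and by this ideal (so $\overline\mu$ is $\mu$ followed by setting $u_{kl}=0$ for $kl\in I\cap J$). For $rs\notin J\cup\{ij\}$ set $f_{rs}=\overline\mu(u_{rs})$; $S$ is the multiplicatively closed set generated by all $f_{rs}$, $rs\notin J\cup\{ij\}$. *)

theory Defs
  imports
    "HOL-Algebra.Algebraic_Closure_Type"
    "HOL-Algebra.Generated_Rings"
    "HOL-Analysis.Function_Topology"
    "HOL-Library.Poly_Mapping"
    "HOL-Library.Extended_Real"
    "HOL-Library.Nat_Bijection"
begin

section \<open>Complete non-Archimedean fields\<close>

definition complete_nonarch :: "('k::field \<Rightarrow> real) \<Rightarrow> bool" where
  "complete_nonarch av \<longleftrightarrow>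
     (\<forall>a. 0 \<le> av a) \<and> (\<forall>a. av a = 0 \<longleftrightarrow> a = 0) \<and>
     (\<forall>a b. av (a * b) = av a * av b) \<and>
     (\<forall>a b. av (a + b) \<le> max (av a) (av b)) \<and>
     (\<forall>s :: nat \<Rightarrow> 'k.
        (\<forall>\<epsilon>>0. \<exists>N. \<forall>p\<ge>N. \<forall>q\<ge>N. av (s p - s q) < \<epsilon>) \<longrightarrow>
        (\<exists>L. \<forall>\<epsilon>>0. \<exists>N. \<forall>p\<ge>N. av (s p - L) < \<epsilon>))"

text \<open>Unordered pairs \<open>kl\<close> are two-element sets \<open>{k, l}\<close>.\<close>

definition pairs :: "nat \<Rightarrow> nat set set" where
  "pairs n = {e. e \<subseteq> {1..n} \<and> card e = 2}"

definition star_pairs :: "nat \<Rightarrow> nat \<Rightarrow> nat \<Rightarrow> nat set set" where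
  "star_pairs n i j = {{a, l} | a l. a \<in> {i, j} \<and> l \<in> {1..n} - {i, j}}"


section \<open>The chart of the Grassmannian where one Plucker coordinate is invertible\<close>

text \<open>Multivariate polynomials; the variable \<open>u_{al}\<close> with \<open>a \<in> {i, j}\<close> carries the index
  \<open>prod_encode (a, l)\<close>. (A linearly ordered index type makes the polynomials an integral domain.)\<close>

type_synonym 'k mpoly = "(nat \<Rightarrow>\<^sub>0 nat) \<Rightarrow>\<^sub>0 'k"

definition mconst :: "'k::field \<Rightarrow> 'k mpoly" where
  "mconst c = Poly_Mapping.single 0 c"

definition mvar :: "nat \<Rightarrow> nat \<Rightarrow> 'k::field mpoly" where
  "mvar a l = Poly_Mapping.single (Poly_Mapping.single (prod_encode (a, l)) 1) 1"

definition chart_ring :: "nat \<Rightarrow> nat \<Rightarrow> nat \<Rightarrow> 'k::field mpoly ring" where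
  "chart_ring n i j = ring_of_type_algebra\<lparr>carrier :=
     {p. \<forall>m\<in>Poly_Mapping.keys p. Poly_Mapping.keys m \<subseteq>
           {prod_encode (a, l) | a l. a \<in> {i, j} \<and> l \<in> {1..n} - {i, j}}}\<rparr>"

text \<open>The element \<open>u_{kl} = p_{kl} / p_{ij}\<close> for all ordered \<open>k, l\<close>, so that
  \<open>u_{lk} = - u_{kl}\<close>, \<open>u_{ij} = 1\<close>; \<open>row_i\<close> and \<open>row_j\<close> are the special cases \<open>u_{ik}\<close> and \<open>u_{jk}\<close>.\<close>

definition row_i :: "nat \<Rightarrow> nat \<Rightarrow> nat \<Rightarrow> 'k::field mpoly" where
  "row_i i j k = (if k = i then 0 else if k = j then 1 else mvar i k)"

definition row_j :: "nat \<Rightarrow> nat \<Rightarrow> nat \<Rightarrow> 'k::field mpoly" where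
  "row_j i j k = (if k = i then - 1 else if k = j then 0 else mvar j k)"

definition ucoord :: "nat \<Rightarrow> nat \<Rightarrow> nat \<Rightarrow> nat \<Rightarrow> 'k::field mpoly" where
  "ucoord i j k l = row_i i j k * row_j i j l - row_i i j l * row_j i j k"

lemma ucoord_swap: "ucoord i j l k = - ucoord i j k l"
  by (simp add: ucoord_def)

lemma ucoord_ij: "i \<noteq> j \<Longrightarrow> ucoord i j i j = 1"
  by (simp add: ucoord_def row_i_def row_j_def)

lemma ucoord_row:
  "l \<notin> {i, j} \<Longrightarrow> ucoord i j i l = mvar i l"
  "l \<notin> {i, j} \<Longrightarrow> i \<noteq> j \<Longrightarrow> ucoord i j j l = mvar j l"
  by (auto simp: ucoord_def row_i_def row_j_def)

lemma ucoord_plucker: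
  "{k, l} \<inter> {i, j} = {} \<Longrightarrow> i \<noteq> j \<Longrightarrow>
   ucoord i j k l = ucoord i j i k * ucoord i j j l - ucoord i j i l * ucoord i j j k"
  by (simp add: ucoord_row) (simp add: ucoord_def row_i_def row_j_def)


section \<open>Tropical projective space and the tropical Grassmannian\<close>

definition quotient_topology :: "'a topology \<Rightarrow> ('a \<Rightarrow> 'b) \<Rightarrow> 'b topology" where
  "quotient_topology Z q =
     topology (\<lambda>U. U \<subseteq> q ` topspace Z \<and> openin Z {x \<in> topspace Z. q x \<in> U})"

lemma openin_quotient_topology:
  "openin (quotient_topology Z q) U \<longleftrightarrow>
     U \<subseteq> q ` topspace Z \<and> openin Z {x \<in> topspace Z. q x \<in> U}"
proof -
  have "istopology (\<lambda>U. U \<subseteq> q ` topspace Z \<and> openin Z {x \<in> topspace Z. q x \<in> U})"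
    unfolding istopology_def
  proof (intro conjI allI impI)
    fix S T
    assume "S \<subseteq> q ` topspace Z \<and> openin Z {x \<in> topspace Z. q x \<in> S}"
      and "T \<subseteq> q ` topspace Z \<and> openin Z {x \<in> topspace Z. q x \<in> T}"
    moreover have "{x \<in> topspace Z. q x \<in> S \<inter> T} =
        {x \<in> topspace Z. q x \<in> S} \<inter> {x \<in> topspace Z. q x \<in> T}" by auto
    ultimately show "S \<inter> T \<subseteq> q ` topspace Z" and "openin Z {x \<in> topspace Z. q x \<in> S \<inter> T}"
      by auto
  next
    fix \<U>
    assume *: "\<forall>U\<in>\<U>. U \<subseteq> q ` topspace Z \<and> openin Z {x \<in> topspace Z. q x \<in> U}"
    then show "\<Union> \<U> \<subseteq> q ` topspace Z" by blast
    have "{x \<in> topspace Z. q x \<in> \<Union> \<U>} = (\<Union>U\<in>\<U>. {x \<in> topspace Z. q x \<in> U})" by auto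
    with * show "openin Z {x \<in> topspace Z. q x \<in> \<Union> \<U>}" by auto
  qed
  then show ?thesis
    by (simp add: quotient_topology_def topology_inverse')
qed

definition tp_class :: "nat \<Rightarrow> (nat set \<Rightarrow> ereal) \<Rightarrow> (nat set \<Rightarrow> ereal) set" where
  "tp_class n x = {y. \<exists>c::real. y = (\<lambda>e\<in>pairs n. x e + ereal c)}"

definition tp_topology :: "nat \<Rightarrow> (nat set \<Rightarrow> ereal) set topology" where
  "tp_topology n = quotient_topology
     (subtopology (product_topology (\<lambda>_. top_of_set {..<\<infinity>}) (pairs n))
        {x. \<exists>e\<in>pairs n. x e \<noteq> -\<infinity>})
     (tp_class n)"

definition log_ereal :: "real \<Rightarrow> ereal" where
  "log_ereal t = (if t = 0 then -\<infinity> else ereal (ln t))"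

text \<open>Points of the analytification of the chart \<open>{p_{ij} \<noteq> 0}\<close>: multiplicative non-Archimedean
  seminorms on the coordinate ring extending the absolute value (only their values on the
  coordinate ring matter).\<close>

definition chart_an :: "('k::field \<Rightarrow> real) \<Rightarrow> nat \<Rightarrow> nat \<Rightarrow> nat \<Rightarrow> ('k mpoly \<Rightarrow> real) set" where
  "chart_an av n i j = {\<gamma>.
     (\<forall>c. \<gamma> (mconst c) = av c) \<and>
     (\<forall>p\<in>carrier (chart_ring n i j). 0 \<le> \<gamma> p) \<and>
     (\<forall>p\<in>carrier (chart_ring n i j). \<forall>q\<in>carrier (chart_ring n i j).
        \<gamma> (p * q) = \<gamma> p * \<gamma> q \<and> \<gamma> (p + q) \<le> max (\<gamma> p) (\<gamma> q))}"

text \<open>The analytification of \<open>Gr(2,n)\<close> is covered by the analytified charts, so the image of the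
  tropicalization map is the union of the images of the charts.\<close>

definition trop_gr :: "('k::field \<Rightarrow> real) \<Rightarrow> nat \<Rightarrow> (nat set \<Rightarrow> ereal) set set" where
  "trop_gr av n = {tp_class n x | x \<gamma> i j.
     i \<in> {1..n} \<and> j \<in> {1..n} \<and> i \<noteq> j \<and> \<gamma> \<in> chart_an av n i j \<and>
     x \<in> pairs n \<rightarrow>\<^sub>E {..<\<infinity>} \<and> x {i, j} \<noteq> -\<infinity> \<and>
     (\<forall>k l. {k, l} \<in> pairs n \<longrightarrow> x {k, l} - x {i, j} = log_ereal (\<gamma> (ucoord i j k l)))}"

definition infinite_pairs :: "nat \<Rightarrow> (nat set \<Rightarrow> ereal) set \<Rightarrow> nat set set" where
  "infinite_pairs n \<xi> = {e \<in> pairs n. \<forall>x\<in>\<xi>. x e = -\<infinity>}"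


section \<open>Trees\<close>

definition is_path :: "'v set set \<Rightarrow> 'v \<Rightarrow> 'v \<Rightarrow> 'v list \<Rightarrow> bool" where
  "is_path E v w p \<longleftrightarrow>
     p \<noteq> [] \<and> hd p = v \<and> last p = w \<and> distinct p \<and> successively (\<lambda>a b. {a, b} \<in> E) p"

definition the_path :: "'v set set \<Rightarrow> 'v \<Rightarrow> 'v \<Rightarrow> 'v list" where
  "the_path E v w = (THE p. is_path E v w p)"

definition edges_of_path :: "'v list \<Rightarrow> 'v set set" where
  "edges_of_path p = {{p ! m, p ! Suc m} | m. Suc m < length p}"

definition inner_vertices :: "'v list \<Rightarrow> 'v set" where
  "inner_vertices p = set (butlast (tl p))"

definition vdeg :: "'v set set \<Rightarrow> 'v \<Rightarrow> nat" where
  "vdeg E v = card {e \<in> E. v \<in> e}"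

definition is_tree :: "'v set \<Rightarrow> 'v set set \<Rightarrow> bool" where
  "is_tree V E \<longleftrightarrow>
     finite V \<and> V \<noteq> {} \<and> (\<forall>e\<in>E. e \<subseteq> V \<and> card e = 2) \<and>
     (\<forall>v\<in>V. \<forall>w\<in>V. \<exists>p. is_path E v w p) \<and>
     \<not> (\<exists>p. 3 \<le> length p \<and> distinct p \<and> successively (\<lambda>a b. {a, b} \<in> E) p \<and> {last p, hd p} \<in> E)"

definition leaves :: "'v set \<Rightarrow> 'v set set \<Rightarrow> 'v set" where
  "leaves V E = {v \<in> V. vdeg E v = 1}"

definition labeled_tree :: "nat \<Rightarrow> 'v set \<Rightarrow> 'v set set \<Rightarrow> (nat \<Rightarrow> 'v) \<Rightarrow> bool" where
  "labeled_tree n V E lab \<longleftrightarrow>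
     is_tree V E \<and> (\<forall>v\<in>V. vdeg E v \<noteq> 2) \<and> bij_betw lab {1..n} (leaves V E)"

definition tree_cone ::
    "nat \<Rightarrow> 'v set \<Rightarrow> 'v set set \<Rightarrow> (nat \<Rightarrow> 'v) \<Rightarrow> (nat set \<Rightarrow> ereal) set set" where
  "tree_cone n V E lab = {tp_class n x | x (\<omega> :: 'v set \<Rightarrow> real).
     x \<in> extensional (pairs n) \<and>
     (\<forall>e\<in>E. e \<inter> leaves V E = {} \<longrightarrow> 0 \<le> \<omega> e) \<and>
     (\<forall>k l. {k, l} \<in> pairs n \<longrightarrow>
        x {k, l} = ereal (\<Sum>e\<in>edges_of_path (the_path E (lab k) (lab l)). \<omega> e))}"

text \<open>For the internal vertex \<open>v = v_a\<close> of the path from \<open>i\<close> to \<open>j\<close>, \<open>part n E lab i j v\<close> is \<open>T_a\<close>.\<close>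

definition spine :: "'v set set \<Rightarrow> (nat \<Rightarrow> 'v) \<Rightarrow> nat \<Rightarrow> nat \<Rightarrow> 'v set" where
  "spine E lab i j = inner_vertices (the_path E (lab i) (lab j))"

definition part ::
    "nat \<Rightarrow> 'v set set \<Rightarrow> (nat \<Rightarrow> 'v) \<Rightarrow> nat \<Rightarrow> nat \<Rightarrow> 'v \<Rightarrow> nat set" where
  "part n E lab i j v = {l \<in> {1..n} - {i, j}.
     set (the_path E (lab l) v) \<inter> set (the_path E (lab i) (lab j)) = {v}}"

text \<open>The edge set of the subtree spanned by the vertices in \<open>L\<close>, degree-two vertices suppressed.\<close>

definition spanned_edges :: "'v set set \<Rightarrow> 'v set \<Rightarrow> 'v set set" where
  "spanned_edges E L = (\<Union>a\<in>L. \<Union>b\<in>L. edges_of_path (the_path E a b))"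

definition suppress2 :: "'v set set \<Rightarrow> 'v set set" where
  "suppress2 D = {{a, b} | a b. a \<in> \<Union>D \<and> b \<in> \<Union>D \<and> a \<noteq> b \<and> vdeg D a \<noteq> 2 \<and> vdeg D b \<noteq> 2 \<and>
     (\<exists>p. is_path D a b p \<and> (\<forall>w\<in>inner_vertices p. vdeg D w = 2))}"

definition is_cherry :: "'v set set \<Rightarrow> 'v \<Rightarrow> 'v \<Rightarrow> bool" where
  "is_cherry Q a b \<longleftrightarrow>
     a \<noteq> b \<and> vdeg Q a = 1 \<and> vdeg Q b = 1 \<and> (\<exists>w. {a, w} \<in> Q \<and> {b, w} \<in> Q)"

text \<open>\<open>(k, l) \<in> r\<close> means \<open>k \<preceq> l\<close>. The alternative in the last clause is inclusive: if the quartet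
  is a star, then all pairs of its leaves are cherries.\<close>

definition cherry_property ::
    "nat \<Rightarrow> 'v set set \<Rightarrow> (nat \<Rightarrow> 'v) \<Rightarrow> nat \<Rightarrow> nat \<Rightarrow> nat rel \<Rightarrow> bool" where
  "cherry_property n E lab i j r \<longleftrightarrow>
     (\<forall>v\<in>spine E lab i j. \<forall>w\<in>spine E lab i j. v \<noteq> w \<longrightarrow>
        (\<forall>k\<in>part n E lab i j v. \<forall>l\<in>part n E lab i j w. (k, l) \<notin> r \<and> (l, k) \<notin> r)) \<and>
     (\<forall>v\<in>spine E lab i j. total_on (part n E lab i j v) r) \<and>
     (\<forall>k l m. (k, l) \<in> r \<and> k \<noteq> l \<and> (l, m) \<in> r \<and> l \<noteq> m \<longrightarrow>
        (let Q = suppress2 (spanned_edges E {lab i, lab k, lab l, lab m})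
         in is_cherry Q (lab k) (lab l) \<or> is_cherry Q (lab l) (lab m)))"


section \<open>Compatible sets\<close>

text \<open>In the next two definitions \<open>A\<close> is the part containing \<open>k\<close>, and \<open>Jij\<close> is \<open>J(ij)\<close>.
  \<open>compatible_ii\<close> is condition (ii); condition (iii) is obtained by exchanging \<open>i\<close> and \<open>j\<close>.\<close>

definition compatible_i ::
    "nat rel \<Rightarrow> nat set set \<Rightarrow> nat set set \<Rightarrow> nat \<Rightarrow> nat \<Rightarrow> nat \<Rightarrow> bool" where
  "compatible_i r Jij I i j k \<longleftrightarrow>
     {i, k} \<in> I \<and> {j, k} \<in> I \<and>
     (\<forall>l. (l, k) \<in> r \<and> l \<noteq> k \<longrightarrow> {i, l} \<in> Jij \<or> {j, l} \<in> Jij)"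

definition compatible_ii ::
    "nat rel \<Rightarrow> nat set set \<Rightarrow> nat set set \<Rightarrow> nat set \<Rightarrow> nat \<Rightarrow> nat \<Rightarrow> nat \<Rightarrow> bool" where
  "compatible_ii r Jij I A i j k \<longleftrightarrow>
     {i, k} \<notin> I \<and> (\<forall>l\<in>A. {j, l} \<in> I) \<and>
     (let M = {t \<in> A. (t, k) \<in> r \<and> t \<noteq> k \<and> {i, t} \<notin> Jij \<and> {j, t} \<notin> Jij}
      in \<exists>t\<in>M. (\<forall>s\<in>M. (s, t) \<in> r) \<and> {k, t} \<in> I)"

definition exactly_one :: "bool \<Rightarrow> bool \<Rightarrow> bool \<Rightarrow> bool" where
  "exactly_one A B C \<longleftrightarrow> (A \<and> \<not> B \<and> \<not> C) \<or> (\<not> A \<and> B \<and> \<not> C) \<or> (\<not> A \<and> \<not> B \<and> C)"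

definition compatible ::
    "nat \<Rightarrow> 'v set set \<Rightarrow> (nat \<Rightarrow> 'v) \<Rightarrow> nat \<Rightarrow> nat \<Rightarrow> nat rel \<Rightarrow> nat set set \<Rightarrow> nat set set \<Rightarrow> bool"
  where
  "compatible n E lab i j r Jij I \<longleftrightarrow>
     I \<subseteq> pairs n \<and> card I = 2 * (n - 2) \<and> {i, j} \<notin> I \<and>
     (\<forall>v\<in>spine E lab i j. \<forall>k\<in>part n E lab i j v.
        exactly_one
          (compatible_i r Jij I i j k)
          (compatible_ii r Jij I (part n E lab i j v) i j k)
          (compatible_ii r Jij I (part n E lab i j v) j i k))"


section \<open>Localization of commutative rings\<close>

inductive_set mult_closure :: "('a, 'b) monoid_scheme \<Rightarrow> 'a set \<Rightarrow> 'a set"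
  for R and G where
    one: "\<one>\<^bsub>R\<^esub> \<in> mult_closure R G"
  | incl: "g \<in> G \<Longrightarrow> g \<in> mult_closure R G"
  | mult: "a \<in> mult_closure R G \<Longrightarrow> b \<in> mult_closure R G \<Longrightarrow> a \<otimes>\<^bsub>R\<^esub> b \<in> mult_closure R G"

text \<open>\<open>loc_frac R S a s\<close> is the fraction \<open>a / s\<close>, an equivalence class of pairs.\<close>

definition loc_frac :: "('a, 'b) ring_scheme \<Rightarrow> 'a set \<Rightarrow> 'a \<Rightarrow> 'a \<Rightarrow> ('a \<times> 'a) set" where
  "loc_frac R S a s = {(b, t). b \<in> carrier R \<and> t \<in> S \<and>
     (\<exists>w\<in>S. w \<otimes>\<^bsub>R\<^esub> (a \<otimes>\<^bsub>R\<^esub> t) = w \<otimes>\<^bsub>R\<^esub> (b \<otimes>\<^bsub>R\<^esub> s))}"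

definition localization :: "('a, 'b) ring_scheme \<Rightarrow> 'a set \<Rightarrow> ('a \<times> 'a) set ring" where
  "localization R S =
     \<lparr>carrier = {loc_frac R S a s | a s. a \<in> carrier R \<and> s \<in> S},
      monoid.mult = (\<lambda>Z Y. \<Union>(a, s)\<in>Z. \<Union>(b, t)\<in>Y. loc_frac R S (a \<otimes>\<^bsub>R\<^esub> b) (s \<otimes>\<^bsub>R\<^esub> t)),
      one = loc_frac R S \<one>\<^bsub>R\<^esub> \<one>\<^bsub>R\<^esub>,
      ring.zero = loc_frac R S \<zero>\<^bsub>R\<^esub> \<one>\<^bsub>R\<^esub>,
      add = (\<lambda>Z Y. \<Union>(a, s)\<in>Z. \<Union>(b, t)\<in>Y.
               loc_frac R S ((a \<otimes>\<^bsub>R\<^esub> t) \<oplus>\<^bsub>R\<^esub> (b \<otimes>\<^bsub>R\<^esub> s)) (s \<otimes>\<^bsub>R\<^esub> t))\<rparr>"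

text \<open>The map \<open>a / s \<mapsto> h a / h s\<close> into the localization of \<open>R'\<close> at \<open>S'\<close>.\<close>

definition loc_map ::
    "('c, 'd) ring_scheme \<Rightarrow> 'c set \<Rightarrow> ('a \<Rightarrow> 'c) \<Rightarrow> ('a \<times> 'a) set \<Rightarrow> ('c \<times> 'c) set" where
  "loc_map R' S' h Z = (\<Union>(a, s)\<in>Z. loc_frac R' S' (h a) (h s))"


section \<open>Quotient, Laurent polynomial ring and the comparison map\<close>

definition coord_ideal :: "nat \<Rightarrow> nat \<Rightarrow> nat \<Rightarrow> nat set set \<Rightarrow> 'k::field mpoly set" where
  "coord_ideal n i j J = Idl\<^bsub>chart_ring n i j\<^esub> {ucoord i j k l | k l. {k, l} \<in> J}"

definition u_class ::
    "nat \<Rightarrow> nat \<Rightarrow> nat \<Rightarrow> nat set set \<Rightarrow> nat \<Rightarrow> nat \<Rightarrow> 'k::field mpoly set" where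
  "u_class n i j J k l = coord_ideal n i j J +>\<^bsub>chart_ring n i j\<^esub> ucoord i j k l"

definition to_frac :: "'k::field mpoly \<Rightarrow> 'k mpoly fract" where
  "to_frac p = Fract p 1"

text \<open>\<open>K[u_{kl} : kl \<in> A][u_{kl}^{-1} : kl \<in> D]\<close> inside the fraction field.\<close>

definition laurent_ring ::
    "nat \<Rightarrow> nat \<Rightarrow> nat set set \<Rightarrow> nat set set \<Rightarrow> 'k::field mpoly fract ring" where
  "laurent_ring i j A D = ring_of_type_algebra\<lparr>carrier := generate_ring ring_of_type_algebra
     (range (\<lambda>c. to_frac (mconst c)) \<union>
      {to_frac (ucoord i j k l) | k l. {k, l} \<in> A} \<union>
      {inverse (to_frac (ucoord i j k l)) | k l. {k, l} \<in> D})\<rparr>"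

text \<open>The homomorphism \<open>K[u_{kl} : kl \<in> I][u_{kl}^{-1} : kl \<in> H - J] \<rightarrow>
  K[u_{kl} : kl \<in> I - J][u_{kl}^{-1} : kl \<in> H - J]\<close> setting \<open>u_{kl} = 0\<close> for \<open>kl \<in> I \<inter> J\<close>.
  Uniqueness is clear, and existence follows from the algebraic independence of the \<open>u_{kl}\<close>, \<open>kl \<in> I\<close>.\<close>

definition set_zero ::
    "nat \<Rightarrow> nat \<Rightarrow> nat set set \<Rightarrow> nat set set \<Rightarrow> nat set set \<Rightarrow>
     'k::field mpoly fract \<Rightarrow> 'k mpoly fract" where
  "set_zero i j I H J = (THE \<sigma>.
     \<sigma> \<in> extensional (carrier (laurent_ring i j I (H - J))) \<and>
     \<sigma> \<in> ring_hom (laurent_ring i j I (H - J)) (laurent_ring i j (I - J) (H - J)) \<and>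
     (\<forall>b\<in>carrier (laurent_ring i j (I - J) (H - J)). \<sigma> b = b) \<and>
     (\<forall>k l. {k, l} \<in> I \<inter> J \<longrightarrow> \<sigma> (to_frac (ucoord i j k l)) = 0))"

text \<open>\<open>\<mu>\<close> is the inclusion \<open>to_frac\<close>; \<open>mu_bar\<close> sends the coset of \<open>p\<close> to \<open>set_zero (\<mu> p)\<close>.\<close>

definition mu_bar ::
    "nat \<Rightarrow> nat \<Rightarrow> nat set set \<Rightarrow> nat set set \<Rightarrow> nat set set \<Rightarrow>
     'k::field mpoly set \<Rightarrow> 'k mpoly fract" where
  "mu_bar i j I H J Z = the_elem ((\<lambda>p. set_zero i j I H J (to_frac p)) ` Z)"

end

theory Submission
  imports Defs
begin

text \<open>The coordinates in \<open>I\<close> form a triangular system along \<open>\<preceq>\<close>: the row \<open>(u_{ik}, u_{jk})\<close> is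
  recovered from coordinates in \<open>I\<close> and from smaller rows, dividing only by coordinates in \<open>H - J\<close>,
  and the cardinality of \<open>I\<close> leaves no room for further relations. Therefore \<open>R(ij)\<close> is contained in
  \<open>K[u_{kl} : kl \<in> I][u_{kl}^{-1} : kl \<in> H - J]\<close>, and there is a point of the chart over the fraction
  field whose coordinate \<open>kl \<in> I\<close> is \<open>u_{kl}\<close> if \<open>kl \<notin> J\<close> and \<open>0\<close> if \<open>kl \<in> J\<close>. Setting
  \<open>u_{kl} = 0\<close> for \<open>kl \<in> I \<inter> J\<close> is evaluation at this point.

  Four-point conditions pass from the cone of the tree to its closure, and there they constrain \<open>J\<close>.
  Together with the cherry property they force all coordinates in \<open>J\<close> to vanish at the point, so the
  comparison map is defined. An element \<open>p\<close> of its kernel is an element of \<open>\<aa>\<^sub>J\<close> divided by a product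
  of coordinates in \<open>H - J\<close>, and the generators of the Laurent polynomial ring are images of fractions
  with such denominators. Hence the comparison map is bijective after localization.\<close>

section \<open>Localizations\<close>

text \<open>The map \<open>set_zero\<close> is specified only by its properties, so its existence is
  part of the work. A polynomial can be evaluated at any point, hence the effort goes into
  constructing one suitable point. A fraction p/m is then forced to go to the value of p divided by
  m, and this does not depend on the fraction because the evaluation fixes the denominators m.

  Coordinates in J that lie outside \<open>I\<close> must vanish at the point too, although nothing
  prescribes them. Three kinds of quartets decide this: {i,j,k,l} with k, l hanging off the same
  vertex of the path from i to j, the same with different vertices, and {i,k,l,m} for a chain of
  three labels. On a tree metric each gives an equation and an inequality between sums of two path
  lengths. In a limit where some lengths tend to -infinity, a statement about membership in J is
  left. It is obtained by separating the limit from the cone by an open set on which the reversed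
  strict inequality holds.\<close>

lemma mult_closure_subset:
  assumes "Ring.ring R" "G \<subseteq> carrier R"
  shows "mult_closure R G \<subseteq> carrier R"
proof
  interpret Ring.ring R by fact
  fix x assume "x \<in> mult_closure R G"
  then show "x \<in> carrier R"
    by induction (use assms(2) in auto)
qed

text \<open>The denominators on the right are generated by images, so each of them is
  \<open>h s\<close> for a single denominator \<open>s\<close> on the left. This is what allows
  fractions over \<open>B\<close> to be lifted in \<open>loc_map_ring_iso\<close>.\<close>

lemma mult_closure_image:
  assumes h: "h \<in> ring_hom Q B" and Q: "Ring.ring Q" and U: "U \<subseteq> carrier Q"
  shows "mult_closure B (h ` U) = h ` mult_closure Q U"
proof
  note sub = mult_closure_subset[OF Q U]
  show "mult_closure B (h ` U) \<subseteq> h ` mult_closure Q U"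
  proof
    fix x assume "x \<in> mult_closure B (h ` U)"
    then show "x \<in> h ` mult_closure Q U"
    proof induction
      case one
      show ?case using ring_hom_one[OF h] mult_closure.one[of Q U] by (metis imageI)
    next
      case (incl g)
      then show ?case by (auto intro: mult_closure.incl)
    next
      case (mult a b)
      then obtain a' b' where "a' \<in> mult_closure Q U" "b' \<in> mult_closure Q U" "a = h a'" "b = h b'"
        by auto
      moreover from this have "h (a' \<otimes>\<^bsub>Q\<^esub> b') = h a' \<otimes>\<^bsub>B\<^esub> h b'"
        using ring_hom_mult[OF h] sub by blast
      ultimately show ?case by (metis imageI mult_closure.mult)
    qed
  qed
  show "h ` mult_closure Q U \<subseteq> mult_closure B (h ` U)"
  proof
    fix y assume "y \<in> h ` mult_closure Q U"
    then obtain x where "x \<in> mult_closure Q U" "y = h x" by auto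
    from this(1) have "h x \<in> mult_closure B (h ` U)"
    proof induction
      case one
      show ?case using ring_hom_one[OF h] mult_closure.one[of B] by simp
    next
      case (incl g)
      then show ?case by (auto intro: mult_closure.incl)
    next
      case (mult a b)
      then have "h (a \<otimes>\<^bsub>Q\<^esub> b) = h a \<otimes>\<^bsub>B\<^esub> h b"
        using ring_hom_mult[OF h] sub by blast
      with mult show ?case by (metis mult_closure.mult)
    qed
    with \<open>y = h x\<close> show "y \<in> mult_closure B (h ` U)" by simp
  qed
qed

locale cring_localization = cring R for R (structure) +
  fixes S
  assumes S_subset: "S \<subseteq> carrier R"
    and S_one: "\<one> \<in> S"
    and S_mult: "a \<in> S \<Longrightarrow> b \<in> S \<Longrightarrow> a \<otimes> b \<in> S"
begin

lemma S_carrier: "s \<in> S \<Longrightarrow> s \<in> carrier R"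
  using S_subset by auto

text \<open>Transitivity of the relation between fractions. The witness for the composite is
  \<open>x \<otimes> w \<otimes> s\<close>: besides both given witnesses it contains the middle
  denominator \<open>s\<close>, which cannot be cancelled in a ring with zero divisors.\<close>

lemma loc_frac_eqI:
  assumes a: "a \<in> carrier R" and b: "b \<in> carrier R" and s: "s \<in> S" and t: "t \<in> S" and w: "w \<in> S"
    and eq: "w \<otimes> (a \<otimes> t) = w \<otimes> (b \<otimes> s)"
  shows "loc_frac R S a s = loc_frac R S b t"
proof -
  have *: "loc_frac R S a s \<subseteq> loc_frac R S b t"
    if a: "a \<in> carrier R" and b: "b \<in> carrier R" and s: "s \<in> S" and t: "t \<in> S" and w: "w \<in> S"
      and eq: "w \<otimes> (a \<otimes> t) = w \<otimes> (b \<otimes> s)" for a b s t w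
  proof clarify
    fix c v assume "(c, v) \<in> loc_frac R S a s"
    then obtain x where c: "c \<in> carrier R" and v: "v \<in> S" and x: "x \<in> S"
      and eq': "x \<otimes> (a \<otimes> v) = x \<otimes> (c \<otimes> s)"
      by (auto simp: loc_frac_def)
    note car = a b c S_carrier[OF s] S_carrier[OF t] S_carrier[OF v] S_carrier[OF w] S_carrier[OF x]
    have "(x \<otimes> w \<otimes> s) \<otimes> (b \<otimes> v) = x \<otimes> v \<otimes> (w \<otimes> (b \<otimes> s))"
      using car by (simp add: m_ac)
    also have "\<dots> = w \<otimes> t \<otimes> (x \<otimes> (a \<otimes> v))"
      unfolding eq[symmetric] using car by (simp add: m_ac)
    also have "\<dots> = (x \<otimes> w \<otimes> s) \<otimes> (c \<otimes> t)"
      unfolding eq' using car by (simp add: m_ac)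
    finally show "(c, v) \<in> loc_frac R S b t"
      using c v x w s S_mult by (auto simp: loc_frac_def)
  qed
  show ?thesis using *[OF assms] *[OF b a t s w eq[symmetric]] by blast
qed

lemma loc_frac_self: "a \<in> carrier R \<Longrightarrow> s \<in> S \<Longrightarrow> (a, s) \<in> loc_frac R S a s"
  using S_one by (auto simp: loc_frac_def)

lemma loc_fracD:
  assumes "(b, t) \<in> loc_frac R S a s" "a \<in> carrier R" "s \<in> S"
  shows "b \<in> carrier R" "t \<in> S" "loc_frac R S b t = loc_frac R S a s"
proof -
  from assms(1) obtain w where "b \<in> carrier R" "t \<in> S" "w \<in> S" "w \<otimes> (a \<otimes> t) = w \<otimes> (b \<otimes> s)"
    by (auto simp: loc_frac_def)
  then show "b \<in> carrier R" "t \<in> S" "loc_frac R S b t = loc_frac R S a s"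
    using loc_frac_eqI[OF assms(2) _ assms(3)] by auto
qed

lemma loc_frac_eqD:
  assumes "loc_frac R S a s = loc_frac R S b t" "b \<in> carrier R" "t \<in> S"
  shows "\<exists>w\<in>S. w \<otimes> (a \<otimes> t) = w \<otimes> (b \<otimes> s)"
proof -
  have "(b, t) \<in> loc_frac R S a s" using loc_frac_self[OF assms(2,3)] by (simp only: assms(1))
  then show ?thesis by (simp add: loc_frac_def)
qed

text \<open>\<open>localization\<close> and \<open>loc_map\<close> take unions over all
  representatives. Such a union is a single class as soon as the value is the same for every
  representative, because a class is never empty.\<close>

lemma union_loc_frac:
  assumes "a \<in> carrier R" "s \<in> S"
    and "\<And>b t. b \<in> carrier R \<Longrightarrow> t \<in> S \<Longrightarrow> loc_frac R S b t = loc_frac R S a s \<Longrightarrow> F b t = Z"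
  shows "(\<Union>(b, t)\<in>loc_frac R S a s. F b t) = Z"
proof -
  have "F b t = Z" if "(b, t) \<in> loc_frac R S a s" for b t
    using assms(3) loc_fracD[OF that assms(1,2)] by blast
  then show ?thesis using loc_frac_self[OF assms(1,2)] by fastforce
qed

lemma localization_mult:
  assumes a: "a \<in> carrier R" and s: "s \<in> S" and b: "b \<in> carrier R" and t: "t \<in> S"
  shows "loc_frac R S a s \<otimes>\<^bsub>localization R S\<^esub> loc_frac R S b t = loc_frac R S (a \<otimes> b) (s \<otimes> t)"
proof -
  have "loc_frac R S (a' \<otimes> b') (s' \<otimes> t') = loc_frac R S (a \<otimes> b) (s \<otimes> t)"
    if a': "a' \<in> carrier R" and s': "s' \<in> S" and 1: "loc_frac R S a' s' = loc_frac R S a s"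
      and b': "b' \<in> carrier R" and t': "t' \<in> S" and 2: "loc_frac R S b' t' = loc_frac R S b t" for a' b' s' t'
  proof -
    obtain w where w: "w \<in> S" "w \<otimes> (a' \<otimes> s) = w \<otimes> (a \<otimes> s')" using loc_frac_eqD[OF 1 a s] by blast
    obtain v where v: "v \<in> S" "v \<otimes> (b' \<otimes> t) = v \<otimes> (b \<otimes> t')" using loc_frac_eqD[OF 2 b t] by blast
    note car = a b a' b' S_carrier[OF s] S_carrier[OF t] S_carrier[OF s'] S_carrier[OF t']
      S_carrier[OF w(1)] S_carrier[OF v(1)]
    have "(w \<otimes> v) \<otimes> ((a' \<otimes> b') \<otimes> (s \<otimes> t)) = (w \<otimes> (a' \<otimes> s)) \<otimes> (v \<otimes> (b' \<otimes> t))"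
      using car by (simp add: m_ac)
    also have "\<dots> = (w \<otimes> v) \<otimes> ((a \<otimes> b) \<otimes> (s' \<otimes> t'))"
      unfolding w(2) v(2) using car by (simp add: m_ac)
    finally show ?thesis
      by (intro loc_frac_eqI[of _ _ _ _ "w \<otimes> v"]) (use assms that w v S_mult in auto)
  qed
  note * = this
  show ?thesis
    unfolding localization_def monoid.simps ring.simps
    by (rule union_loc_frac[OF a s], rule union_loc_frac[OF b t]) (rule *)
qed

lemma localization_add:
  assumes a: "a \<in> carrier R" and s: "s \<in> S" and b: "b \<in> carrier R" and t: "t \<in> S"
  shows "loc_frac R S a s \<oplus>\<^bsub>localization R S\<^esub> loc_frac R S b t =
    loc_frac R S (a \<otimes> t \<oplus> b \<otimes> s) (s \<otimes> t)"
proof -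
  have "loc_frac R S (a' \<otimes> t' \<oplus> b' \<otimes> s') (s' \<otimes> t') = loc_frac R S (a \<otimes> t \<oplus> b \<otimes> s) (s \<otimes> t)"
    if a': "a' \<in> carrier R" and s': "s' \<in> S" and 1: "loc_frac R S a' s' = loc_frac R S a s"
      and b': "b' \<in> carrier R" and t': "t' \<in> S" and 2: "loc_frac R S b' t' = loc_frac R S b t" for a' b' s' t'
  proof -
    obtain w where w: "w \<in> S" "w \<otimes> (a' \<otimes> s) = w \<otimes> (a \<otimes> s')" using loc_frac_eqD[OF 1 a s] by blast
    obtain v where v: "v \<in> S" "v \<otimes> (b' \<otimes> t) = v \<otimes> (b \<otimes> t')" using loc_frac_eqD[OF 2 b t] by blast
    note car = a b a' b' S_carrier[OF s] S_carrier[OF t] S_carrier[OF s'] S_carrier[OF t']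
      S_carrier[OF w(1)] S_carrier[OF v(1)]
    have "(w \<otimes> v) \<otimes> ((a' \<otimes> t' \<oplus> b' \<otimes> s') \<otimes> (s \<otimes> t)) =
        (v \<otimes> t' \<otimes> t) \<otimes> (w \<otimes> (a' \<otimes> s)) \<oplus> (w \<otimes> s' \<otimes> s) \<otimes> (v \<otimes> (b' \<otimes> t))"
      using car by (simp add: m_ac r_distr l_distr)
    also have "\<dots> = (w \<otimes> v) \<otimes> ((a \<otimes> t \<oplus> b \<otimes> s) \<otimes> (s' \<otimes> t'))"
      unfolding w(2) v(2) using car by (simp add: m_ac r_distr l_distr)
    finally show ?thesis
      by (intro loc_frac_eqI[of _ _ _ _ "w \<otimes> v"]) (use assms that w v S_mult S_carrier in auto)
  qed
  note * = this
  show ?thesis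
    unfolding localization_def monoid.simps ring.simps
    by (rule union_loc_frac[OF a s], rule union_loc_frac[OF b t]) (rule *)
qed

lemma carrier_localization:
  "carrier (localization R S) = {loc_frac R S a s | a s. a \<in> carrier R \<and> s \<in> S}"
  and one_localization: "\<one>\<^bsub>localization R S\<^esub> = loc_frac R S \<one> \<one>"
  by (simp_all add: localization_def)

end

lemma cring_localization_mult_closure:
  assumes "cring R" "G \<subseteq> carrier R"
  shows "cring_localization R (mult_closure R G)"
proof -
  interpret cring R by fact
  show ?thesis
    by unfold_locales
      (use mult_closure_subset[OF ring_axioms assms(2)] in \<open>auto intro: mult_closure.intros\<close>)
qed

text \<open>The map \<open>h\<close> need be neither injective nor surjective: it suffices that
  kernel elements are killed by denominators, and that each \<open>b\<close> becomes an image after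
  multiplication by some \<open>h s\<close>. In the latter case \<open>b / h t\<close> is the image
  of \<open>a / (s t)\<close>.\<close>

lemma loc_map_ring_iso:
  assumes Q: "cring Q" and B: "cring B" and h: "h \<in> ring_hom Q B" and U: "U \<subseteq> carrier Q"
    and inj: "\<And>a. a \<in> carrier Q \<Longrightarrow> h a = \<zero>\<^bsub>B\<^esub> \<Longrightarrow> \<exists>w\<in>mult_closure Q U. w \<otimes>\<^bsub>Q\<^esub> a = \<zero>\<^bsub>Q\<^esub>"
    and surj: "\<And>b. b \<in> carrier B \<Longrightarrow> \<exists>a\<in>carrier Q. \<exists>s\<in>mult_closure Q U. b \<otimes>\<^bsub>B\<^esub> h s = h a"
  shows "loc_map B (mult_closure B (h ` U)) h \<in>
    ring_iso (localization Q (mult_closure Q U)) (localization B (mult_closure B (h ` U)))"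
proof -
  define S' where "S' = mult_closure Q U"
  define S where "S = mult_closure B (h ` U)"
  interpret Q: cring_localization Q S'
    unfolding S'_def using Q U by (rule cring_localization_mult_closure)
  have hU: "h ` U \<subseteq> carrier B" using U ring_hom_closed[OF h] by auto
  interpret B: cring_localization B S
    unfolding S_def using B hU by (rule cring_localization_mult_closure)
  interpret h: ring_hom_cring Q B h
    by unfold_locales (rule h)
  have S: "S = h ` S'"
    unfolding S_def S'_def using h Q.ring_axioms U by (rule mult_closure_image)
  have hS: "h s \<in> S" if "s \<in> S'" for s using that S by auto
  have f: "loc_map B S h (loc_frac Q S' a s) = loc_frac B S (h a) (h s)"
    if a: "a \<in> carrier Q" and s: "s \<in> S'" for a s
    unfolding loc_map_def
  proof (rule Q.union_loc_frac[OF a s])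
    fix b t assume b: "b \<in> carrier Q" and t: "t \<in> S'" and eq: "loc_frac Q S' b t = loc_frac Q S' a s"
    obtain w where w: "w \<in> S'" "w \<otimes>\<^bsub>Q\<^esub> (b \<otimes>\<^bsub>Q\<^esub> s) = w \<otimes>\<^bsub>Q\<^esub> (a \<otimes>\<^bsub>Q\<^esub> t)"
      using Q.loc_frac_eqD[OF eq a s] by blast
    have "h (w \<otimes>\<^bsub>Q\<^esub> (b \<otimes>\<^bsub>Q\<^esub> s)) = h (w \<otimes>\<^bsub>Q\<^esub> (a \<otimes>\<^bsub>Q\<^esub> t))" using w(2) by simp
    then have "h w \<otimes>\<^bsub>B\<^esub> (h b \<otimes>\<^bsub>B\<^esub> h s) = h w \<otimes>\<^bsub>B\<^esub> (h a \<otimes>\<^bsub>B\<^esub> h t)"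
      using a b s t w(1) Q.S_carrier by simp
    then show "loc_frac B S (h b) (h t) = loc_frac B S (h a) (h s)"
      by (intro B.loc_frac_eqI[of _ _ _ _ "h w"]) (use a b s t w(1) hS in auto)
  qed
  have hom: "loc_map B S h \<in> ring_hom (localization Q S') (localization B S)"
  proof (rule ring_hom_memI)
    fix P assume "P \<in> carrier (localization Q S')"
    then obtain a s where P: "P = loc_frac Q S' a s" and a: "a \<in> carrier Q" and s: "s \<in> S'"
      by (auto simp: Q.carrier_localization)
    then show "loc_map B S h P \<in> carrier (localization B S)"
      using f[OF a s] hS[OF s] by (auto simp: B.carrier_localization)
    fix Y assume "Y \<in> carrier (localization Q S')"
    then obtain b t where Y: "Y = loc_frac Q S' b t" and b: "b \<in> carrier Q" and t: "t \<in> S'"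
      by (auto simp: Q.carrier_localization)
    show "loc_map B S h (P \<otimes>\<^bsub>localization Q S'\<^esub> Y) =
        loc_map B S h P \<otimes>\<^bsub>localization B S\<^esub> loc_map B S h Y"
      using a b s t hS Q.S_carrier
      by (simp add: P Y Q.localization_mult B.localization_mult f Q.S_mult)
    show "loc_map B S h (P \<oplus>\<^bsub>localization Q S'\<^esub> Y) =
        loc_map B S h P \<oplus>\<^bsub>localization B S\<^esub> loc_map B S h Y"
      using a b s t hS Q.S_carrier
      by (simp add: P Y Q.localization_add B.localization_add f Q.S_mult)
  next
    show "loc_map B S h \<one>\<^bsub>localization Q S'\<^esub> = \<one>\<^bsub>localization B S\<^esub>"
      by (simp add: Q.one_localization B.one_localization f Q.S_one)
  qed
  have "inj_on (loc_map B S h) (carrier (localization Q S'))"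
  proof (rule inj_onI)
    fix P Y assume XY: "P \<in> carrier (localization Q S')" "Y \<in> carrier (localization Q S')"
      and eq: "loc_map B S h P = loc_map B S h Y"
    then obtain a s b t where P: "P = loc_frac Q S' a s" and a: "a \<in> carrier Q" and s: "s \<in> S'"
      and Y: "Y = loc_frac Q S' b t" and b: "b \<in> carrier Q" and t: "t \<in> S'"
      by (auto simp: Q.carrier_localization)
    from eq have "loc_frac B S (h a) (h s) = loc_frac B S (h b) (h t)"
      using a b s t by (simp add: P Y f)
    from B.loc_frac_eqD[OF this] obtain v where v: "v \<in> S'"
      and eqv: "h v \<otimes>\<^bsub>B\<^esub> (h a \<otimes>\<^bsub>B\<^esub> h t) = h v \<otimes>\<^bsub>B\<^esub> (h b \<otimes>\<^bsub>B\<^esub> h s)"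
      using b t hS by (auto simp: S)
    \<comment> \<open>Cross-multiplying two fractions with equal images yields an element of the
      kernel. The denominator \<open>w\<close> that kills it is then absorbed into the witness
      \<open>w \<otimes> v\<close> of equality.\<close>
    define d where "d = v \<otimes>\<^bsub>Q\<^esub> (a \<otimes>\<^bsub>Q\<^esub> t) \<ominus>\<^bsub>Q\<^esub> v \<otimes>\<^bsub>Q\<^esub> (b \<otimes>\<^bsub>Q\<^esub> s)"
    note car = a b Q.S_carrier[OF s] Q.S_carrier[OF t] Q.S_carrier[OF v]
    have "h d = \<zero>\<^bsub>B\<^esub>"
      using car eqv by (simp add: d_def Q.minus_eq B.r_neg)
    moreover have d: "d \<in> carrier Q" using car by (simp add: d_def)
    ultimately obtain w where w: "w \<in> S'" "w \<otimes>\<^bsub>Q\<^esub> d = \<zero>\<^bsub>Q\<^esub>"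
      using inj unfolding S'_def by blast
    note car = car Q.S_carrier[OF w(1)]
    have "w \<otimes>\<^bsub>Q\<^esub> (v \<otimes>\<^bsub>Q\<^esub> (a \<otimes>\<^bsub>Q\<^esub> t)) \<ominus>\<^bsub>Q\<^esub> w \<otimes>\<^bsub>Q\<^esub> (v \<otimes>\<^bsub>Q\<^esub> (b \<otimes>\<^bsub>Q\<^esub> s)) = \<zero>\<^bsub>Q\<^esub>"
      using w(2) car by (simp add: d_def Q.minus_eq Q.r_distr Q.r_minus)
    then have "(w \<otimes>\<^bsub>Q\<^esub> v) \<otimes>\<^bsub>Q\<^esub> (a \<otimes>\<^bsub>Q\<^esub> t) = (w \<otimes>\<^bsub>Q\<^esub> v) \<otimes>\<^bsub>Q\<^esub> (b \<otimes>\<^bsub>Q\<^esub> s)"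
      using car by (simp add: Q.m_assoc Q.r_right_minus_eq)
    then show "P = Y"
      unfolding P Y by (intro Q.loc_frac_eqI[of _ _ _ _ "w \<otimes>\<^bsub>Q\<^esub> v"]) (use a b s t w v Q.S_mult in auto)
  qed
  moreover have "loc_map B S h ` carrier (localization Q S') = carrier (localization B S)"
  proof
    show "loc_map B S h ` carrier (localization Q S') \<subseteq> carrier (localization B S)"
      using ring_hom_closed[OF hom] by auto
    show "carrier (localization B S) \<subseteq> loc_map B S h ` carrier (localization Q S')"
    proof
      fix Z assume "Z \<in> carrier (localization B S)"
      then obtain b t where Z: "Z = loc_frac B S b (h t)" and b: "b \<in> carrier B" and t: "t \<in> S'"
        unfolding B.carrier_localization by (auto simp: S)
      obtain a s where a: "a \<in> carrier Q" and s: "s \<in> S'" and eq: "b \<otimes>\<^bsub>B\<^esub> h s = h a"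
        using surj[OF b] unfolding S'_def by blast
      note car = a b Q.S_carrier[OF s] Q.S_carrier[OF t]
      have "h a \<otimes>\<^bsub>B\<^esub> h t = b \<otimes>\<^bsub>B\<^esub> h (s \<otimes>\<^bsub>Q\<^esub> t)"
        using car by (simp add: eq[symmetric] B.m_assoc)
      then have "loc_frac B S (h a) (h (s \<otimes>\<^bsub>Q\<^esub> t)) = loc_frac B S b (h t)"
        by (intro B.loc_frac_eqI[of _ _ _ _ "\<one>\<^bsub>B\<^esub>"])
          (use a b s t hS B.S_one Q.S_mult in auto)
      then have "Z = loc_map B S h (loc_frac Q S' a (s \<otimes>\<^bsub>Q\<^esub> t))"
        using a s t by (simp add: Z f Q.S_mult)
      then show "Z \<in> loc_map B S h ` carrier (localization Q S')"
        using a s t Q.S_mult unfolding Q.carrier_localization by blast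
    qed
  qed
  ultimately show ?thesis
    using hom by (simp add: ring_iso_def bij_betw_def S_def S'_def)
qed

section \<open>Evaluation of polynomials in the fraction field\<close>

lemma to_frac_simps [simp]:
  "to_frac 0 = 0" "to_frac 1 = 1"
  "to_frac (p + q) = to_frac p + to_frac q"
  "to_frac (p - q) = to_frac p - to_frac q"
  "to_frac (p * q) = to_frac p * to_frac q"
  "to_frac (- p) = - to_frac p"
  "to_frac p = to_frac q \<longleftrightarrow> p = q"
  by (simp_all add: to_frac_def Zero_fract_def One_fract_def eq_fract)

lemma to_frac_eq_0_iff [simp]: "to_frac p = 0 \<longleftrightarrow> p = 0"
  using to_frac_simps(1,7) by metis

lemma mconst_simps [simp]:
  "mconst 0 = 0" "mconst 1 = 1" "mconst (a + b) = mconst a + mconst b"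
  "mconst (a * b) = mconst a * mconst b"
  by (simp_all add: mconst_def single_add mult_single)

definition mono_eval :: "(nat \<Rightarrow> 'a::comm_ring_1) \<Rightarrow> (nat \<Rightarrow>\<^sub>0 nat) \<Rightarrow> 'a" where
  "mono_eval Y m = (\<Prod>v\<in>Poly_Mapping.keys m. Y v ^ Poly_Mapping.lookup m v)"

definition poly_eval :: "(nat \<Rightarrow> 'k mpoly fract) \<Rightarrow> 'k::field mpoly \<Rightarrow> 'k mpoly fract" where
  "poly_eval Y p = (\<Sum>m\<in>Poly_Mapping.keys p. to_frac (mconst (Poly_Mapping.lookup p m)) * mono_eval Y m)"

lemma mono_eval_superset:
  assumes "finite A" "Poly_Mapping.keys m \<subseteq> A"
  shows "mono_eval Y m = (\<Prod>v\<in>A. Y v ^ Poly_Mapping.lookup m v)"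
  unfolding mono_eval_def
  by (rule prod.mono_neutral_left) (use assms in \<open>auto simp: in_keys_iff\<close>)

lemma mono_eval_add: "mono_eval Y (m + m') = mono_eval Y m * mono_eval Y m'"
proof -
  let ?A = "Poly_Mapping.keys m \<union> Poly_Mapping.keys m'"
  have "mono_eval Y x = (\<Prod>v\<in>?A. Y v ^ Poly_Mapping.lookup x v)" if "x \<in> {m, m', m + m'}" for x
    using that keys_add[of m m'] by (intro mono_eval_superset) auto
  then show ?thesis by (simp add: lookup_add power_add prod.distrib)
qed

lemma poly_eval_superset:
  assumes "finite A" "Poly_Mapping.keys p \<subseteq> A"
  shows "poly_eval Y p = (\<Sum>m\<in>A. to_frac (mconst (Poly_Mapping.lookup p m)) * mono_eval Y m)"
  unfolding poly_eval_def
  by (rule sum.mono_neutral_left) (use assms in \<open>auto simp: in_keys_iff\<close>)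

lemma poly_eval_add [simp]: "poly_eval Y (p + q) = poly_eval Y p + poly_eval Y q"
proof -
  let ?A = "Poly_Mapping.keys p \<union> Poly_Mapping.keys q"
  have "poly_eval Y x = (\<Sum>m\<in>?A. to_frac (mconst (Poly_Mapping.lookup x m)) * mono_eval Y m)"
    if "x \<in> {p, q, p + q}" for x
    using that keys_add[of p q] by (intro poly_eval_superset) auto
  then show ?thesis by (simp add: lookup_add distrib_right sum.distrib)
qed

lemma poly_eval_0 [simp]: "poly_eval Y 0 = 0"
  by (simp add: poly_eval_def)

lemma poly_eval_uminus [simp]: "poly_eval Y (- p) = - poly_eval Y p"
  using poly_eval_add[of Y p "- p"] by (simp add: eq_neg_iff_add_eq_0 add.commute)

lemma poly_eval_diff [simp]: "poly_eval Y (p - q) = poly_eval Y p - poly_eval Y q"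
  using poly_eval_add[of Y p "- q"] by simp

lemma poly_eval_sum: "poly_eval Y (sum f A) = (\<Sum>a\<in>A. poly_eval Y (f a))"
  by (induction A rule: infinite_finite_induct) auto

lemma poly_eval_single: "poly_eval Y (Poly_Mapping.single m c) = to_frac (mconst c) * mono_eval Y m"
  by (simp add: poly_eval_def)

lemma poly_mapping_sum_single: "p = (\<Sum>m\<in>Poly_Mapping.keys p. Poly_Mapping.single m (Poly_Mapping.lookup p m))"
  by (rule poly_mapping_eqI) (auto simp: lookup_sum lookup_single when_def in_keys_iff)

lemma poly_eval_mult [simp]: "poly_eval Y (p * q) = poly_eval Y p * poly_eval Y q"
proof -
  let ?s = "\<lambda>p m. Poly_Mapping.single m (Poly_Mapping.lookup p m)"
  have "p * q = (\<Sum>m\<in>Poly_Mapping.keys p. \<Sum>m'\<in>Poly_Mapping.keys q. ?s p m * ?s q m')"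
    unfolding sum_product[symmetric] by (simp flip: poly_mapping_sum_single)
  then have "poly_eval Y (p * q) =
      (\<Sum>m\<in>Poly_Mapping.keys p. \<Sum>m'\<in>Poly_Mapping.keys q. poly_eval Y (?s p m * ?s q m'))"
    by (simp only: poly_eval_sum)
  also have "\<dots> = (\<Sum>m\<in>Poly_Mapping.keys p. \<Sum>m'\<in>Poly_Mapping.keys q.
      (to_frac (mconst (Poly_Mapping.lookup p m)) * mono_eval Y m) *
      (to_frac (mconst (Poly_Mapping.lookup q m')) * mono_eval Y m'))"
    by (simp add: mult_single poly_eval_single mono_eval_add mult_ac)
  also have "\<dots> = poly_eval Y p * poly_eval Y q"
    unfolding sum_product[symmetric] by (simp add: poly_eval_def)
  finally show ?thesis .
qed

lemma poly_eval_mconst [simp]: "poly_eval Y (mconst c) = to_frac (mconst c)"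
  unfolding mconst_def by (simp add: poly_eval_single mono_eval_def mconst_def)

lemma poly_eval_1 [simp]: "poly_eval Y 1 = 1"
  using poly_eval_mconst[of Y 1] by simp

lemma poly_eval_mvar: "poly_eval Y (mvar a l) = Y (prod_encode (a, l))"
  by (simp add: mvar_def poly_eval_single mono_eval_def)

lemma mvar_nonzero: "(mvar a l :: 'k::field mpoly) \<noteq> 0"
  unfolding mvar_def by (metis lookup_single_eq lookup_zero zero_neq_one)

section \<open>The coordinate ring and the Laurent polynomial rings\<close>

lemma ring_of_type_algebra_simps [simp]:
  "carrier ring_of_type_algebra = UNIV"
  "monoid.mult ring_of_type_algebra = (*)" "add ring_of_type_algebra = (+)"
  "\<one>\<^bsub>ring_of_type_algebra\<^esub> = 1" "\<zero>\<^bsub>ring_of_type_algebra\<^esub> = 0"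
  by (simp_all add: ring_of_type_algebra_def fun_eq_iff)

lemma a_inv_type_algebra [simp]:
  "\<ominus>\<^bsub>ring_of_type_algebra\<^esub> x = - (x :: 'a::comm_ring_1)"
proof -
  interpret cring "ring_of_type_algebra :: 'a ring" by (rule cring_from_type_algebra)
  show ?thesis by (rule minus_equality) auto
qed

lemma cring_type_algebra_carrier_update:
  assumes "1 \<in> A" "\<And>x. x \<in> A \<Longrightarrow> - x \<in> A" "\<And>x y. x \<in> A \<Longrightarrow> y \<in> A \<Longrightarrow> x + y \<in> A"
    "\<And>x y. x \<in> A \<Longrightarrow> y \<in> A \<Longrightarrow> x * y \<in> (A :: 'a::comm_ring_1 set)"
  shows "cring (ring_of_type_algebra\<lparr>carrier := A\<rparr>)"
proof -
  interpret cring "ring_of_type_algebra :: 'a ring" by (rule cring_from_type_algebra)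
  have "subring A ring_of_type_algebra"
    by (rule subringI) (use assms in auto)
  then show ?thesis
    using subcring_iff[of A] subcringI'[of A] by auto
qed

definition chart_vars :: "nat \<Rightarrow> nat \<Rightarrow> nat \<Rightarrow> nat set" where
  "chart_vars n i j = {prod_encode (a, l) | a l. a \<in> {i, j} \<and> l \<in> {1..n} - {i, j}}"

lemma carrier_chart_ring:
  "carrier (chart_ring n i j) =
    {p. \<forall>m\<in>Poly_Mapping.keys p. Poly_Mapping.keys m \<subseteq> chart_vars n i j}"
  by (simp add: chart_ring_def chart_vars_def)

lemma chart_ring_simps [simp]:
  "monoid.mult (chart_ring n i j) = (*)" "add (chart_ring n i j) = (+)"
  "\<one>\<^bsub>chart_ring n i j\<^esub> = 1" "\<zero>\<^bsub>chart_ring n i j\<^esub> = 0"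
  by (simp_all add: chart_ring_def)

lemma keys_uminus: "Poly_Mapping.keys (- p) = Poly_Mapping.keys (p :: 'a \<Rightarrow>\<^sub>0 'b::ab_group_add)"
  by (auto simp: in_keys_iff)

lemma chart_ring_closed:
  fixes p q :: "'k::field mpoly" and c :: 'k
  shows "mconst c \<in> carrier (chart_ring n i j)"
    and "1 \<in> carrier (chart_ring n i j :: 'k mpoly ring)"
    and "p \<in> carrier (chart_ring n i j) \<Longrightarrow> - p \<in> carrier (chart_ring n i j)"
    and "p \<in> carrier (chart_ring n i j) \<Longrightarrow> q \<in> carrier (chart_ring n i j) \<Longrightarrow>
      p + q \<in> carrier (chart_ring n i j)"
    and "p \<in> carrier (chart_ring n i j) \<Longrightarrow> q \<in> carrier (chart_ring n i j) \<Longrightarrow>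
      p * q \<in> carrier (chart_ring n i j)"
proof -
  have const: "mconst c \<in> carrier (chart_ring n i j)" for c :: 'k
    by (simp add: carrier_chart_ring mconst_def)
  then show "mconst c \<in> carrier (chart_ring n i j)" .
  from const[of 1] show "1 \<in> carrier (chart_ring n i j :: 'k mpoly ring)" by simp
  show "p \<in> carrier (chart_ring n i j) \<Longrightarrow> - p \<in> carrier (chart_ring n i j)"
    by (simp add: carrier_chart_ring keys_uminus)
  show "p \<in> carrier (chart_ring n i j) \<Longrightarrow> q \<in> carrier (chart_ring n i j) \<Longrightarrow>
      p + q \<in> carrier (chart_ring n i j)"
    using keys_add[of p q] unfolding carrier_chart_ring by blast
  assume pq: "p \<in> carrier (chart_ring n i j)" "q \<in> carrier (chart_ring n i j)"
  show "p * q \<in> carrier (chart_ring n i j)"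
    unfolding carrier_chart_ring
  proof (intro CollectI ballI)
    fix m assume "m \<in> Poly_Mapping.keys (p * q)"
    then obtain a b where "m = a + b" "a \<in> Poly_Mapping.keys p" "b \<in> Poly_Mapping.keys q"
      using keys_mult[of p q] by blast
    then show "Poly_Mapping.keys m \<subseteq> chart_vars n i j"
      using pq keys_add[of a b] unfolding carrier_chart_ring by blast
  qed
qed

lemma cring_chart_ring: "cring (chart_ring n i j :: 'k::field mpoly ring)"
proof -
  have "chart_ring n i j = ring_of_type_algebra\<lparr>carrier := carrier (chart_ring n i j :: 'k mpoly ring)\<rparr>"
    by (simp add: chart_ring_def)
  moreover have "cring (ring_of_type_algebra\<lparr>carrier := carrier (chart_ring n i j :: 'k mpoly ring)\<rparr>)"
    by (intro cring_type_algebra_carrier_update chart_ring_closed)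
  ultimately show ?thesis by metis
qed

lemma row_in_chart_ring:
  assumes "k \<in> {1..n}"
  shows "(row_i i j k :: 'k::field mpoly) \<in> carrier (chart_ring n i j)"
    and "(row_j i j k :: 'k::field mpoly) \<in> carrier (chart_ring n i j)"
proof -
  have 0: "(0 :: 'k mpoly) \<in> carrier (chart_ring n i j)"
    using chart_ring_closed(1)[of 0] by simp
  show "(row_i i j k :: 'k mpoly) \<in> carrier (chart_ring n i j)"
    "(row_j i j k :: 'k mpoly) \<in> carrier (chart_ring n i j)"
    using 0 chart_ring_closed(2,3) assms
    by (auto simp: row_i_def row_j_def) (auto simp: carrier_chart_ring mvar_def chart_vars_def)
qed

lemma ucoord_in_chart_ring:
  assumes "k \<in> {1..n}" "l \<in> {1..n}"
  shows "(ucoord i j k l :: 'k::field mpoly) \<in> carrier (chart_ring n i j)"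
  unfolding ucoord_def diff_conv_add_uminus
  using row_in_chart_ring[OF assms(1)] row_in_chart_ring[OF assms(2)]
  by (intro chart_ring_closed) auto

lemma laurent_ring_simps [simp]:
  "monoid.mult (laurent_ring i j A D) = (*)" "add (laurent_ring i j A D) = (+)"
  "\<one>\<^bsub>laurent_ring i j A D\<^esub> = 1" "\<zero>\<^bsub>laurent_ring i j A D\<^esub> = 0"
  by (simp_all add: laurent_ring_def)

lemma laurent_closed:
  fixes x y :: "'k::field mpoly fract" and c :: 'k
  shows "to_frac (mconst c) \<in> carrier (laurent_ring i j A D)"
    and "{k, l} \<in> A \<Longrightarrow> to_frac (ucoord i j k l :: 'k mpoly) \<in> carrier (laurent_ring i j A D)"
    and "{k, l} \<in> D \<Longrightarrow> inverse (to_frac (ucoord i j k l :: 'k mpoly)) \<in> carrier (laurent_ring i j A D)"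
    and "1 \<in> carrier (laurent_ring i j A D :: 'k mpoly fract ring)"
    and "x \<in> carrier (laurent_ring i j A D) \<Longrightarrow> - x \<in> carrier (laurent_ring i j A D)"
    and "x \<in> carrier (laurent_ring i j A D) \<Longrightarrow> y \<in> carrier (laurent_ring i j A D) \<Longrightarrow>
      x + y \<in> carrier (laurent_ring i j A D)"
    and "x \<in> carrier (laurent_ring i j A D) \<Longrightarrow> y \<in> carrier (laurent_ring i j A D) \<Longrightarrow>
      x - y \<in> carrier (laurent_ring i j A D)"
    and "x \<in> carrier (laurent_ring i j A D) \<Longrightarrow> y \<in> carrier (laurent_ring i j A D) \<Longrightarrow>
      x * y \<in> carrier (laurent_ring i j A D)"
proof -
  show "to_frac (mconst c) \<in> carrier (laurent_ring i j A D)"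
    "{k, l} \<in> A \<Longrightarrow> to_frac (ucoord i j k l :: 'k mpoly) \<in> carrier (laurent_ring i j A D)"
    "{k, l} \<in> D \<Longrightarrow> inverse (to_frac (ucoord i j k l :: 'k mpoly)) \<in> carrier (laurent_ring i j A D)"
    by (auto simp: laurent_ring_def intro!: generate_ring.incl)
  show "1 \<in> carrier (laurent_ring i j A D :: 'k mpoly fract ring)"
    using generate_ring.one[of ring_of_type_algebra] by (simp add: laurent_ring_def)
  show uminus: "- x \<in> carrier (laurent_ring i j A D)" if "x \<in> carrier (laurent_ring i j A D)"
    for x :: "'k mpoly fract"
    using generate_ring.a_inv[of x ring_of_type_algebra] that by (simp add: laurent_ring_def)
  show add: "x + y \<in> carrier (laurent_ring i j A D)"
    if "x \<in> carrier (laurent_ring i j A D)" "y \<in> carrier (laurent_ring i j A D)" for x y :: "'k mpoly fract"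
    using generate_ring.eng_add[of x ring_of_type_algebra _ y] that by (simp add: laurent_ring_def)
  show "x \<in> carrier (laurent_ring i j A D) \<Longrightarrow> y \<in> carrier (laurent_ring i j A D) \<Longrightarrow>
      x - y \<in> carrier (laurent_ring i j A D)"
    using add[of x "- y"] uminus[of y] by simp
  show "x \<in> carrier (laurent_ring i j A D) \<Longrightarrow> y \<in> carrier (laurent_ring i j A D) \<Longrightarrow>
      x * y \<in> carrier (laurent_ring i j A D)"
    using generate_ring.eng_mult[of x ring_of_type_algebra _ y] by (simp add: laurent_ring_def)
qed

lemma laurent_induct [consumes 1, case_names const coord inverse_coord uminus add mult]:
  fixes x :: "'k::field mpoly fract"
  assumes "x \<in> carrier (laurent_ring i j A D)"
    and "\<And>c. P (to_frac (mconst c))"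
    and "\<And>k l. {k, l} \<in> A \<Longrightarrow> P (to_frac (ucoord i j k l))"
    and "\<And>k l. {k, l} \<in> D \<Longrightarrow> P (inverse (to_frac (ucoord i j k l)))"
    and "\<And>x. x \<in> carrier (laurent_ring i j A D) \<Longrightarrow> P x \<Longrightarrow> P (- x)"
    and "\<And>x y. x \<in> carrier (laurent_ring i j A D) \<Longrightarrow> y \<in> carrier (laurent_ring i j A D) \<Longrightarrow>
      P x \<Longrightarrow> P y \<Longrightarrow> P (x + y)"
    and "\<And>x y. x \<in> carrier (laurent_ring i j A D) \<Longrightarrow> y \<in> carrier (laurent_ring i j A D) \<Longrightarrow>
      P x \<Longrightarrow> P y \<Longrightarrow> P (x * y)"
  shows "P x"
proof -
  have car: "carrier (laurent_ring i j A D :: 'k mpoly fract ring) =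
      generate_ring ring_of_type_algebra
        (range (\<lambda>c. to_frac (mconst c)) \<union> {to_frac (ucoord i j k l) | k l. {k, l} \<in> A} \<union>
         {inverse (to_frac (ucoord i j k l)) | k l. {k, l} \<in> D})"
    by (simp add: laurent_ring_def)
  from assms(1) show ?thesis
    unfolding car
  proof induction
    case one
    then show ?case using assms(2)[of 1] by simp
  next
    case (incl h)
    then show ?case using assms(2-4) by auto
  next
    case (a_inv h)
    then show ?case using assms(5)[of h] by (simp add: car)
  next
    case (eng_add h1 h2)
    then show ?case using assms(6)[of h1 h2] by (simp add: car)
  next
    case (eng_mult h1 h2)
    then show ?case using assms(7)[of h1 h2] by (simp add: car)
  qed
qed

lemma cring_laurent_ring: "cring (laurent_ring i j A D :: 'k::field mpoly fract ring)"
proof -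
  have "laurent_ring i j A D =
      ring_of_type_algebra\<lparr>carrier := carrier (laurent_ring i j A D :: 'k mpoly fract ring)\<rparr>"
    by (simp add: laurent_ring_def)
  moreover have
    "cring (ring_of_type_algebra\<lparr>carrier := carrier (laurent_ring i j A D :: 'k mpoly fract ring)\<rparr>)"
    by (intro cring_type_algebra_carrier_update laurent_closed)
  ultimately show ?thesis by metis
qed

lemma laurent_ring_mono:
  assumes "A \<subseteq> A'"
  shows "carrier (laurent_ring i j A D) \<subseteq> carrier (laurent_ring i j A' D :: 'k::field mpoly fract ring)"
proof
  fix x :: "'k mpoly fract" assume "x \<in> carrier (laurent_ring i j A D)"
  then show "x \<in> carrier (laurent_ring i j A' D)"
    by (induction rule: laurent_induct) (use assms in \<open>auto intro: laurent_closed\<close>)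
qed

section \<open>Edge splits of trees\<close>

text \<open>Used with \<open>D = E - {e}\<close>, where it says that two vertices lie on the same
  side of the edge \<open>e\<close>. In this way statements about paths turn into statements about
  splits.\<close>

definition linked :: "'v set set \<Rightarrow> 'v \<Rightarrow> 'v \<Rightarrow> bool" where
  "linked D a b \<longleftrightarrow> (a, b) \<in> {(u, v). {u, v} \<in> D}\<^sup>*"

lemma linked_refl [simp]: "linked D a a"
  by (simp add: linked_def)

lemma linked_trans: "linked D a b \<Longrightarrow> linked D b c \<Longrightarrow> linked D a c"
  by (simp add: linked_def)

lemma linked_sym: "linked D a b \<Longrightarrow> linked D b a"
proof -
  have "sym {(u, v). {u, v} \<in> D}" by (auto simp: sym_def insert_commute)
  then show "linked D a b \<Longrightarrow> linked D b a"
    unfolding linked_def by (metis sym_rtrancl symD)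
qed

lemma linked_edge: "{a, b} \<in> D \<Longrightarrow> linked D a b"
  by (auto simp: linked_def)

lemma edges_of_path_simps [simp]:
  "edges_of_path [] = {}" "edges_of_path [x] = {}"
  "edges_of_path (x # y # p) = insert {x, y} (edges_of_path (y # p))"
proof -
  show "edges_of_path (x # y # p) = insert {x, y} (edges_of_path (y # p))"
  proof (rule Set.equalityI; rule subsetI)
    fix e assume "e \<in> edges_of_path (x # y # p)"
    then obtain m where "e = {(x # y # p) ! m, (x # y # p) ! Suc m}" "Suc m < length (x # y # p)"
      unfolding edges_of_path_def by blast
    then show "e \<in> insert {x, y} (edges_of_path (y # p))"
      unfolding edges_of_path_def by (cases m) auto
  next
    fix e assume "e \<in> insert {x, y} (edges_of_path (y # p))"
    then consider "e = {x, y}" | m where "e = {(y # p) ! m, (y # p) ! Suc m}" "Suc m < length (y # p)"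
      unfolding edges_of_path_def by blast
    then show "e \<in> edges_of_path (x # y # p)"
    proof cases
      case 1
      then show ?thesis unfolding edges_of_path_def by (intro CollectI exI[of _ 0]) auto
    next
      case 2
      then show ?thesis unfolding edges_of_path_def by (intro CollectI exI[of _ "Suc m"]) auto
    qed
  qed
qed (simp_all add: edges_of_path_def)

lemma edges_of_path_subset: "e \<in> edges_of_path p \<Longrightarrow> e \<subseteq> set p"
  by (auto simp: edges_of_path_def)

lemma successively_iff_edges: "successively (\<lambda>a b. {a, b} \<in> D) p \<longleftrightarrow> edges_of_path p \<subseteq> D"
  by (induction p rule: induct_list012) auto

lemma edges_of_path_append:
  "edges_of_path (p @ x # q) = edges_of_path (p @ [x]) \<union> edges_of_path (x # q)"
proof (induction p rule: induct_list012)
  case (2 y)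
  then show ?case by (cases q) auto
qed auto

lemma edges_of_path_rev: "edges_of_path (rev p) = edges_of_path p"
proof (induction p rule: induct_list012)
  case (3 x y p)
  then show ?case
    using edges_of_path_append[of "rev p" y "[x]"] by (auto simp: insert_commute)
qed auto

lemma edge_of_path_split:
  "e \<in> edges_of_path p \<Longrightarrow> \<exists>p1 x y p2. p = p1 @ x # y # p2 \<and> e = {x, y}"
proof (induction p rule: induct_list012)
  case (3 x y p)
  then show ?case
    by simp (metis append_Cons append_Nil)
qed auto

lemma is_path_iff:
  "is_path D a b p \<longleftrightarrow> p \<noteq> [] \<and> hd p = a \<and> last p = b \<and> distinct p \<and> edges_of_path p \<subseteq> D"
  by (simp add: is_path_def successively_iff_edges)

lemma is_path_rev: "is_path D a b p \<Longrightarrow> is_path D b a (rev p)"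
  by (auto simp: is_path_iff edges_of_path_rev hd_rev last_rev)

lemma linked_hd_last: "p \<noteq> [] \<Longrightarrow> edges_of_path p \<subseteq> D \<Longrightarrow> linked D (hd p) (last p)"
proof (induction p rule: induct_list012)
  case (3 x y p)
  then show ?case by (auto intro: linked_trans[OF linked_edge[of x y]])
qed auto

lemma linked_imp_path:
  assumes "linked D a b"
  shows "\<exists>p. is_path D a b p"
  using assms unfolding linked_def
proof (induction rule: rtrancl_induct)
  case base
  have "is_path D a a [a]" by (simp add: is_path_iff)
  then show ?case by blast
next
  case (step y z)
  then obtain p where p: "is_path D a y p" by blast
  show ?case
  proof (cases "z \<in> set p")
    case True
    then obtain p1 p2 where "p = p1 @ z # p2" by (auto dest: split_list)
    with p have "is_path D a z (p1 @ [z])"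
      using edges_of_path_append[of p1 z p2] by (cases p1) (auto simp: is_path_iff)
    then show ?thesis by blast
  next
    case False
    obtain q where q: "p = q @ [y]" using p by (cases p rule: rev_cases) (auto simp: is_path_iff)
    have "is_path D a z (q @ [y, z])"
      using p False step(2) edges_of_path_append[of q y "[z]"] unfolding q
      by (cases q) (auto simp: is_path_iff)
    then show ?thesis by blast
  qed
qed

text \<open>The start \<open>x\<close> of a path without repetitions lies on exactly one of its
  edges, so the edge set determines the first step, and inductively the whole path.\<close>

lemma edges_of_path_inject:
  "distinct (x # p) \<Longrightarrow> distinct (x # q) \<Longrightarrow> edges_of_path (x # p) = edges_of_path (x # q) \<Longrightarrow> p = q"
proof (induction p arbitrary: x q)
  case Nil
  then show ?case by (cases q) auto
next
  case (Cons y p)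
  then obtain z r where q: "q = z # r" by (cases q) auto
  have notin: "{x, w} \<notin> edges_of_path (y # p)" "{x, w} \<notin> edges_of_path (z # r)" for w
    using Cons.prems edges_of_path_subset[of "{x, w}" "y # p"] edges_of_path_subset[of "{x, w}" "z # r"]
    unfolding q by auto
  have eq: "insert {x, y} (edges_of_path (y # p)) = insert {x, z} (edges_of_path (z # r))"
    using Cons.prems(3) unfolding q by simp
  then have "{x, y} = {x, z}" using notin(2)[of y] by blast
  then have "y = z" by (metis doubleton_eq_iff)
  moreover from this have "edges_of_path (y # p) = edges_of_path (y # r)"
    using eq insert_ident[OF notin(1)[of y] notin(2)[of y]] by simp
  ultimately show ?case using Cons.IH[of y r] Cons.prems(1,2) by (auto simp: q)
qed

lemma inner_vertices_nth: "0 < u \<Longrightarrow> Suc u < length p \<Longrightarrow> p ! u \<in> inner_vertices p"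
  unfolding inner_vertices_def in_set_conv_nth
  by (rule exI[of _ "u - 1"]) (auto simp: nth_butlast nth_tl)

lemma inner_vertices_Cons: "inner_vertices (x # q @ [y]) = set q"
  by (simp add: inner_vertices_def)

section \<open>Unique paths, and the two sides of an edge\<close>

locale tree =
  fixes V :: "'v set" and E :: "'v set set"
  assumes is_tree: "is_tree V E"
begin

lemma edge_subset: "e \<in> E \<Longrightarrow> e \<subseteq> V"
  and finite_V: "finite V"
  and path_exists: "a \<in> V \<Longrightarrow> b \<in> V \<Longrightarrow> \<exists>p. is_path E a b p"
  using is_tree by (auto simp: is_tree_def)

lemma finite_E: "finite E"
  using edge_subset finite_V by (meson PowI finite_Pow_iff finite_subset subsetI)

lemma edgeE:
  assumes "e \<in> E"
  obtains x y where "e = {x, y}" "x \<noteq> y" "x \<in> V" "y \<in> V"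
proof -
  have "card e = 2" using is_tree assms by (auto simp: is_tree_def)
  then obtain x y where "e = {x, y}" "x \<noteq> y" by (auto simp: card_2_iff)
  with edge_subset[OF assms] that show ?thesis by auto
qed

text \<open>A path from \<open>x\<close> to \<open>y\<close> that avoids the edge would close up
  with it to a cycle; it has at least three vertices because the only path with two vertices is the
  edge itself.\<close>

lemma not_linked_edge:
  assumes "{x, y} \<in> E" "x \<noteq> y"
  shows "\<not> linked (E - {{x, y}}) x y"
proof
  assume "linked (E - {{x, y}}) x y"
  from linked_imp_path[OF this] obtain p where p: "is_path (E - {{x, y}}) x y p" by blast
  have "3 \<le> length p"
  proof (rule ccontr)
    assume "\<not> 3 \<le> length p"
    then consider "p = []" | a where "p = [a]" | a b where "p = [a, b]"
      by (cases p; cases "tl p"; cases "tl (tl p)") auto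
    then show False using p assms(2) by cases (auto simp: is_path_iff)
  qed
  moreover have "distinct p" "successively (\<lambda>a b. {a, b} \<in> E) p" "{last p, hd p} \<in> E"
    using p assms by (auto simp: is_path_iff successively_iff_edges insert_commute)
  ultimately show False using is_tree unfolding is_tree_def by blast
qed

text \<open>The pieces of the path before and after \<open>e\<close> avoid \<open>e\<close>. If its
  removal left \<open>a\<close> and \<open>b\<close> linked, these pieces would therefore link the
  two ends of \<open>e\<close>, contradicting \<open>not_linked_edge\<close>.\<close>

lemma edges_of_path_iff:
  assumes p: "is_path E a b p"
  shows "e \<in> edges_of_path p \<longleftrightarrow> e \<in> E \<and> \<not> linked (E - {e}) a b"
proof
  assume "e \<in> E \<and> \<not> linked (E - {e}) a b"
  then show "e \<in> edges_of_path p"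
    using p linked_hd_last[of p "E - {e}"] by (auto simp: is_path_iff)
next
  assume e: "e \<in> edges_of_path p"
  then have eE: "e \<in> E" using p by (auto simp: is_path_iff)
  obtain p1 x y p2 where split: "p = p1 @ x # y # p2" and exy: "e = {x, y}"
    using edge_of_path_split[OF e] by blast
  have d: "distinct (p1 @ x # y # p2)" using p by (simp add: is_path_iff split)
  have sub: "edges_of_path (p1 @ [x]) \<subseteq> E" "edges_of_path (y # p2) \<subseteq> E"
    using p edges_of_path_append[of p1 x "y # p2"] by (auto simp: is_path_iff split)
  have "e \<notin> edges_of_path (p1 @ [x])" "e \<notin> edges_of_path (y # p2)"
    using edges_of_path_subset[of e "p1 @ [x]"] edges_of_path_subset[of e "y # p2"] d
    by (auto simp: exy)
  with sub have "linked (E - {e}) (hd (p1 @ [x])) (last (p1 @ [x]))"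
    "linked (E - {e}) (hd (y # p2)) (last (y # p2))"
    by (intro linked_hd_last; auto)+
  then have ax: "linked (E - {e}) a x" and yb: "linked (E - {e}) y b"
    using p by (auto simp: is_path_iff split hd_append)
  have "\<not> linked (E - {e}) a b"
  proof
    assume "linked (E - {e}) a b"
    then have "linked (E - {e}) x y"
      using ax yb by (meson linked_sym linked_trans)
    then show False using not_linked_edge[of x y] eE d by (simp add: exy)
  qed
  with eE show "e \<in> E \<and> \<not> linked (E - {e}) a b" by blast
qed

text \<open>By \<open>edges_of_path_iff\<close> the edge set of a path depends on its ends
  only.\<close>

lemma path_unique:
  assumes "is_path E a b p" "is_path E a b q"
  shows "p = q"
proof -
  have "edges_of_path p = edges_of_path q"
    using edges_of_path_iff[OF assms(1)] edges_of_path_iff[OF assms(2)] by blast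
  moreover obtain p' q' where "p = a # p'" "q = a # q'"
    using assms by (cases p; cases q) (auto simp: is_path_iff)
  ultimately show ?thesis using assms edges_of_path_inject[of a p' q'] by (auto simp: is_path_iff)
qed

lemma the_path_eq: "is_path E a b p \<Longrightarrow> the_path E a b = p"
  unfolding the_path_def using path_unique by blast

lemma is_path_the_path: "a \<in> V \<Longrightarrow> b \<in> V \<Longrightarrow> is_path E a b (the_path E a b)"
  using path_exists the_path_eq by metis

lemma set_path_subset:
  assumes "is_path E a b p" "a \<in> V"
  shows "set p \<subseteq> V"
proof
  fix v assume "v \<in> set p"
  show "v \<in> V"
  proof (cases "v = a")
    case False
    obtain q where q: "p = a # q" using assms(1) by (cases p) (auto simp: is_path_iff)
    with \<open>v \<in> set p\<close> False obtain q1 q2 where "p = a # q1 @ v # q2" by (auto dest: split_list)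
    moreover obtain w q3 where "a # q1 = q3 @ [w]" by (cases "a # q1" rule: rev_cases) auto
    ultimately have "p = q3 @ w # v # q2"
      by (metis append.assoc append_Cons append_Nil)
    then have "{w, v} \<in> E"
      using assms(1) edges_of_path_append[of q3 w "v # q2"] by (auto simp: is_path_iff)
    then show ?thesis using edge_subset by auto
  qed (use assms(2) in simp)
qed

text \<open>Removing an edge leaves exactly two components. Encoding them by a Boolean function
  turns arguments about the position of four leaves into finite case distinctions.\<close>

lemma edge_sides:
  assumes "e \<in> E"
  shows "\<exists>side :: 'v \<Rightarrow> bool. \<forall>a\<in>V. \<forall>b\<in>V. linked (E - {e}) a b \<longleftrightarrow> side a = side b"
proof -
  obtain x y where e: "e = {x, y}" "x \<noteq> y" "x \<in> V" "y \<in> V" using edgeE[OF assms] .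
  have *: "linked (E - {e}) a x \<or> linked (E - {e}) a y" if a: "a \<in> V" for a
  proof -
    obtain p where p: "is_path E a x p" using path_exists[OF a e(3)] by blast
    show ?thesis
    proof (cases "e \<in> edges_of_path p")
      case False
      then show ?thesis using edges_of_path_iff[OF p, of e] assms by blast
    next
      case True
      obtain p1 u w p2 where split: "p = p1 @ u # w # p2" and uw: "e = {u, w}"
        using edge_of_path_split[OF True] by blast
      have d: "distinct (p1 @ u # w # p2)" and l: "last (p1 @ u # w # p2) = x"
        using p by (auto simp: is_path_iff split)
      \<comment> \<open>The path ends in \<open>x\<close> and visits it only once, so it can use
        \<open>e\<close> only in its last step, from \<open>y\<close> to \<open>x\<close>. The piece
        before avoids \<open>e\<close> and links \<open>a\<close> to \<open>y\<close>.\<close>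
      have "u = y" "w = x" using uw e d l by (auto simp: doubleton_eq_iff split: if_splits)
      have "e \<notin> edges_of_path (p1 @ [u])"
        using edges_of_path_subset[of e "p1 @ [u]"] d by (auto simp: uw)
      then have "linked (E - {e}) (hd (p1 @ [u])) (last (p1 @ [u]))"
        using p edges_of_path_append[of p1 u "w # p2"]
        by (intro linked_hd_last) (auto simp: is_path_iff split)
      then show ?thesis using p \<open>u = y\<close> by (auto simp: is_path_iff split hd_append)
    qed
  qed
  have n: "\<not> linked (E - {e}) x y" using not_linked_edge[of x y] assms e by simp
  show ?thesis
  proof (intro exI ballI)
    fix a b assume "a \<in> V" "b \<in> V"
    then show "linked (E - {e}) a b = (linked (E - {e}) a x = linked (E - {e}) b x)"
      using *[of a] *[of b] n by (meson linked_sym linked_trans)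
  qed
qed

definition edge_split :: "'v set \<Rightarrow> 'v \<Rightarrow> 'v \<Rightarrow> 'v \<Rightarrow> 'v \<Rightarrow> bool" where
  "edge_split e a b c d \<longleftrightarrow>
     e \<in> E \<and> linked (E - {e}) a b \<and> linked (E - {e}) c d \<and> \<not> linked (E - {e}) a c"

text \<open>Crossing splits cannot both come from edges of one tree: each of the two edges lies
  entirely on one side of the other. A vertex on the far side of both cannot reach \<open>e\<close>
  without crossing \<open>e0\<close>, but its path up to \<open>e0\<close> avoids \<open>e\<close>
  and would put it on the same side of \<open>e\<close> as \<open>e0\<close>.\<close>

lemma edge_split_compatible:
  assumes V: "a \<in> V" "b \<in> V" "c \<in> V" "d \<in> V"
    and e0: "edge_split e0 a b c d" and e: "edge_split e a c b d"
  shows False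
proof -
  have E: "e \<in> E" "e0 \<in> E" using e e0 by (auto simp: edge_split_def)
  obtain s :: "'v \<Rightarrow> bool" where s: "\<And>a b. a \<in> V \<Longrightarrow> b \<in> V \<Longrightarrow> linked (E - {e}) a b \<longleftrightarrow> s a = s b"
    using edge_sides[OF E(1)] by blast
  obtain s0 :: "'v \<Rightarrow> bool" where s0: "\<And>a b. a \<in> V \<Longrightarrow> b \<in> V \<Longrightarrow> linked (E - {e0}) a b \<longleftrightarrow> s0 a = s0 b"
    using edge_sides[OF E(2)] by blast
  have sp: "s a = s c" "s b = s d" "s a \<noteq> s b" "s0 a = s0 b" "s0 c = s0 d" "s0 a \<noteq> s0 c"
    using e e0 V s s0 by (auto simp: edge_split_def)
  obtain p q where pq: "e = {p, q}" "p \<noteq> q" "p \<in> V" "q \<in> V" using edgeE[OF E(1)] .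
  obtain p0 q0 where pq0: "e0 = {p0, q0}" "p0 \<noteq> q0" "p0 \<in> V" "q0 \<in> V" using edgeE[OF E(2)] .
  have ne: "e \<noteq> e0" using sp s s0 V by metis
  have "s p0 = s q0" using linked_edge[of p0 q0 "E - {e}"] E ne pq0 s by auto
  have "s0 p = s0 q" using linked_edge[of p q "E - {e0}"] E ne pq s0 by auto
  have "s p \<noteq> s q" using not_linked_edge[of p q] E pq s by auto
  \<comment> \<open>The vertices \<open>a\<close>, \<open>b\<close>, \<open>c\<close>,
    \<open>d\<close> realize all four combinations of sides of \<open>e\<close> and
    \<open>e0\<close>, so one of them lies opposite to \<open>e0\<close> with respect to
    \<open>e\<close> and opposite to \<open>e\<close> with respect to \<open>e0\<close>.\<close>
  obtain z where z: "z \<in> V" "s z \<noteq> s p0" "s0 z \<noteq> s0 p"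
    using sp V by metis
  obtain w where w: "w \<in> V" "w \<in> e" "s z = s w" "s0 w = s0 p"
    using \<open>s p \<noteq> s q\<close> \<open>s0 p = s0 q\<close> pq by (metis insertCI)
  obtain P where P: "is_path E z w P" using path_exists z(1) w(1) by blast
  have "e0 \<in> edges_of_path P" using edges_of_path_iff[OF P, of e0] E s0 z w by auto
  have "e \<notin> edges_of_path P" using edges_of_path_iff[OF P, of e] s z w by auto
  obtain P1 x y P2 where split: "P = P1 @ x # y # P2" and xy: "e0 = {x, y}"
    using edge_of_path_split[OF \<open>e0 \<in> edges_of_path P\<close>] by blast
  have "linked (E - {e}) (hd (P1 @ [x])) (last (P1 @ [x]))"
    using P \<open>e \<notin> edges_of_path P\<close> edges_of_path_append[of P1 x "y # P2"]
    by (intro linked_hd_last) (auto simp: is_path_iff split)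
  then have "linked (E - {e}) z x" using P by (auto simp: is_path_iff split hd_append)
  moreover have "x \<in> {p0, q0}" using xy pq0 by auto
  ultimately have "s z = s p0" using s[of z x] z pq0 \<open>s p0 = s q0\<close> by auto
  with z show False by simp
qed

lemma leaf_linked:
  assumes v: "v \<in> leaves V E" and e: "e \<in> E" "v \<in> e" and l: "linked (E - {e}) v u"
  shows "u = v"
proof (rule ccontr)
  assume "u \<noteq> v"
  obtain p where p: "is_path (E - {e}) v u p" using linked_imp_path[OF l] by blast
  with \<open>u \<noteq> v\<close> obtain y q where "p = v # y # q"
    by (cases p; cases "tl p") (auto simp: is_path_iff)
  with p have "{v, y} \<in> E" "{v, y} \<noteq> e" by (auto simp: is_path_iff)
  moreover have "card {e \<in> E. v \<in> e} = 1" using v by (simp add: leaves_def vdeg_def)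
  ultimately show False using e by (metis (mono_tags, lifting) card_1_singletonE insertCI mem_Collect_eq singletonD)
qed

text \<open>An edge ending in a leaf has this leaf alone on one side, whereas here both sides
  contain two distinct vertices. Hence weights of splitting edges are nonnegative in the
  cone.\<close>

lemma edge_split_inner:
  assumes L: "{a, b, c, d} \<subseteq> leaves V E" and ne: "a \<noteq> b" "c \<noteq> d"
    and split: "edge_split e a b c d"
  shows "e \<inter> leaves V E = {}"
proof (rule ccontr)
  assume "e \<inter> leaves V E \<noteq> {}"
  then obtain v where v: "v \<in> leaves V E" "v \<in> e" by blast
  have V: "a \<in> V" "b \<in> V" "c \<in> V" "d \<in> V" "v \<in> V" using L v by (auto simp: leaves_def)
  have e: "e \<in> E" using split by (simp add: edge_split_def)
  obtain s :: "'v \<Rightarrow> bool" where s: "\<And>a b. a \<in> V \<Longrightarrow> b \<in> V \<Longrightarrow> linked (E - {e}) a b \<longleftrightarrow> s a = s b"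
      using edge_sides[OF e] by blast
  have "u = v" if "u \<in> V" "s u = s v" for u
    using leaf_linked[OF v(1) e v(2), of u] s[of v u] that V by auto
  then show False using split ne s V unfolding edge_split_def by metis
qed

section \<open>Path weights and the four-point condition\<close>

definition path_weight :: "('v set \<Rightarrow> real) \<Rightarrow> 'v \<Rightarrow> 'v \<Rightarrow> real" where
  "path_weight \<omega> a b = (\<Sum>e\<in>edges_of_path (the_path E a b). \<omega> e)"

text \<open>Writing the weight as a sum over all edges of the tree makes it possible to compare sums
  of two path weights edge by edge.\<close>

lemma path_weight_eq:
  assumes "a \<in> V" "b \<in> V"
  shows "path_weight \<omega> a b = (\<Sum>e\<in>E. if linked (E - {e}) a b then 0 else \<omega> e)"
proof -
  have "edges_of_path (the_path E a b) = {e \<in> E. \<not> linked (E - {e}) a b}"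
    using edges_of_path_iff[OF is_path_the_path[OF assms]] by auto
  then show ?thesis
    unfolding path_weight_def by (simp add: sum.If_cases[OF finite_E] Int_def Compl_eq)
qed

text \<open>The quartet of the four leaves is \<open>ab|cd\<close> or a star.\<close>

definition quartet :: "'v \<Rightarrow> 'v \<Rightarrow> 'v \<Rightarrow> 'v \<Rightarrow> bool" where
  "quartet a b c d \<longleftrightarrow> (\<forall>e. \<not> edge_split e a c b d \<and> \<not> edge_split e a d b c)"

text \<open>The contribution of an edge to the three sums depends only on how it splits the four
  leaves. The splits ac|bd and ad|bc are excluded by \<open>Q\<close>. An edge with split ab|cd
  contributes twice its weight to the two larger sums and nothing to the third, and its weight is
  nonnegative; all other edges contribute equally to the three sums.\<close>

lemma four_point:
  assumes L: "{a, b, c, d} \<subseteq> leaves V E" and ne: "a \<noteq> b" "c \<noteq> d"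
    and Q: "quartet a b c d" and \<omega>: "\<And>e. e \<in> E \<Longrightarrow> e \<inter> leaves V E = {} \<Longrightarrow> 0 \<le> \<omega> e"
  shows "path_weight \<omega> a c + path_weight \<omega> b d = path_weight \<omega> a d + path_weight \<omega> b c"
    and "path_weight \<omega> a b + path_weight \<omega> c d \<le> path_weight \<omega> a c + path_weight \<omega> b d"
proof -
  have V: "a \<in> V" "b \<in> V" "c \<in> V" "d \<in> V" using L by (auto simp: leaves_def)
  define f where "f x y e = (if linked (E - {e}) x y then 0 else \<omega> e)" for x y e
  have "f a c e + f b d e = f a d e + f b c e \<and> f a b e + f c d e \<le> f a c e + f b d e"
    if e: "e \<in> E" for e
  proof -
    obtain s :: "'v \<Rightarrow> bool" where s: "\<And>a b. a \<in> V \<Longrightarrow> b \<in> V \<Longrightarrow> linked (E - {e}) a b \<longleftrightarrow> s a = s b"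
      using edge_sides[OF e] by blast
    have "\<not> (s a = s c \<and> s b = s d \<and> s a \<noteq> s b)" "\<not> (s a = s d \<and> s b = s c \<and> s a \<noteq> s b)"
      using Q e s V unfolding quartet_def edge_split_def by metis+
    moreover have "s a = s b \<Longrightarrow> s c = s d \<Longrightarrow> s a \<noteq> s c \<Longrightarrow> 0 \<le> \<omega> e"
      using edge_split_inner[OF L ne, of e] \<omega>[OF e] e s V unfolding edge_split_def by metis
    ultimately show ?thesis
      unfolding f_def using s V by (cases "s a"; cases "s b"; cases "s c"; cases "s d") auto
  qed
  then have "(\<Sum>e\<in>E. f a c e + f b d e) = (\<Sum>e\<in>E. f a d e + f b c e)"
    "(\<Sum>e\<in>E. f a b e + f c d e) \<le> (\<Sum>e\<in>E. f a c e + f b d e)"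
    by (blast intro!: sum.cong sum_mono)+
  then show "path_weight \<omega> a c + path_weight \<omega> b d = path_weight \<omega> a d + path_weight \<omega> b c"
    "path_weight \<omega> a b + path_weight \<omega> c d \<le> path_weight \<omega> a c + path_weight \<omega> b d"
    using V by (simp_all add: path_weight_eq sum.distrib f_def)
qed

text \<open>Both excluded splits cross the given one; for the second, \<open>c\<close> and
  \<open>d\<close> are interchanged.\<close>

lemma edge_split_imp_quartet:
  assumes "a \<in> V" "b \<in> V" "c \<in> V" "d \<in> V" "edge_split e a b c d"
  shows "quartet a b c d"
  unfolding quartet_def
proof (intro allI conjI notI)
  fix e'
  have e: "edge_split e a b d c" using assms(5) by (auto simp: edge_split_def intro: linked_sym linked_trans)
  show False if "edge_split e' a c b d" using edge_split_compatible[OF assms that] .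
  show False if "edge_split e' a d b c"
    using edge_split_compatible[OF assms(1,2,4,3) e that] .
qed

end

section \<open>Cherries of a quartet\<close>

context tree
begin

lemma leaf_edge_unique:
  assumes "v \<in> leaves V E" "e \<in> E" "v \<in> e" "e' \<in> E" "v \<in> e'"
  shows "e = e'"
proof -
  have "card {e \<in> E. v \<in> e} = 1" using assms(1) by (simp add: leaves_def vdeg_def)
  then obtain f where "{e \<in> E. v \<in> e} = {f}" by (rule card_1_singletonE)
  with assms show ?thesis by (metis (mono_tags, lifting) mem_Collect_eq singletonD)
qed

text \<open>An inner vertex of a path lies on two different edges, a leaf on one.\<close>

lemma leaf_not_inner:
  assumes p: "is_path E a b p" and v: "v \<in> leaves V E" "v \<in> set p"
  shows "v = a \<or> v = b"
proof (rule ccontr)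
  assume ne: "\<not> (v = a \<or> v = b)"
  obtain p1 p2 where split: "p = p1 @ v # p2" using v(2) by (auto dest: split_list)
  obtain u p1' where p1: "p1 = p1' @ [u]"
    using p ne by (cases p1 rule: rev_cases) (auto simp: is_path_iff split)
  obtain w p2' where p2: "p2 = w # p2'"
    using p ne by (cases p2) (auto simp: is_path_iff split)
  have "{u, v} \<in> E" "{v, w} \<in> E" "u \<noteq> w" "u \<noteq> v"
    using p edges_of_path_append[of p1' u "v # w # p2'"] by (auto simp: is_path_iff split p1 p2)
  with leaf_edge_unique[OF v(1), of "{u, v}" "{v, w}"] show False
    by (auto simp: doubleton_eq_iff)
qed

text \<open>Along \<open>p\<close> there is no branching: the first edge is the only one at
  \<open>a\<close>, and at every inner vertex there is just one edge besides the one of arrival. So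
  every path from \<open>a\<close> to another vertex of degree at most one starts with
  \<open>p\<close>.\<close>

lemma path_prefix:
  assumes p: "is_path D a w p" and r: "is_path D a z r" and fin: "finite D"
    and a: "vdeg D a \<le> 1" and z: "vdeg D z \<le> 1" "z \<noteq> a"
    and inner: "\<And>u. u \<in> inner_vertices p \<Longrightarrow> vdeg D u = 2"
  shows "edges_of_path p \<subseteq> edges_of_path r"
proof -
  have p': "p \<noteq> []" "p ! 0 = a" "distinct p" "edges_of_path p \<subseteq> D"
    and r': "r \<noteq> []" "r ! 0 = a" "r ! (length r - 1) = z" "distinct r" "edges_of_path r \<subseteq> D"
    using p r by (auto simp: is_path_iff hd_conv_nth last_conv_nth)
  have edge_p: "{p ! m, p ! Suc m} \<in> D" if "Suc m < length p" for m
    using that p'(4) by (auto simp: edges_of_path_def)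
  have edge_r: "{r ! m, r ! Suc m} \<in> D" if "Suc m < length r" for m
    using that r'(5) by (auto simp: edges_of_path_def)
  have agree: "s < length p \<Longrightarrow> s < length r \<Longrightarrow> p ! s = r ! s" for s
  proof (induction s rule: less_induct)
    case (less s)
    define y where "y = p ! (s - 1)"
    define W where "W = {e \<in> D. y \<in> e}"
    have W: "finite W" using fin by (simp add: W_def)
    show ?case
    proof (cases s)
      case 0
      then show ?thesis by (simp add: p' r')
    next
      case (Suc m)
      have y: "y = p ! m" "y = r ! m" using less Suc by (auto simp: y_def)
      have in_W: "{y, p ! s} \<in> W" "{y, r ! s} \<in> W"
        using edge_p[of m, folded y(1)] edge_r[of m, folded y(2)] less.prems by (auto simp: W_def Suc)
      have "{y, p ! s} = {y, r ! s}"
      proof (cases m)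
        case 0
        then have "card W \<le> 1" using a by (simp add: y p' W_def vdeg_def)
        then show ?thesis using in_W card_le_Suc0_iff_eq[OF W] by auto
      next
        case (Suc m')
        define x where "x = p ! m'"
        have "r ! m' = x"
          unfolding x_def using less.IH[of m'] less.prems \<open>s = Suc m\<close> Suc by auto
        have xW: "{x, y} \<in> W"
          using edge_p[of m'] less.prems \<open>s = Suc m\<close> Suc by (auto simp: W_def y x_def)
        have "y \<in> inner_vertices p"
          unfolding y by (rule inner_vertices_nth) (use less.prems Suc \<open>s = Suc m\<close> in auto)
        then have "card W = 2" using inner[of y] by (simp add: W_def vdeg_def)
        then obtain e1 e2 where "W = {e1, e2}" by (auto simp: card_2_iff)
        moreover have "x \<noteq> p ! s" "x \<noteq> y"
          using p'(3) less.prems \<open>s = Suc m\<close> Suc by (auto simp: x_def y nth_eq_iff_index_eq)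
        moreover have "x \<noteq> r ! s"
          using r'(4) less.prems \<open>s = Suc m\<close> Suc \<open>r ! m' = x\<close> by (auto simp: nth_eq_iff_index_eq)
        ultimately have "{x, y} \<noteq> {y, p ! s}" "{x, y} \<noteq> {y, r ! s}" "W = {e1, e2}"
          by (auto simp: doubleton_eq_iff)
        then show ?thesis using in_W xW by blast
      qed
      then show ?thesis by (auto simp: doubleton_eq_iff)
    qed
  qed
  \<comment> \<open>If \<open>r\<close> stopped before the end of \<open>p\<close>, its last vertex
    \<open>z\<close> would be an inner vertex of \<open>p\<close> and have degree two.\<close>
  have len: "length p \<le> length r"
  proof (rule ccontr)
    assume "\<not> length p \<le> length r"
    then have "p ! (length r - 1) = z" using agree[of "length r - 1"] r' by auto
    moreover have "0 < length r - 1"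
      using r' z(2) by (cases "length r - 1 = 0") auto
    ultimately have "z \<in> inner_vertices p"
      using inner_vertices_nth[of "length r - 1" p] \<open>\<not> length p \<le> length r\<close> by auto
    then show False using inner[of z] z(1) by simp
  qed
  show ?thesis
  proof
    fix e assume "e \<in> edges_of_path p"
    then obtain m where m: "e = {p ! m, p ! Suc m}" "Suc m < length p"
      by (auto simp: edges_of_path_def)
    then have "e = {r ! m, r ! Suc m}" "Suc m < length r" using agree len by auto
    then show "e \<in> edges_of_path r" by (auto simp: edges_of_path_def)
  qed
qed

text \<open>Let \<open>w\<close> be the common neighbor of the cherry. An edge separating
  \<open>a\<close> from \<open>b\<close> separates one of them from \<open>w\<close>, and then this
  one from all three other leaves. Its split therefore is neither ac|bd nor ad|bc.\<close>

lemma cherry_imp_quartet: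
  assumes L: "{a, b, c, d} \<subseteq> leaves V E" and dist: "distinct [a, b, c, d]"
    and cherry: "is_cherry (suppress2 (spanned_edges E {a, b, c, d})) a b"
  shows "quartet a b c d"
proof -
  define D where "D = spanned_edges E {a, b, c, d}"
  have V: "a \<in> V" "b \<in> V" "c \<in> V" "d \<in> V" using L by (auto simp: leaves_def)
  have DE: "D \<subseteq> E"
    unfolding D_def spanned_edges_def using is_path_the_path V by (auto simp: is_path_iff)
  have fin: "finite D" using DE finite_E finite_subset by blast
  have deg: "vdeg D x \<le> 1" if "x \<in> {a, b, c, d}" for x
  proof -
    have "vdeg D x \<le> vdeg E x"
      unfolding vdeg_def using DE finite_E by (intro card_mono) auto
    then show ?thesis using L that by (auto simp: leaves_def)
  qed
  obtain w where w: "{a, w} \<in> suppress2 D" "{b, w} \<in> suppress2 D"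
    using cherry by (auto simp: is_cherry_def D_def)
  have path: "\<exists>p. is_path D x w p \<and> (\<forall>u\<in>inner_vertices p. vdeg D u = 2)"
    if "{x, w} \<in> suppress2 D" for x
  proof -
    have "\<exists>x' w'. {x, w} = {x', w'} \<and> (\<exists>p. is_path D x' w' p \<and> (\<forall>u\<in>inner_vertices p. vdeg D u = 2))"
      using that unfolding suppress2_def mem_Collect_eq by (elim exE conjE) (intro exI conjI)
    then obtain x' w' p where p: "{x, w} = {x', w'}" "is_path D x' w' p"
      "\<forall>u\<in>inner_vertices p. vdeg D u = 2" by (elim exE conjE)
    consider "x' = x" "w' = w" | "x' = w" "w' = x" using p(1) by (auto simp: doubleton_eq_iff)
    then show ?thesis
    proof cases
      case 2
      have "inner_vertices (rev p) = inner_vertices p"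
        unfolding inner_vertices_def by (metis butlast_rev butlast_tl rev_rev_ident set_rev)
      then show ?thesis using is_path_rev[OF p(2)] p(3) 2 by (metis)
    qed (use p in blast)
  qed
  \<comment> \<open>In \<open>D\<close> the path from \<open>x\<close> to \<open>w\<close> has only
    inner vertices of degree two, so by \<open>path_prefix\<close> it is contained in the path from
    \<open>x\<close> to any other of the four leaves.\<close>
  have apart: "\<not> linked (E - {e}) x z"
    if x: "x \<in> {a, b}" and z: "z \<in> {a, b, c, d}" "z \<noteq> x" and e: "e \<in> E" and xw: "\<not> linked (E - {e}) x w"
    for x z e
  proof -
    obtain p where p: "is_path D x w p" "\<And>u. u \<in> inner_vertices p \<Longrightarrow> vdeg D u = 2"
      using path[of x] w x by blast
    then have pE: "is_path E x w p" using DE by (auto simp: is_path_iff)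
    define r where "r = the_path E x z"
    have rE: "is_path E x z r" unfolding r_def using x z V by (intro is_path_the_path) auto
    have "edges_of_path r \<subseteq> D"
      unfolding D_def spanned_edges_def r_def using x z by blast
    then have r: "is_path D x z r" using rE by (simp add: is_path_iff)
    have "edges_of_path p \<subseteq> edges_of_path r"
      using path_prefix[OF p(1) r fin _ _ z(2) p(2)] deg x z(1) by blast
    then show ?thesis
      using edges_of_path_iff[OF pE, of e] edges_of_path_iff[OF rE, of e] e xw by blast
  qed
  have "False" if e: "e \<in> E" and ab: "\<not> linked (E - {e}) a b"
    and split: "linked (E - {e}) a c \<and> linked (E - {e}) b d \<or> linked (E - {e}) a d \<and> linked (E - {e}) b c"
    for e
  proof -
    have "\<not> linked (E - {e}) a w \<or> \<not> linked (E - {e}) b w"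
      using ab linked_sym linked_trans by metis
    then show False using apart[of a _ e] apart[of b _ e] e split dist by auto
  qed
  then show ?thesis unfolding quartet_def edge_split_def by (meson linked_sym linked_trans)
qed

end

section \<open>Labeled leaves and their position relative to the path from \<open>i\<close> to
  \<open>j\<close>\<close>

locale leaf_labeled_tree = tree V E for V :: "'v set" and E :: "'v set set" +
  fixes n :: nat and lab :: "nat \<Rightarrow> 'v"
  assumes labeled: "labeled_tree n V E lab"
begin

lemma bij_lab: "bij_betw lab {1..n} (leaves V E)"
  using labeled by (simp add: labeled_tree_def)

lemma lab_leaf: "k \<in> {1..n} \<Longrightarrow> lab k \<in> leaves V E"
  by (rule bij_betw_apply[OF bij_lab])

lemma lab_inject: "k \<in> {1..n} \<Longrightarrow> l \<in> {1..n} \<Longrightarrow> lab k = lab l \<longleftrightarrow> k = l"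
  by (rule inj_on_eq_iff[OF bij_betw_imp_inj_on[OF bij_lab]])

lemma lab_V: "k \<in> {1..n} \<Longrightarrow> lab k \<in> V"
  using lab_leaf by (auto simp: leaves_def)

context
  fixes i j :: nat
  assumes ij: "i \<in> {1..n}" "j \<in> {1..n}" "i \<noteq> j"
begin

abbreviation "main_path \<equiv> the_path E (lab i) (lab j)"

lemma main_path: "is_path E (lab i) (lab j) main_path"
  using ij by (intro is_path_the_path lab_V)

lemma spine_subset: "spine E lab i j \<subseteq> set main_path"
  unfolding spine_def inner_vertices_def by (cases main_path) (auto dest: in_set_butlastD)

text \<open>The vertex sought is the first one on the main path that a walk from \<open>k\<close> to
  \<open>i\<close> meets. The work lies in showing that it is neither of the two end leaves.\<close>

lemma part_exists:
  assumes k: "k \<in> {1..n} - {i, j}"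
  shows "\<exists>v\<in>spine E lab i j. k \<in> part n E lab i j v"
proof -
  have kV: "lab k \<in> V" and iV: "lab i \<in> V" using k ij lab_V by auto
  have ne: "lab k \<noteq> lab i" "lab k \<noteq> lab j" "lab i \<noteq> lab j" using k ij lab_inject by auto
  obtain r where r: "is_path E (lab k) (lab i) r" using path_exists[OF kV iV] by blast
  have "lab i \<in> set r" "lab i \<in> set main_path"
    using r main_path unfolding is_path_iff by (metis last_in_set, metis hd_in_set)
  then have "\<exists>x\<in>set r. x \<in> set main_path" by blast
  then obtain ys v zs where split: "r = ys @ v # zs" and v: "v \<in> set main_path"
    and ys: "\<forall>y\<in>set ys. y \<notin> set main_path"
    by (auto dest!: split_list_first_prop)
  have path: "is_path E (lab k) v (ys @ [v])"
    using r edges_of_path_append[of ys v zs] by (cases ys) (auto simp: is_path_iff split)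
  have "k \<in> part n E lab i j v"
    using k v ys by (auto simp: part_def the_path_eq[OF path])
  have "v \<in> set r" by (simp add: split)
  have "v \<noteq> lab j"
    using leaf_not_inner[OF r lab_leaf[OF ij(2)]] \<open>v \<in> set r\<close> ne by auto
  \<comment> \<open>The walk can enter the leaf \<open>i\<close> only through its unique edge, whose
    other end already belongs to the main path.\<close>
  have "v \<noteq> lab i"
  proof
    assume vi: "v = lab i"
    obtain u ys' where u: "ys = ys' @ [u]"
      using path ne vi by (cases ys rule: rev_cases) (auto simp: is_path_iff)
    have "{u, lab i} \<in> E"
      using path edges_of_path_append[of ys' u "[v]"] by (auto simp: is_path_iff u vi)
    moreover obtain y q where y: "main_path = lab i # y # q"
      using main_path ne by (cases main_path; cases "tl main_path") (auto simp: is_path_iff)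
    then have "{lab i, y} \<in> E" using main_path by (auto simp: is_path_iff)
    ultimately have "{u, lab i} = {lab i, y}"
      using leaf_edge_unique[OF lab_leaf[OF ij(1)]] by blast
    then have "u \<in> set main_path" using y by (auto simp: doubleton_eq_iff)
    then show False using ys u by auto
  qed
  obtain q where q: "main_path = lab i # q @ [lab j]"
  proof -
    obtain q1 where q1: "main_path = lab i # q1" using main_path by (cases main_path) (auto simp: is_path_iff)
    moreover from this ne main_path obtain q2 where "q1 = q2 @ [lab j]"
      by (cases q1 rule: rev_cases) (auto simp: is_path_iff)
    ultimately show ?thesis using that by blast
  qed
  have "v \<in> spine E lab i j"
    unfolding spine_def q inner_vertices_Cons using v \<open>v \<noteq> lab i\<close> \<open>v \<noteq> lab j\<close> by (auto simp: q)
  with \<open>k \<in> part n E lab i j v\<close> show ?thesis by blast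
qed

lemma part_subset: "k \<in> part n E lab i j v \<Longrightarrow> k \<in> {1..n} - {i, j}"
  by (simp add: part_def)

text \<open>The path from the leaf to \<open>v\<close> meets the main path in \<open>v\<close> alone
  and so uses none of its edges: for every edge of the main path, the leaf lies on the side of its
  attachment vertex.\<close>

lemma part_linked:
  assumes v: "v \<in> set main_path" and k: "k \<in> part n E lab i j v"
    and e: "e \<in> edges_of_path main_path"
  shows "linked (E - {e}) (lab k) v"
proof -
  have eE: "e \<in> E" using e main_path by (auto simp: is_path_iff)
  have "v \<in> V" using set_path_subset[OF main_path lab_V[OF ij(1)]] v by auto
  then have p: "is_path E (lab k) v (the_path E (lab k) v)"
    using part_subset[OF k] lab_V by (intro is_path_the_path) auto
  have "e \<notin> edges_of_path (the_path E (lab k) v)"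
  proof
    assume "e \<in> edges_of_path (the_path E (lab k) v)"
    then have "e \<subseteq> {v}" using edges_of_path_subset e k unfolding part_def by fast
    moreover obtain x y where "e = {x, y}" "x \<noteq> y" by (rule edgeE[OF eE])
    ultimately show False by auto
  qed
  then show ?thesis using edges_of_path_iff[OF p, of e] eE by blast
qed

text \<open>An edge separating \<open>i\<close> from \<open>j\<close> is an edge of the main path,
  and such edges do not separate leaves attached at the same vertex.\<close>

lemma same_part_quartet:
  assumes v: "v \<in> spine E lab i j" and k: "k \<in> part n E lab i j v" and l: "l \<in> part n E lab i j v"
  shows "quartet (lab i) (lab j) (lab k) (lab l)"
proof -
  have "False" if e: "e \<in> E" "\<not> linked (E - {e}) (lab i) (lab j)"
    and s: "linked (E - {e}) (lab i) (lab k) \<and> linked (E - {e}) (lab j) (lab l) \<or>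
      linked (E - {e}) (lab i) (lab l) \<and> linked (E - {e}) (lab j) (lab k)" for e
  proof -
    have "e \<in> edges_of_path main_path" using edges_of_path_iff[OF main_path] e by blast
    then have "linked (E - {e}) (lab k) (lab l)"
      using part_linked k l v spine_subset by (meson linked_sym linked_trans subsetD)
    then show False using e s by (meson linked_sym linked_trans)
  qed
  then show ?thesis unfolding quartet_def edge_split_def by blast
qed

text \<open>An edge of the main path between the two attachment vertices produces the split; which
  of the two alternatives holds depends on the order of the vertices along the path.\<close>

lemma different_part_quartet:
  assumes v: "v \<in> spine E lab i j" and w: "w \<in> spine E lab i j" and vw: "v \<noteq> w"
    and k: "k \<in> part n E lab i j v" and l: "l \<in> part n E lab i j w"
  shows "quartet (lab i) (lab k) (lab j) (lab l) \<or> quartet (lab i) (lab l) (lab j) (lab k)"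
proof -
  have *: "quartet (lab i) (lab k) (lab j) (lab l)"
    if split: "main_path = p1 @ v # p2" and wp: "w \<in> set p2"
      and k: "k \<in> part n E lab i j v" and l: "l \<in> part n E lab i j w" for v w k l p1 p2
  proof -
    obtain y p3 where p2: "p2 = y # p3" using wp by (cases p2) auto
    \<comment> \<open>The first edge after \<open>v\<close> in the direction of \<open>w\<close>
      touches neither the piece of the main path up to \<open>v\<close> nor the piece from
      \<open>w\<close> on.\<close>
    define e where "e = {v, y}"
    have d: "distinct (p1 @ v # y # p3)" using main_path by (simp add: is_path_iff split p2)
    have eP: "e \<in> edges_of_path main_path"
      unfolding split p2 edges_of_path_append[of p1 v "y # p3"] by (simp add: e_def)
    have eE: "e \<in> E" using eP main_path by (auto simp: is_path_iff)
    have "e \<notin> edges_of_path (p1 @ [v])"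
      using edges_of_path_subset[of e "p1 @ [v]"] d by (auto simp: e_def)
    then have "linked (E - {e}) (hd (p1 @ [v])) (last (p1 @ [v]))"
      using main_path edges_of_path_append[of p1 v p2]
      by (intro linked_hd_last) (auto simp: is_path_iff split)
    then have iv: "linked (E - {e}) (lab i) v"
      using main_path by (cases p1) (auto simp: is_path_iff split)
    obtain q1 q2 where q: "y # p3 = q1 @ w # q2" using wp unfolding p2 by (meson split_list)
    have "e \<notin> edges_of_path (w # q2)"
      using edges_of_path_subset[of e "w # q2"] d unfolding q by (auto simp: e_def)
    moreover have "edges_of_path (w # q2) \<subseteq> E"
      using main_path edges_of_path_append[of "p1 @ v # q1" w q2] by (auto simp: is_path_iff split p2 q)
    ultimately have "linked (E - {e}) (hd (w # q2)) (last (w # q2))"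
      by (intro linked_hd_last) auto
    then have wj: "linked (E - {e}) w (lab j)"
      using main_path by (auto simp: is_path_iff split p2 q)
    have "linked (E - {e}) (lab k) v" "linked (E - {e}) (lab l) w"
      using part_linked[OF _ k eP] part_linked[OF _ l eP] wp by (auto simp: split)
    moreover have "\<not> linked (E - {e}) (lab i) (lab j)"
      using edges_of_path_iff[OF main_path, of e] eP by blast
    ultimately have "edge_split e (lab i) (lab k) (lab j) (lab l)"
      unfolding edge_split_def using eE iv wj by (meson linked_sym linked_trans)
    then show ?thesis
      by (rule edge_split_imp_quartet[rotated 4])
        (use ij part_subset[OF k] part_subset[OF l] lab_V in auto)
  qed
  obtain p1 p2 where split: "main_path = p1 @ v # p2" using v spine_subset by (meson split_list subsetD)
  have "w \<in> set p1 \<or> w \<in> set p2" using w spine_subset vw split by auto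
  then show ?thesis
  proof
    assume "w \<in> set p1"
    then obtain q1 q2 where "p1 = q1 @ w # q2" by (auto dest: split_list)
    then have "main_path = q1 @ w # (q2 @ v # p2)" by (simp add: split)
    then show ?thesis using *[of q1 w "q2 @ v # p2" v l k] k l by auto
  qed (use *[OF split] k l in auto)
qed

end

end

section \<open>Four-point conditions in the closure of the cone of a tree\<close>

lemma tp_class_eqD:
  assumes "tp_class n x = tp_class n y" "x \<in> extensional (pairs n)"
  obtains c where "\<And>e. e \<in> pairs n \<Longrightarrow> x e = y e + ereal c"
proof -
  have x: "x = (\<lambda>e\<in>pairs n. x e + ereal 0)"
    using assms(2) by (auto simp: fun_eq_iff extensional_def zero_ereal_def[symmetric])
  have "x \<in> tp_class n x"
    unfolding tp_class_def mem_Collect_eq by (rule exI[of _ 0]) (rule x)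
  then have "x \<in> tp_class n y" by (simp only: assms(1))
  then obtain c where "x = (\<lambda>e\<in>pairs n. y e + ereal c)" unfolding tp_class_def by blast
  then show ?thesis using that by (metis restrict_apply')
qed

definition tp_space :: "nat \<Rightarrow> (nat set \<Rightarrow> ereal) topology" where
  "tp_space n = subtopology (product_topology (\<lambda>_. top_of_set {..<\<infinity>}) (pairs n))
     {x. \<exists>e\<in>pairs n. x e \<noteq> -\<infinity>}"

lemma topspace_tp_space:
  "topspace (tp_space n) = (pairs n \<rightarrow>\<^sub>E {..<\<infinity>}) \<inter> {x. \<exists>e\<in>pairs n. x e \<noteq> -\<infinity>}"
  by (simp add: tp_space_def)

lemma openin_tp_space:
  assumes "e \<in> pairs n" "open U"
  shows "openin (tp_space n) {x \<in> topspace (tp_space n). x e \<in> U}"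
proof -
  have "openin (top_of_set {..<\<infinity>}) ({..<\<infinity>} \<inter> U)" using assms(2) by blast
  moreover have "continuous_map (tp_space n) (top_of_set {..<\<infinity>}) (\<lambda>x. x e)"
    unfolding tp_space_def
    by (rule continuous_map_from_subtopology) (rule continuous_map_product_projection[OF assms(1)])
  ultimately have "openin (tp_space n) {x \<in> topspace (tp_space n). x e \<in> {..<\<infinity>} \<inter> U}"
    by (rule openin_continuous_map_preimage[rotated])
  moreover have "x e < \<infinity>" if "x \<in> topspace (tp_space n)" for x
    using that assms(1) by (auto simp: topspace_tp_space)
  ultimately show ?thesis by (smt (verit) Collect_cong Int_iff lessThan_iff)
qed

text \<open>\<open>sum_less_set\<close> is the open set where \<open>x\<^sub>e\<^sub>3 + x\<^sub>e\<^sub>4 < x\<^sub>e\<^sub>1 + x\<^sub>e\<^sub>2\<close>, written so as to avoid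
  sums of infinite values.\<close>

definition sum_less_set :: "nat \<Rightarrow> nat set \<Rightarrow> nat set \<Rightarrow> nat set \<Rightarrow> nat set \<Rightarrow> (nat set \<Rightarrow> ereal) set" where
  "sum_less_set n e3 e4 e1 e2 = {x \<in> topspace (tp_space n). \<exists>p q r s.
     x e3 < ereal p \<and> x e4 < ereal q \<and> ereal r < x e1 \<and> ereal s < x e2 \<and> p + q \<le> r + s}"

lemma openin_sum_less_set:
  assumes "{e1, e2, e3, e4} \<subseteq> pairs n"
  shows "openin (tp_space n) (sum_less_set n e3 e4 e1 e2)"
proof -
  let ?A = "\<lambda>e U. {x \<in> topspace (tp_space n). x e \<in> U}"
  define box where "box p q r s =
      ?A e3 {..<ereal p} \<inter> ?A e4 {..<ereal q} \<inter> ?A e1 {ereal r<..} \<inter> ?A e2 {ereal s<..}" for p q r s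
  have "sum_less_set n e3 e4 e1 e2 = \<Union>{box p q r s | p q r s. p + q \<le> r + s}"
  proof -
    have "x \<in> box p q r s \<longleftrightarrow> x \<in> topspace (tp_space n) \<and>
        x e3 < ereal p \<and> x e4 < ereal q \<and> ereal r < x e1 \<and> ereal s < x e2" for x p q r s
      by (auto simp: box_def)
    then show ?thesis unfolding sum_less_set_def by blast
  qed
  also have "openin (tp_space n) \<dots>"
  proof (rule openin_Union)
    fix K assume "K \<in> {box p q r s | p q r s. p + q \<le> r + s}"
    then obtain p q r s where K: "K = box p q r s" by blast
    show "openin (tp_space n) K"
      unfolding K box_def by (intro openin_Int openin_tp_space) (use assms in auto)
  qed
  finally show ?thesis .
qed

text \<open>Adding \<open>c\<close> to all coordinates shifts both sums by \<open>2 c\<close>. The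
  set is thus a union of classes, which is what makes its image open in the quotient
  topology.\<close>

lemma sum_less_set_cong:
  assumes x: "x \<in> sum_less_set n e3 e4 e1 e2" and y: "y \<in> topspace (tp_space n)"
    and eq: "\<And>e. e \<in> pairs n \<Longrightarrow> y e = x e + ereal c" and e: "{e1, e2, e3, e4} \<subseteq> pairs n"
  shows "y \<in> sum_less_set n e3 e4 e1 e2"
proof -
  obtain p q r s where "x e3 < ereal p" "x e4 < ereal q" "ereal r < x e1" "ereal s < x e2" "p + q \<le> r + s"
    using x unfolding sum_less_set_def by blast
  moreover have "(a + ereal c < b + ereal c) = (a < b)" for a b :: ereal
    by (cases a; cases b) auto
  ultimately have "y e3 < ereal p + ereal c" "y e4 < ereal q + ereal c" "ereal r + ereal c < y e1"
    "ereal s + ereal c < y e2" "(p + c) + (q + c) \<le> (r + c) + (s + c)"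
    using eq e by (auto simp del: plus_ereal.simps)
  then show ?thesis
    unfolding sum_less_set_def using y
    by (intro CollectI conjI exI[of _ "p + c"] exI[of _ "q + c"] exI[of _ "r + c"] exI[of _ "s + c"]) auto
qed

lemma openin_tp_topology_sum_less:
  assumes e: "{e1, e2, e3, e4} \<subseteq> pairs n"
  shows "openin (tp_topology n) (tp_class n ` sum_less_set n e3 e4 e1 e2)"
proof -
  let ?G = "sum_less_set n e3 e4 e1 e2"
  have sub: "?G \<subseteq> topspace (tp_space n)" by (auto simp: sum_less_set_def)
  have "{x \<in> topspace (tp_space n). tp_class n x \<in> tp_class n ` ?G} = ?G" (is "?L = _")
  proof
    show "?L \<subseteq> ?G"
    proof clarify
      fix x y assume x: "x \<in> topspace (tp_space n)" and y: "y \<in> ?G" and eq: "tp_class n x = tp_class n y"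
      have "x \<in> extensional (pairs n)" using x by (auto simp: topspace_tp_space PiE_def)
      from tp_class_eqD[OF eq this] obtain c where "\<And>e. e \<in> pairs n \<Longrightarrow> x e = y e + ereal c" by blast
      then show "x \<in> ?G" using sum_less_set_cong[OF y x _ e] by blast
    qed
    show "?G \<subseteq> ?L" using sub by blast
  qed
  with sub show ?thesis
    unfolding tp_topology_def tp_space_def[symmetric] openin_quotient_topology
    using openin_sum_less_set[OF e] by auto
qed

text \<open>If \<open>e3\<close> or \<open>e4\<close> were infinite at \<xi> while \<open>e1\<close>
  and \<open>e2\<close> are finite, then \<xi> would lie in the open set given by the strict
  reversed inequality. This set would meet \<open>C\<close>, where the inequality holds.\<close>

lemma closure_sum_le_infinite:
  assumes \<xi>: "\<xi> \<in> tp_topology n closure_of C" and e: "{e1, e2, e3, e4} \<subseteq> pairs n"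
    and C: "\<And>\<eta>. \<eta> \<in> C \<Longrightarrow> \<exists>y f. \<eta> = tp_class n y \<and> y \<in> extensional (pairs n) \<and>
      (\<forall>e\<in>{e1, e2, e3, e4}. y e = ereal (f e)) \<and> f e1 + f e2 \<le> f e3 + f e4"
    and fin: "e1 \<notin> infinite_pairs n \<xi>" "e2 \<notin> infinite_pairs n \<xi>"
  shows "e3 \<notin> infinite_pairs n \<xi> \<and> e4 \<notin> infinite_pairs n \<xi>"
proof (rule ccontr)
  assume inf: "\<not> (e3 \<notin> infinite_pairs n \<xi> \<and> e4 \<notin> infinite_pairs n \<xi>)"
  have "\<xi> \<in> topspace (tp_topology n)" using \<xi> by (simp add: in_closure_of)
  moreover have "topspace (tp_topology n) \<subseteq> tp_class n ` topspace (tp_space n)"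
    using openin_topspace[of "tp_topology n"]
    unfolding tp_topology_def tp_space_def[symmetric] openin_quotient_topology by blast
  ultimately obtain x where x: "x \<in> topspace (tp_space n)" and \<xi>_eq: "\<xi> = tp_class n x" by blast
  have iff: "f \<in> infinite_pairs n \<xi> \<longleftrightarrow> x f = -\<infinity>" if f: "f \<in> pairs n" for f
  proof -
    have "(\<forall>c::real. x f + ereal c = -\<infinity>) \<longleftrightarrow> x f = -\<infinity>"
      by (cases "x f") auto
    then show ?thesis
      using f by (auto simp: infinite_pairs_def \<xi>_eq tp_class_def)
  qed
  have lt: "x f < \<infinity>" if "f \<in> pairs n" for f using x that by (auto simp: topspace_tp_space)
  obtain \<alpha> \<beta> where ab: "x e1 = ereal \<alpha>" "x e2 = ereal \<beta>"
    using iff[of e1] iff[of e2] fin e lt[of e1] lt[of e2] by (cases "x e1"; cases "x e2") auto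
  obtain q3 q4 where q: "x e3 < ereal q3" "x e4 < ereal q4"
    using lt[of e3] lt[of e4] e by (metis insert_subset ereal_dense2)
  have "x \<in> sum_less_set n e3 e4 e1 e2"
  proof (cases "x e3 = -\<infinity>")
    case True
    \<comment> \<open>The bounds for \<open>x e1\<close> and \<open>x e2\<close> are lowered by 1 to
      be strict. The bound for \<open>x e3\<close> may be any real number, and is chosen so that the
      two sums of bounds agree.\<close>
    have "x e3 < ereal (\<alpha> + \<beta> - 2 - q4) \<and> x e4 < ereal q4 \<and> ereal (\<alpha> - 1) < x e1 \<and>
        ereal (\<beta> - 1) < x e2 \<and> (\<alpha> + \<beta> - 2 - q4) + q4 \<le> (\<alpha> - 1) + (\<beta> - 1)"
      using True q ab by simp
    then show ?thesis unfolding sum_less_set_def using x by blast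
  next
    case False
    then have "x e4 = -\<infinity>" using inf iff e by auto
    then have "x e3 < ereal q3 \<and> x e4 < ereal (\<alpha> + \<beta> - 2 - q3) \<and> ereal (\<alpha> - 1) < x e1 \<and>
        ereal (\<beta> - 1) < x e2 \<and> q3 + (\<alpha> + \<beta> - 2 - q3) \<le> (\<alpha> - 1) + (\<beta> - 1)"
      using q ab by simp
    then show ?thesis unfolding sum_less_set_def using x by blast
  qed
  then have "\<xi> \<in> tp_class n ` sum_less_set n e3 e4 e1 e2" by (simp add: \<xi>_eq)
  with \<xi> openin_tp_topology_sum_less[OF e]
  have "\<exists>\<eta>\<in>C. \<eta> \<in> tp_class n ` sum_less_set n e3 e4 e1 e2"
    unfolding in_closure_of by metis
  then obtain \<eta> where "\<eta> \<in> C" "\<eta> \<in> tp_class n ` sum_less_set n e3 e4 e1 e2"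
    by blast
  then obtain y f g where y: "\<eta> = tp_class n y" "y \<in> extensional (pairs n)"
      and f: "\<forall>e\<in>{e1, e2, e3, e4}. y e = ereal (f e)" "f e1 + f e2 \<le> f e3 + f e4"
      and g: "g \<in> sum_less_set n e3 e4 e1 e2" "\<eta> = tp_class n g"
    using C[of \<eta>] by blast
  obtain c where c: "\<And>e. e \<in> pairs n \<Longrightarrow> y e = g e + ereal c"
    using tp_class_eqD[of n y g] y g by metis
  \<comment> \<open>\<open>y\<close> and \<open>g\<close> represent the same class, so
    \<open>g\<close> is finite on the four pairs as well, and passing to \<open>g\<close> lowers
    both sides of the inequality by \<open>2 c\<close>.\<close>
  have g_eq: "g e = ereal (f e - c)" if "e \<in> {e1, e2, e3, e4}" for e
    using c[of e] f(1) that assms(2) by (cases "g e") auto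
  obtain p q r s where "g e3 < ereal p" "g e4 < ereal q" "ereal r < g e1" "ereal s < g e2" "p + q \<le> r + s"
    using g(1) unfolding sum_less_set_def by blast
  then show False using f(2) by (simp add: g_eq)
qed

text \<open>The consequences of the four-point condition for the quartet \<open>ab|cd\<close> that only involve the
  set of infinite coordinates.\<close>

definition four_point_infinite :: "nat set set \<Rightarrow> nat \<Rightarrow> nat \<Rightarrow> nat \<Rightarrow> nat \<Rightarrow> bool" where
  "four_point_infinite J a b c d \<longleftrightarrow>
     ({a, b} \<notin> J \<and> {c, d} \<notin> J \<longrightarrow> {a, c} \<notin> J \<and> {b, d} \<notin> J) \<and>
     ({a, c} \<notin> J \<and> {b, d} \<notin> J \<longleftrightarrow> {a, d} \<notin> J \<and> {b, c} \<notin> J)"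

text \<open>Every clause comes from one inequality between sums of path weights that holds on the
  whole cone; the equation in \<open>four_point\<close> counts as two inequalities.\<close>

lemma (in leaf_labeled_tree) quartet_imp_four_point_infinite:
  assumes \<xi>: "\<xi> \<in> tp_topology n closure_of tree_cone n V E lab"
    and abcd: "{a, b, c, d} \<subseteq> {1..n}" "distinct [a, b, c, d]"
    and Q: "quartet (lab a) (lab b) (lab c) (lab d)"
  shows "four_point_infinite (infinite_pairs n \<xi>) a b c d"
proof -
  have pair: "{k, l} \<in> pairs n" if "k \<in> {a, b, c, d}" "l \<in> {a, b, c, d}" "k \<noteq> l" for k l
    using that abcd by (auto simp: pairs_def)
  have cone: "\<exists>y \<omega>. \<eta> = tp_class n y \<and> y \<in> extensional (pairs n) \<and>
      (\<forall>e\<in>E. e \<inter> leaves V E = {} \<longrightarrow> 0 \<le> \<omega> e) \<and>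
      (\<forall>k l. {k, l} \<in> pairs n \<longrightarrow> y {k, l} = ereal (path_weight \<omega> (lab k) (lab l)))"
    if "\<eta> \<in> tree_cone n V E lab" for \<eta>
    using that unfolding tree_cone_def path_weight_def by blast
  have L: "{lab a, lab b, lab c, lab d} \<subseteq> leaves V E" "lab a \<noteq> lab b" "lab c \<noteq> lab d"
    using abcd lab_leaf lab_inject by auto
  have *: "{p', q'} \<notin> infinite_pairs n \<xi> \<and> {r', s'} \<notin> infinite_pairs n \<xi>"
    if in_abcd: "{p, q, r, s, p', q', r', s'} \<subseteq> {a, b, c, d}"
      and ne: "p \<noteq> q" "r \<noteq> s" "p' \<noteq> q'" "r' \<noteq> s'"
      and le: "\<And>\<omega>. (\<And>e. e \<in> E \<Longrightarrow> e \<inter> leaves V E = {} \<Longrightarrow> 0 \<le> \<omega> e) \<Longrightarrow>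
        path_weight \<omega> (lab p) (lab q) + path_weight \<omega> (lab r) (lab s) \<le>
        path_weight \<omega> (lab p') (lab q') + path_weight \<omega> (lab r') (lab s')"
      and fin: "{p, q} \<notin> infinite_pairs n \<xi>" "{r, s} \<notin> infinite_pairs n \<xi>"
    for p q r s p' q' r' s'
  proof (rule closure_sum_le_infinite[OF \<xi> _ _ fin])
    show sub: "{{p, q}, {r, s}, {p', q'}, {r', s'}} \<subseteq> pairs n"
      using in_abcd ne pair by auto
    fix \<eta> assume "\<eta> \<in> tree_cone n V E lab"
    then obtain y \<omega> where y: "\<eta> = tp_class n y" "y \<in> extensional (pairs n)"
      and \<omega>: "\<forall>e\<in>E. e \<inter> leaves V E = {} \<longrightarrow> 0 \<le> \<omega> e"
      and y_eq: "\<And>k l. {k, l} \<in> pairs n \<Longrightarrow> y {k, l} = ereal (path_weight \<omega> (lab k) (lab l))"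
      using cone by blast
    have "path_weight \<omega> (lab p) (lab q) + path_weight \<omega> (lab r) (lab s) \<le>
        path_weight \<omega> (lab p') (lab q') + path_weight \<omega> (lab r') (lab s')"
      using le[of \<omega>] \<omega> by blast
    then have "real_of_ereal (y {p, q}) + real_of_ereal (y {r, s}) \<le>
        real_of_ereal (y {p', q'}) + real_of_ereal (y {r', s'})"
      using sub by (simp add: y_eq)
    moreover have "\<forall>e\<in>{{p, q}, {r, s}, {p', q'}, {r', s'}}. y e = ereal (real_of_ereal (y e))"
      using sub by (auto simp: y_eq)
    ultimately show "\<exists>y f. \<eta> = tp_class n y \<and> y \<in> extensional (pairs n) \<and>
        (\<forall>e\<in>{{p, q}, {r, s}, {p', q'}, {r', s'}}. y e = ereal (f e)) \<and>
        f {p, q} + f {r, s} \<le> f {p', q'} + f {r', s'}"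
      using y by (intro exI[of _ y] exI[of _ "\<lambda>e. real_of_ereal (y e)"]) blast
  qed
  let ?J = "infinite_pairs n \<xi>"
  have "{a, c} \<notin> ?J \<and> {b, d} \<notin> ?J" if "{a, b} \<notin> ?J" "{c, d} \<notin> ?J"
    by (rule *[OF _ _ _ _ _ _ that]) (use abcd(2) four_point(2)[OF L Q] in auto)
  moreover have "{a, d} \<notin> ?J \<and> {b, c} \<notin> ?J" if "{a, c} \<notin> ?J" "{b, d} \<notin> ?J"
    by (rule *[OF _ _ _ _ _ _ that]) (use abcd(2) four_point(1)[OF L Q] in auto)
  moreover have "{a, c} \<notin> ?J \<and> {b, d} \<notin> ?J" if "{a, d} \<notin> ?J" "{b, c} \<notin> ?J"
    by (rule *[OF _ _ _ _ _ _ that]) (use abcd(2) four_point(1)[OF L Q] in auto)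
  ultimately show ?thesis unfolding four_point_infinite_def by blast
qed

section \<open>Compatible sets\<close>

text \<open>Condition (ii) without reference to the part of the tree that contains \<open>k\<close>.\<close>

definition pivot :: "nat rel \<Rightarrow> nat set set \<Rightarrow> nat set set \<Rightarrow> nat \<Rightarrow> nat \<Rightarrow> nat \<Rightarrow> nat \<Rightarrow> bool" where
  "pivot r J I a b k t \<longleftrightarrow>
     {a, k} \<notin> I \<and> {b, k} \<in> I \<and> {b, t} \<in> I \<and> {k, t} \<in> I \<and> (t, k) \<in> r \<and> t \<noteq> k \<and>
     {a, t} \<notin> J \<and> {b, t} \<notin> J \<and>
     (\<forall>s. (s, k) \<in> r \<and> s \<noteq> k \<and> {a, s} \<notin> J \<and> {b, s} \<notin> J \<longrightarrow> (s, t) \<in> r)"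

text \<open>What remains of the tree and the tropical point is condensed in the last assumptions.
  Comparable labels are attached to the same vertex of the main path, giving the quartet ij|kl or a
  star; incomparable ones to different vertices, giving ik|jl or il|jk; the cherry property speaks
  about a chain of three labels together with \<open>i\<close>.\<close>

locale compatible_set =
  fixes n i j :: nat and r :: "nat rel" and J I :: "nat set set" and L :: "nat set"
  defines L_def: "L \<equiv> {1..n} - {i, j}"
  assumes ij: "i \<in> {1..n}" "j \<in> {1..n}" "i \<noteq> j" "{i, j} \<notin> J"
    and order: "partial_order_on L r"
    and I_pairs: "I \<subseteq> pairs n" and J_pairs: "J \<subseteq> pairs n" and card_I: "card I = 2 * (n - 2)" and ij_I: "{i, j} \<notin> I"
    and compatible: "k \<in> L \<Longrightarrow>
      {i, k} \<in> I \<and> {j, k} \<in> I \<and> (\<forall>l. (l, k) \<in> r \<and> l \<noteq> k \<longrightarrow> {i, l} \<in> J \<or> {j, l} \<in> J) \<or>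
      (\<exists>t. pivot r J I i j k t) \<or> (\<exists>t. pivot r J I j i k t)"
    and comparable_four_point: "(k, l) \<in> r \<Longrightarrow> k \<noteq> l \<Longrightarrow> four_point_infinite J i j k l"
    and incomparable_four_point: "k \<in> L \<Longrightarrow> l \<in> L \<Longrightarrow> (k, l) \<notin> r \<Longrightarrow> (l, k) \<notin> r \<Longrightarrow>
      four_point_infinite J i k j l \<or> four_point_infinite J i l j k"
    and cherry_four_point: "(k, l) \<in> r \<Longrightarrow> k \<noteq> l \<Longrightarrow> (l, m) \<in> r \<Longrightarrow> l \<noteq> m \<Longrightarrow>
      four_point_infinite J k l i m \<or> four_point_infinite J l m i k"
begin

lemma finite_L: "finite L" and card_L: "card L = n - 2"
  using ij by (auto simp: L_def)

lemma L_ne: "k \<in> L \<Longrightarrow> k \<noteq> i \<and> k \<noteq> j"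
  by (auto simp: L_def)

lemma r_L: "(k, l) \<in> r \<Longrightarrow> k \<in> L \<and> l \<in> L"
  using partial_order_onD(4)[OF order] by auto

lemma r_antisym: "(k, l) \<in> r \<Longrightarrow> (l, k) \<in> r \<Longrightarrow> k = l"
  using partial_order_onD(3)[OF order] by (auto dest: antisymD)

lemma wf_r: "wf (r - Id)"
proof (rule partial_order_on_well_order_on[OF _ order])
  show "finite r" using partial_order_onD(4)[OF order] finite_L by (meson finite_SigmaI finite_subset)
qed

lemma compatible_cases:
  assumes "k \<in> L"
  obtains "{i, k} \<in> I" "{j, k} \<in> I" "\<And>l. (l, k) \<in> r \<Longrightarrow> l \<noteq> k \<Longrightarrow> {i, l} \<in> J \<or> {j, l} \<in> J"
    | t where "pivot r J I i j k t" | t where "pivot r J I j i k t"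
  using compatible[OF assms] by metis

lemma pairs_cases:
  assumes "{k, l} \<in> pairs n" "{k, l} \<noteq> {i, j}"
  obtains "k = i" "l \<in> L" | "k = j" "l \<in> L" | "l = i" "k \<in> L" | "l = j" "k \<in> L" | "k \<in> L" "l \<in> L" "k \<noteq> l"
proof -
  have "k \<in> {1..n}" "l \<in> {1..n}" "k \<noteq> l" using assms(1) by (auto simp: pairs_def)
  then show ?thesis using assms(2) that unfolding L_def by blast
qed

text \<open>The cardinality condition forces \<open>I\<close> to contain no other pairs than the two that the
  conditions (i), (ii) and (iii) provide for each \<open>k\<close>.\<close>

definition first_edge :: "nat \<Rightarrow> nat set" where
  "first_edge k = (if {i, k} \<in> I then {i, k} else {j, k})"

definition the_pivot :: "nat \<Rightarrow> nat" where
  "the_pivot k = (SOME t. pivot r J I i j k t \<or> pivot r J I j i k t)"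

definition second_edge :: "nat \<Rightarrow> nat set" where
  "second_edge k = (if {i, k} \<in> I \<and> {j, k} \<in> I then {j, k} else {k, the_pivot k})"

lemma the_pivot:
  assumes "k \<in> L" "\<not> ({i, k} \<in> I \<and> {j, k} \<in> I)"
  shows "(the_pivot k, k) \<in> r" "the_pivot k \<noteq> k" "{k, the_pivot k} \<in> I"
proof -
  have "\<exists>t. pivot r J I i j k t \<or> pivot r J I j i k t"
    using assms by (elim compatible_cases) auto
  then have "pivot r J I i j k (the_pivot k) \<or> pivot r J I j i k (the_pivot k)"
    unfolding the_pivot_def by (rule someI_ex)
  then show "(the_pivot k, k) \<in> r" "the_pivot k \<noteq> k" "{k, the_pivot k} \<in> I"
    unfolding pivot_def by auto
qed

lemma first_edge_I: "k \<in> L \<Longrightarrow> first_edge k \<in> I"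
  unfolding first_edge_def by (elim compatible_cases) (auto simp: pivot_def)

lemma second_edge_I: "k \<in> L \<Longrightarrow> second_edge k \<in> I"
  unfolding second_edge_def using the_pivot(3) by auto

lemma second_edge_simps:
  "{i, k} \<in> I \<and> {j, k} \<in> I \<Longrightarrow> second_edge k = {j, k}"
  "\<not> ({i, k} \<in> I \<and> {j, k} \<in> I) \<Longrightarrow> second_edge k = {k, the_pivot k}"
  unfolding second_edge_def by (rule if_P if_not_P, assumption)+

text \<open>The 2(n - 2) chosen pairs are distinct. Two labels with the same second edge through
  pivots would lie strictly below each other; and a second edge \<open>{j, k}\<close> occurs only if
  the first edge of \<open>k\<close> is \<open>{i, k}\<close>.\<close>

lemma I_eq: "I = first_edge ` L \<union> second_edge ` L"
proof -
  have "inj_on first_edge L"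
    using L_ne by (intro inj_onI) (auto simp: first_edge_def doubleton_eq_iff split: if_splits)
  moreover have "inj_on second_edge L"
  proof (rule inj_onI)
    fix k l assume kl: "k \<in> L" "l \<in> L" and eq: "second_edge k = second_edge l"
    show "k = l"
    proof (cases "{i, k} \<in> I \<and> {j, k} \<in> I"; cases "{i, l} \<in> I \<and> {j, l} \<in> I")
      assume *: "\<not> ({i, k} \<in> I \<and> {j, k} \<in> I)" "\<not> ({i, l} \<in> I \<and> {j, l} \<in> I)"
      then have "{k, the_pivot k} = {l, the_pivot l}" using eq second_edge_simps by metis
      then show ?thesis
        using the_pivot[OF kl(1) *(1)] the_pivot[OF kl(2) *(2)] r_antisym by (metis doubleton_eq_iff)
    next
      assume *: "{i, k} \<in> I \<and> {j, k} \<in> I" "\<not> ({i, l} \<in> I \<and> {j, l} \<in> I)"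
      then have "{j, k} = {l, the_pivot l}" using eq second_edge_simps by metis
      then have "j = l \<or> j = the_pivot l" by (auto simp: doubleton_eq_iff)
      then show ?thesis using L_ne[OF conjunct1[OF r_L[OF the_pivot(1)[OF kl(2) *(2)]]]] L_ne[OF kl(2)] by simp
    next
      assume *: "\<not> ({i, k} \<in> I \<and> {j, k} \<in> I)" "{i, l} \<in> I \<and> {j, l} \<in> I"
      then have "{k, the_pivot k} = {j, l}" using eq second_edge_simps by metis
      then have "j = k \<or> j = the_pivot k" by (auto simp: doubleton_eq_iff)
      then show ?thesis using L_ne[OF conjunct1[OF r_L[OF the_pivot(1)[OF kl(1) *(1)]]]] L_ne[OF kl(1)] by simp
    next
      assume "{i, k} \<in> I \<and> {j, k} \<in> I" "{i, l} \<in> I \<and> {j, l} \<in> I"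
      then have "{j, k} = {j, l}" using eq second_edge_simps by metis
      then show ?thesis by (metis doubleton_eq_iff)
    qed
  qed
  moreover have "first_edge ` L \<inter> second_edge ` L = {}"
  proof -
    have "first_edge k \<noteq> second_edge l" if kl: "k \<in> L" "l \<in> L" for k l
    proof (cases "{i, l} \<in> I \<and> {j, l} \<in> I")
      case True
      then have "second_edge l = {j, l}" by (rule second_edge_simps)
      then show ?thesis
        using True L_ne[OF kl(1)] L_ne[OF kl(2)] ij(3) by (auto simp: first_edge_def doubleton_eq_iff)
    next
      case False
      then have "i \<notin> second_edge l" "j \<notin> second_edge l"
        using L_ne[OF kl(2)] L_ne[OF conjunct1[OF r_L[OF the_pivot(1)[OF kl(2) False]]]]
        by (auto simp: second_edge_simps(2)[OF False])
      then show ?thesis by (auto simp: first_edge_def)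
    qed
    then show ?thesis by auto
  qed
  ultimately have "card (first_edge ` L \<union> second_edge ` L) = card I"
    using finite_L by (simp add: card_Un_disjoint card_image card_I card_L)
  moreover have "finite I"
    using I_pairs by (rule finite_subset) (simp add: pairs_def)
  ultimately show ?thesis
    using first_edge_I second_edge_I by (intro card_subset_eq[symmetric]) auto
qed

lemma I_inner_edge:
  assumes kl: "{k, l} \<in> I" "k \<in> L" "l \<in> L"
  obtains "\<not> ({i, k} \<in> I \<and> {j, k} \<in> I)" "l = the_pivot k"
    | "\<not> ({i, l} \<in> I \<and> {j, l} \<in> I)" "k = the_pivot l"
proof -
  have "i \<notin> {k, l}" "j \<notin> {k, l}" using kl L_ne by auto
  then have "{k, l} \<notin> first_edge ` L" by (auto simp: first_edge_def)
  moreover have "{k, l} \<in> first_edge ` L \<union> second_edge ` L" using kl(1) by (simp only: I_eq[symmetric])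
  ultimately obtain m where m: "m \<in> L" "{k, l} = second_edge m" by blast
  have *: "\<not> ({i, m} \<in> I \<and> {j, m} \<in> I)"
  proof
    assume "{i, m} \<in> I \<and> {j, m} \<in> I"
    then have "j \<in> {k, l}" using second_edge_simps(1)[of m] m(2) by simp
    with \<open>j \<notin> {k, l}\<close> show False ..
  qed
  have "{k, l} = {m, the_pivot m}" using m(2) second_edge_simps(2)[OF *] by simp
  then consider "k = m" "l = the_pivot m" | "l = m" "k = the_pivot m" by (auto simp: doubleton_eq_iff)
  then show ?thesis using * that by cases auto
qed

text \<open>For the recursion along the order: each pair of \<open>I\<close> joining
  \<open>k\<close> to a smaller label is one equation for the row of \<open>k\<close>. There is at
  most one such equation, and none if both entries of the row are prescribed already.\<close>

lemma I_below_unique: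
  assumes kt: "{k, t} \<in> I" "(t, k) \<in> r" "t \<noteq> k"
  shows "\<not> ({i, k} \<in> I \<and> {j, k} \<in> I) \<and> t = the_pivot k"
  using kt(1)
proof (rule I_inner_edge)
  show "k \<in> L" "t \<in> L" using r_L kt by auto
  assume "\<not> ({i, t} \<in> I \<and> {j, t} \<in> I)" "k = the_pivot t"
  then show ?thesis using the_pivot(1,2)[of t] r_antisym kt \<open>t \<in> L\<close> by metis
qed auto

end

section \<open>Points with prescribed coordinates on a compatible set\<close>

text \<open>With \<open>row2\<close>, the two columns of a matrix whose rows at \<open>i\<close> and
  \<open>j\<close> are (0, -1) and (1, 0). With this normalization the minor at
  \<open>(i, j)\<close> is 1, those at \<open>(i, k)\<close> and \<open>(j, k)\<close> are the
  entries of row \<open>k\<close>, and \<open>minor\<close> has the same shape as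
  \<open>ucoord\<close>.\<close>

definition row1 :: "nat \<Rightarrow> nat \<Rightarrow> (nat \<Rightarrow> 'a::zero_neq_one) \<Rightarrow> nat \<Rightarrow> 'a" where
  "row1 i j f k = (if k = i then 0 else if k = j then 1 else f k)"

definition row2 :: "nat \<Rightarrow> nat \<Rightarrow> (nat \<Rightarrow> 'a::comm_ring_1) \<Rightarrow> nat \<Rightarrow> 'a" where
  "row2 i j g k = (if k = i then - 1 else if k = j then 0 else g k)"

definition minor :: "nat \<Rightarrow> nat \<Rightarrow> (nat \<Rightarrow> 'a::comm_ring_1) \<Rightarrow> (nat \<Rightarrow> 'a) \<Rightarrow> nat \<Rightarrow> nat \<Rightarrow> 'a" where
  "minor i j f g k l = row1 i j f k * row2 i j g l - row1 i j f l * row2 i j g k"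

lemma minor_swap: "minor i j f g l k = - minor i j f g k l"
  by (simp add: minor_def)

text \<open>Expansions of the vanishing determinant of a three-by-three matrix with a repeated
  column. They show that two rows proportional to the same nonzero row \<open>t\<close> have minor
  zero.\<close>

lemma minor_plucker:
  "minor i j f g k l * row1 i j f t = minor i j f g k t * row1 i j f l + minor i j f g t l * row1 i j f k"
  "minor i j f g k l * row2 i j g t = minor i j f g k t * row2 i j g l + minor i j f g t l * row2 i j g k"
  by (simp_all add: minor_def algebra_simps)

context compatible_set
begin

lemma minor_simps:
  assumes "k \<in> L"
  shows "minor i j f g i k = f k" "minor i j f g k i = - f k" "minor i j f g j k = g k"
    "minor i j f g k j = - g k" "row1 i j f k = f k" "row2 i j g k = g k"
  using L_ne[OF assms] ij(3) by (auto simp: minor_def row1_def row2_def)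

lemma minor_inner: "k \<in> L \<Longrightarrow> l \<in> L \<Longrightarrow> minor i j f g k l = f k * g l - f l * g k"
  by (simp add: minor_def minor_simps)

text \<open>The rows are found by recursion along the order. A label with a pivot \<open>t\<close>
  has one entry prescribed, and the other solves a linear equation whose coefficient is an entry of
  row \<open>t\<close>; that entry is prescribed and nonzero, since its pair lies in
  \<open>I - J\<close>.\<close>

lemma exists_minors:
  fixes z :: "nat \<Rightarrow> nat \<Rightarrow> 'a::field"
  assumes swap: "\<And>k l. z l k = - z k l"
    and nz: "\<And>a t. a \<in> {i, j} \<Longrightarrow> {a, t} \<in> I - J \<Longrightarrow> z a t \<noteq> 0"
  shows "\<exists>f g. \<forall>k l. {k, l} \<in> I \<longrightarrow> minor i j f g k l = z k l"
proof -
  \<comment> \<open>The requirement on row \<open>x\<close> involves only rows of smaller labels, as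
    the choice along a well-founded relation demands. Every pair of \<open>I\<close> inside
    \<open>L\<close> reappears as the equation for its larger member.\<close>
  define P where "P h x p \<longleftrightarrow> (x \<in> L \<longrightarrow>
      ({i, x} \<in> I \<longrightarrow> fst p = z i x) \<and> ({j, x} \<in> I \<longrightarrow> snd p = z j x) \<and>
      (\<forall>t. (t, x) \<in> r \<and> t \<noteq> x \<and> {x, t} \<in> I \<longrightarrow> fst p * snd (h t) - fst (h t) * snd p = z x t))"
    for h :: "nat \<Rightarrow> 'a \<times> 'a" and x p
  have "\<exists>h. \<forall>x. P h x (h x)"
  proof (rule dependent_wf_choice[OF wf_r])
    fix f g :: "nat \<Rightarrow> 'a \<times> 'a" and x p
    assume "\<And>y. (y, x) \<in> r - Id \<Longrightarrow> f y = g y"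
    then have "\<And>y. (y, x) \<in> r \<Longrightarrow> y \<noteq> x \<Longrightarrow> f y = g y" by blast
    then show "P f x p = P g x p" unfolding P_def by (intro imp_cong conj_cong all_cong1 refl) auto
  next
    fix x and h :: "nat \<Rightarrow> 'a \<times> 'a" assume IH: "\<And>y. (y, x) \<in> r - Id \<Longrightarrow> P h y (h y)"
    show "\<exists>p. P h x p"
    proof (cases "x \<in> L")
      case True
      then show ?thesis
      proof (cases rule: compatible_cases)
        case 1
        then have "P h x (z i x, z j x)" unfolding P_def using I_below_unique by auto
        then show ?thesis by blast
      next
        case (2 t)
        then have t: "(t, x) \<in> r" "t \<noteq> x" "{x, t} \<in> I" "{j, t} \<in> I - J" "{i, x} \<notin> I"
          by (auto simp: pivot_def)
        have "snd (h t) = z j t" using IH[of t] t r_L unfolding P_def by auto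
        moreover have "z j t \<noteq> 0" using nz t by auto
        \<comment> \<open>The fraction is the solution \<open>f x\<close> of the pivot equation
          \<open>f x * g t - f t * g x = z x t\<close> with \<open>g t = z j t\<close> and
          \<open>g x = z j x\<close>.\<close>
        ultimately have "(z x t + fst (h t) * z j x) / z j t * snd (h t) - fst (h t) * z j x = z x t"
          by simp
        moreover have "s = t" if "(s, x) \<in> r" "s \<noteq> x" "{x, s} \<in> I" for s
          using I_below_unique[OF that(3,1,2)] I_below_unique[OF t(3,1,2)] by simp
        ultimately have "P h x ((z x t + fst (h t) * z j x) / z j t, z j x)"
          unfolding P_def using t(5) by auto
        then show ?thesis by blast
      next
        case (3 t)
        then have t: "(t, x) \<in> r" "t \<noteq> x" "{x, t} \<in> I" "{i, t} \<in> I - J" "{j, x} \<notin> I"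
          by (auto simp: pivot_def)
        have "fst (h t) = z i t" using IH[of t] t r_L unfolding P_def by auto
        moreover have "z i t \<noteq> 0" using nz t by auto
        ultimately have "z i x * snd (h t) - fst (h t) * ((z i x * snd (h t) - z x t) / z i t) = z x t"
          by simp
        moreover have "s = t" if "(s, x) \<in> r" "s \<noteq> x" "{x, s} \<in> I" for s
          using I_below_unique[OF that(3,1,2)] I_below_unique[OF t(3,1,2)] by simp
        ultimately have "P h x (z i x, (z i x * snd (h t) - z x t) / z i t)"
          unfolding P_def using t(5) by auto
        then show ?thesis by blast
      qed
    qed (auto simp: P_def)
  qed
  then obtain h where h: "\<And>x. P h x (h x)" by blast
  define f g where "f = (\<lambda>k. fst (h k))" and "g = (\<lambda>k. snd (h k))"
  have below: "minor i j f g k t = z k t" if "(t, k) \<in> r" "t \<noteq> k" "{k, t} \<in> I" for k t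
    using h[of k] that r_L[OF that(1)] by (auto simp: P_def minor_inner f_def g_def)
  have "minor i j f g k l = z k l" if kl: "{k, l} \<in> I" for k l
  proof -
    have "{k, l} \<in> pairs n" "{k, l} \<noteq> {i, j}" using kl I_pairs ij_I by auto
    then show ?thesis
    proof (cases rule: pairs_cases)
      case 1
      then show ?thesis using h[of l] kl by (simp add: P_def minor_simps f_def)
    next
      case 2
      then show ?thesis using h[of l] kl by (simp add: P_def minor_simps g_def)
    next
      case 3
      then show ?thesis using h[of k] kl swap[of k i] by (simp add: P_def minor_simps f_def insert_commute)
    next
      case 4
      then show ?thesis using h[of k] kl swap[of k j] by (simp add: P_def minor_simps g_def insert_commute)
    next
      case 5
      from kl 5(1,2) show ?thesis
      proof (rule I_inner_edge)
        assume "\<not> ({i, k} \<in> I \<and> {j, k} \<in> I)" "l = the_pivot k"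
        then show ?thesis using below the_pivot 5 kl by metis
      next
        assume "\<not> ({i, l} \<in> I \<and> {j, l} \<in> I)" "k = the_pivot l"
        then have "minor i j f g l k = z l k" using below the_pivot 5 by metis
        then show ?thesis using minor_swap swap by metis
      qed
    qed
  qed
  then show ?thesis by blast
qed

text \<open>The recursion of \<open>exists_minors\<close> read as an elimination: each entry is
  either a minor indexed by \<open>I\<close> or the solution of a pivot equation, whose coefficient
  is invertible in \<open>C\<close>.\<close>

lemma rows_in_subring:
  fixes C :: "'a::field set"
  assumes C: "\<And>x y. x \<in> C \<Longrightarrow> y \<in> C \<Longrightarrow> x + y \<in> C" "\<And>x y. x \<in> C \<Longrightarrow> y \<in> C \<Longrightarrow> x * y \<in> C"
    "\<And>x. x \<in> C \<Longrightarrow> - x \<in> C"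
    and I: "\<And>k l. {k, l} \<in> I \<Longrightarrow> minor i j f g k l \<in> C"
    and H: "\<And>a t. a \<in> {i, j} \<Longrightarrow> {a, t} \<in> I - J \<Longrightarrow> minor i j f g a t \<noteq> 0 \<and> inverse (minor i j f g a t) \<in> C"
  shows "k \<in> L \<Longrightarrow> f k \<in> C \<and> g k \<in> C"
proof (induction k rule: wf_induct_rule[OF wf_r])
  case (1 k)
  have f: "f x \<in> C" if "{i, x} \<in> I" "x \<in> L" for x using I[OF that(1)] that by (simp add: minor_simps)
  have g: "g x \<in> C" if "{j, x} \<in> I" "x \<in> L" for x using I[OF that(1)] that by (simp add: minor_simps)
  have diff: "x - y \<in> C" if "x \<in> C" "y \<in> C" for x y
    using C(1)[OF that(1) C(3)[OF that(2)]] by simp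
  from \<open>k \<in> L\<close> show ?case
  proof (cases rule: compatible_cases)
    case 1
    then show ?thesis using f g \<open>k \<in> L\<close> by auto
  next
    case (2 t)
    then have t: "(t, k) \<in> r" "t \<noteq> k" "{k, t} \<in> I" "{j, t} \<in> I - J" "{j, k} \<in> I"
      by (auto simp: pivot_def)
    have tL: "t \<in> L" using r_L t by blast
    have ft: "f t \<in> C" using 1 t tL by auto
    have gt: "g t \<noteq> 0" "inverse (g t) \<in> C" using H[of j t] t tL by (simp_all add: minor_simps)
    have "f k * g t = minor i j f g k t + f t * g k"
      using \<open>k \<in> L\<close> tL by (simp add: minor_inner)
    then have "f k = (minor i j f g k t + f t * g k) * inverse (g t)"
      using gt by (simp add: field_simps)
    then show ?thesis using C I[OF t(3)] ft gt g[OF t(5) \<open>k \<in> L\<close>] by auto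
  next
    case (3 t)
    then have t: "(t, k) \<in> r" "t \<noteq> k" "{k, t} \<in> I" "{i, t} \<in> I - J" "{i, k} \<in> I"
      by (auto simp: pivot_def)
    have tL: "t \<in> L" using r_L t by blast
    have gt: "g t \<in> C" using 1 t tL by auto
    have ft: "f t \<noteq> 0" "inverse (f t) \<in> C" using H[of i t] t tL by (simp_all add: minor_simps)
    have "f t * g k = f k * g t - minor i j f g k t"
      using \<open>k \<in> L\<close> tL by (simp add: minor_inner)
    then have "g k = (f k * g t - minor i j f g k t) * inverse (f t)"
      using ft by (simp add: field_simps)
    then show ?thesis using C diff I[OF t(3)] ft gt f[OF t(5) \<open>k \<in> L\<close>] by auto
  qed
qed

text \<open>This is where the four-point conditions and the cherry property enter.\<close>

context
  fixes f g :: "nat \<Rightarrow> 'a::field"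
  assumes minor_zero: "\<And>k l. {k, l} \<in> I \<inter> J \<Longrightarrow> minor i j f g k l = 0"
    and minor_nonzero: "\<And>a t. a \<in> {i, j} \<Longrightarrow> {a, t} \<in> I - J \<Longrightarrow> minor i j f g a t \<noteq> 0"
begin

text \<open>The entry not prescribed by \<open>I\<close> is the point at issue. For
  \<open>{i, k}\<close> in \<open>J\<close>, with pivot \<open>t\<close>, the quartet ij|tk forces
  \<open>{j, k}\<close> and \<open>{k, t}\<close> into \<open>J\<close>. Both are prescribed to be
  zero, so the pivot equation reads \<open>f k * g t = 0\<close> with \<open>g t\<close>
  nonzero.\<close>

lemma row_zero:
  assumes "k \<in> L"
  shows "{i, k} \<in> J \<Longrightarrow> f k = 0" "{j, k} \<in> J \<Longrightarrow> g k = 0"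
proof -
  have *: "{a, k} \<in> J \<Longrightarrow> {k, t} \<in> J \<and> {b, k} \<in> J"
    if piv: "pivot r J I a b k t" and ab: "(a, b) = (i, j) \<or> (a, b) = (j, i)" for a b t
  proof -
    have t: "(t, k) \<in> r" "t \<noteq> k" "{a, t} \<notin> J" "{b, t} \<notin> J" using piv by (auto simp: pivot_def)
    have "four_point_infinite J i j t k" using comparable_four_point[OF t(1,2)] .
    then show "{a, k} \<in> J \<Longrightarrow> {k, t} \<in> J \<and> {b, k} \<in> J"
      using ab ij(4) t unfolding four_point_infinite_def by (auto simp: insert_commute)
  qed
  have ik: "f x = 0" if "{i, x} \<in> I \<inter> J" "x \<in> L" for x
    using minor_zero[OF that(1)] that(2) by (simp add: minor_simps)
  have jk: "g x = 0" if "{j, x} \<in> I \<inter> J" "x \<in> L" for x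
    using minor_zero[OF that(1)] that(2) by (simp add: minor_simps)
  show "f k = 0" if J: "{i, k} \<in> J"
    using assms
  proof (cases rule: compatible_cases)
    case (2 t)
    then have t: "(t, k) \<in> r" "{k, t} \<in> I" "{j, t} \<in> I - J" "{j, k} \<in> I" by (auto simp: pivot_def)
    have "{k, t} \<in> J" "{j, k} \<in> J" using *[OF 2] J by auto
    then have "minor i j f g k t = 0" "g k = 0" using t minor_zero jk assms by auto
    moreover have "g t \<noteq> 0" using minor_nonzero[OF _ t(3)] r_L[OF t(1)] by (simp add: minor_simps)
    ultimately show ?thesis using minor_inner[OF assms, of t f g] r_L[OF t(1)] by auto
  qed (use J ik assms in \<open>auto simp: pivot_def\<close>)
  show "g k = 0" if J: "{j, k} \<in> J"
    using assms
  proof (cases rule: compatible_cases)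
    case (3 t)
    then have t: "(t, k) \<in> r" "{k, t} \<in> I" "{i, t} \<in> I - J" "{i, k} \<in> I" by (auto simp: pivot_def)
    have "{k, t} \<in> J" "{i, k} \<in> J" using *[OF 3] J by auto
    then have "minor i j f g k t = 0" "f k = 0" using t minor_zero ik assms by auto
    moreover have "f t \<noteq> 0" using minor_nonzero[OF _ t(3)] r_L[OF t(1)] by (simp add: minor_simps)
    ultimately show ?thesis using minor_inner[OF assms, of t f g] r_L[OF t(1)] by auto
  qed (use J jk assms in \<open>auto simp: pivot_def\<close>)
qed

text \<open>Condition (i) for \<open>k\<close> is impossible, since \<open>l\<close> has no entry in
  \<open>J\<close>. If the pivot \<open>t\<close> of \<open>k\<close> differs from \<open>l\<close>,
  it lies between \<open>l\<close> and \<open>k\<close> by maximality, and either alternative of the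
  cherry property puts \<open>{k, t}\<close> and \<open>{t, l}\<close> into \<open>J\<close>. The
  first minor is prescribed to be zero and the second vanishes by induction, so rows
  \<open>k\<close> and \<open>l\<close> are both proportional to the nonzero row
  \<open>t\<close>.\<close>

lemma comparable_minor_zero:
  "(l, k) \<in> r \<Longrightarrow> l \<noteq> k \<Longrightarrow> {k, l} \<in> J \<Longrightarrow> {i, k} \<notin> J \<Longrightarrow> {j, k} \<notin> J \<Longrightarrow> {i, l} \<notin> J \<Longrightarrow> {j, l} \<notin> J \<Longrightarrow>
   minor i j f g k l = 0"
proof (induction k arbitrary: l rule: wf_induct_rule[OF wf_r])
  case (1 k)
  have kL: "k \<in> L" "l \<in> L" using r_L \<open>(l, k) \<in> r\<close> by auto
  have *: "minor i j f g k l = 0"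
    if piv: "pivot r J I a b k t" and ab: "(a, b) = (i, j) \<or> (a, b) = (j, i)" for a b t
  proof (cases "l = t")
    case True
    then show ?thesis using piv minor_zero 1(4) by (auto simp: pivot_def)
  next
    case False
    have t: "(t, k) \<in> r" "t \<noteq> k" "{i, t} \<notin> J" "{j, t} \<notin> J" "{k, t} \<in> I" "{b, t} \<in> I - J" "(l, t) \<in> r"
      using piv ab 1 by (auto simp: pivot_def)
    have tL: "t \<in> L" using r_L t by blast
    have "four_point_infinite J l t i k \<or> four_point_infinite J t k i l"
      using cherry_four_point[OF t(7) False t(1,2)] .
    then have "{k, t} \<in> J" "{t, l} \<in> J"
      using 1(4-8) t(3,4) unfolding four_point_infinite_def by (auto simp: insert_commute)
    then have kt: "minor i j f g k t = 0" using t minor_zero by auto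
    have tl: "minor i j f g t l = 0"
      using 1(1)[of t l] \<open>{t, l} \<in> J\<close> t False 1(7,8) by auto
    have "f t \<noteq> 0 \<or> g t \<noteq> 0"
      using minor_nonzero[OF _ t(6)] ab tL by (auto simp: minor_simps)
    then show ?thesis
      using minor_plucker[of i j f g k l t] kt tl tL by (auto simp: minor_simps)
  qed
  from kL(1) show ?case
  proof (cases rule: compatible_cases)
    case 1
    then show ?thesis using 1(3)[of l] \<open>(l, k) \<in> r\<close> \<open>l \<noteq> k\<close> \<open>{i, l} \<notin> J\<close> \<open>{j, l} \<notin> J\<close> by blast
  qed (use * in auto)
qed

text \<open>If an entry of row \<open>k\<close> or \<open>l\<close> belongs to \<open>J\<close>,
  each possible quartet forces a zero factor in both products of the minor. If none does, the
  quartets ik|jl and il|jk are incompatible with \<open>{k, l}\<close> being in \<open>J\<close>, so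
  the labels are comparable.\<close>

lemma minor_J_zero:
  assumes "{k, l} \<in> J"
  shows "minor i j f g k l = 0"
proof -
  have "{k, l} \<in> pairs n" "{k, l} \<noteq> {i, j}" using assms J_pairs ij by auto
  then show ?thesis
  proof (cases rule: pairs_cases)
    case 5
    show ?thesis
    proof (cases "{i, k} \<in> J \<or> {j, l} \<in> J \<or> {i, l} \<in> J \<or> {j, k} \<in> J")
      case True
      have "four_point_infinite J i j k l \<or> four_point_infinite J i j l k \<or>
          four_point_infinite J i k j l \<or> four_point_infinite J i l j k"
        using comparable_four_point incomparable_four_point 5 by metis
      then have "({i, k} \<in> J \<or> {j, l} \<in> J) \<and> ({i, l} \<in> J \<or> {j, k} \<in> J)"
        using assms True ij(4) unfolding four_point_infinite_def by (elim disjE) (auto simp: insert_commute)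
      then show ?thesis using row_zero 5 by (auto simp: minor_inner)
    next
      case False
      have "\<not> (four_point_infinite J i k j l \<or> four_point_infinite J i l j k)"
        using False assms ij(4) unfolding four_point_infinite_def by (auto simp: insert_commute)
      then have "(k, l) \<in> r \<or> (l, k) \<in> r" using incomparable_four_point 5 by blast
      then show ?thesis
      proof
        assume "(l, k) \<in> r"
        then show ?thesis using comparable_minor_zero[of l k] False 5 assms by auto
      next
        assume "(k, l) \<in> r"
        then have "minor i j f g l k = 0"
          using comparable_minor_zero[of k l] False 5 assms by (auto simp: insert_commute)
        then show ?thesis using minor_swap[of i j f g k l] by simp
      qed
    qed
  qed (use assms row_zero in \<open>auto simp: minor_simps insert_commute\<close>)
qed

end

end

section \<open>The comparison map\<close>

lemma power_in_submonoid:
  fixes C :: "'a::comm_ring_1 set"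
  assumes "\<And>x y. x \<in> C \<Longrightarrow> y \<in> C \<Longrightarrow> x * y \<in> C" "1 \<in> C" "x \<in> C"
  shows "x ^ e \<in> C"
  by (induction e) (use assms in auto)

lemma poly_eval_in_subring:
  fixes p :: "'k::field mpoly"
  assumes C: "\<And>x y. x \<in> C \<Longrightarrow> y \<in> C \<Longrightarrow> x + y \<in> C" "\<And>x y. x \<in> C \<Longrightarrow> y \<in> C \<Longrightarrow> x * y \<in> C"
    "\<And>c. to_frac (mconst c) \<in> C"
    and Y: "\<And>v. v \<in> chart_vars n i j \<Longrightarrow> Y v \<in> C" and p: "p \<in> carrier (chart_ring n i j)"
  shows "poly_eval Y p \<in> C"
proof -
  have 0: "0 \<in> C" and 1: "1 \<in> C" using C(3)[of 0] C(3)[of 1] by simp_all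
  have mono: "mono_eval Y m \<in> C" if m: "Poly_Mapping.keys m \<subseteq> chart_vars n i j" for m
  proof -
    have "(\<Prod>v\<in>A. Y v ^ Poly_Mapping.lookup m v) \<in> C" if "A \<subseteq> chart_vars n i j" for A
      using that
      by (induction A rule: infinite_finite_induct) (auto intro!: C 1 power_in_submonoid Y)
    then show ?thesis using m unfolding mono_eval_def by blast
  qed
  have "(\<Sum>m\<in>A. to_frac (mconst (Poly_Mapping.lookup p m)) * mono_eval Y m) \<in> C"
    if "A \<subseteq> Poly_Mapping.keys p" for A
    using that p
    by (induction A rule: infinite_finite_induct) (auto simp: carrier_chart_ring intro!: C 0 mono)
  then show ?thesis unfolding poly_eval_def by blast
qed

lemma to_frac_sum: "to_frac (sum h A) = (\<Sum>a\<in>A. to_frac (h a))"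
  by (induction A rule: infinite_finite_induct) auto

definition frac_var :: "nat \<Rightarrow> 'k::field mpoly fract" where
  "frac_var v = to_frac (Poly_Mapping.single (Poly_Mapping.single v 1) 1)"

text \<open>Evaluation at the generic point is the inclusion into the fraction field, so
  \<open>poly_eval_in_subring\<close> also decides where polynomials themselves lie.\<close>

lemma poly_eval_frac_var: "poly_eval frac_var p = to_frac (p :: 'k::field mpoly)"
proof -
  have pow: "frac_var v ^ e = to_frac (Poly_Mapping.single (Poly_Mapping.single v e) (1 :: 'k))" for v e
    by (induction e) (simp_all add: frac_var_def mult_single single_add[symmetric] flip: to_frac_simps(5))
  have prod: "(\<Prod>v\<in>A. frac_var v ^ e v) =
      to_frac (Poly_Mapping.single (\<Sum>v\<in>A. Poly_Mapping.single v (e v)) (1 :: 'k))" for A e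
    by (induction A rule: infinite_finite_induct)
      (simp_all add: pow mult_single flip: to_frac_simps(5))
  have mono: "mono_eval frac_var m = to_frac (Poly_Mapping.single m (1 :: 'k))" for m
    unfolding mono_eval_def prod by (simp flip: poly_mapping_sum_single)
  have "poly_eval frac_var p =
      (\<Sum>m\<in>Poly_Mapping.keys p. to_frac (Poly_Mapping.single m (Poly_Mapping.lookup p m)))"
    unfolding poly_eval_def mono by (simp add: mconst_def mult_single flip: to_frac_simps(5))
  also have "\<dots> = to_frac (\<Sum>m\<in>Poly_Mapping.keys p. Poly_Mapping.single m (Poly_Mapping.lookup p m))"
    by (simp add: to_frac_sum)
  finally show ?thesis by (simp flip: poly_mapping_sum_single)
qed

locale comparison = compatible_set +
  fixes H :: "nat set set" and f g :: "nat \<Rightarrow> 'k::field mpoly fract"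
  assumes H: "H = I \<inter> star_pairs n i j"
    and fg: "\<And>k l. {k, l} \<in> I \<Longrightarrow>
      minor i j f g k l = (if {k, l} \<in> J then 0 else to_frac (ucoord i j k l))"
begin

abbreviation "R \<equiv> chart_ring n i j :: 'k mpoly ring"
abbreviation "BI \<equiv> laurent_ring i j I (H - J) :: 'k mpoly fract ring"
abbreviation "B \<equiv> laurent_ring i j (I - J) (H - J) :: 'k mpoly fract ring"
abbreviation "\<aa> \<equiv> coord_ideal n i j J :: 'k mpoly set"

lemma H_pairs: "H - J \<subseteq> I - J" "H - J \<subseteq> pairs n - (J \<union> {{i, j}})"
  using H I_pairs ij_I by auto

lemma ucoord_star_nonzero:
  assumes "{k, l} \<in> H"
  shows "(ucoord i j k l :: 'k mpoly) \<noteq> 0"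
proof -
  obtain a m where m: "{k, l} = {a, m}" "a \<in> {i, j}" "m \<in> L"
    using assms by (auto simp: H star_pairs_def L_def)
  then have "ucoord i j a m = (mvar a m :: 'k mpoly)"
    using ucoord_row[of m i j] ij(3) by (auto simp: L_def)
  then have "ucoord i j a m \<noteq> (0 :: 'k mpoly)" using mvar_nonzero by simp
  moreover have "ucoord i j k l = (ucoord i j a m :: 'k mpoly) \<or> ucoord i j k l = - (ucoord i j a m :: 'k mpoly)"
    using m(1) ucoord_swap[of i j m a] by (metis doubleton_eq_iff)
  ultimately show ?thesis by auto
qed

section \<open>Evaluation at the constructed point, and the denominators\<close>

definition \<phi> :: "'k mpoly \<Rightarrow> 'k mpoly fract" where
  "\<phi> = poly_eval (\<lambda>v. case prod_decode v of (a, l) \<Rightarrow> if a = i then f l else g l)"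

lemma \<phi>_simps [simp]:
  "\<phi> 0 = 0" "\<phi> 1 = 1" "\<phi> (p + q) = \<phi> p + \<phi> q" "\<phi> (p - q) = \<phi> p - \<phi> q" "\<phi> (- p) = - \<phi> p"
  "\<phi> (p * q) = \<phi> p * \<phi> q" "\<phi> (mconst c) = to_frac (mconst c)"
  by (simp_all add: \<phi>_def)

lemma \<phi>_ucoord: "\<phi> (ucoord i j k l) = minor i j f g k l"
proof -
  have "\<phi> (row_i i j k) = row1 i j f k" for k
    by (simp add: row_i_def row1_def) (simp add: \<phi>_def poly_eval_mvar)
  moreover have "\<phi> (row_j i j k) = row2 i j g k" for k
    using ij(3) by (simp add: row_j_def row2_def) (simp add: \<phi>_def poly_eval_mvar)
  ultimately show ?thesis by (simp add: ucoord_def minor_def)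
qed

lemma \<phi>_ucoord_J:
  assumes "{k, l} \<in> J"
  shows "\<phi> (ucoord i j k l) = 0"
  unfolding \<phi>_ucoord
proof (rule minor_J_zero[OF _ _ assms])
  show "minor i j f g k l = 0" if "{k, l} \<in> I \<inter> J" for k l
    using fg that by auto
  show "minor i j f g a t \<noteq> 0" if "a \<in> {i, j}" "{a, t} \<in> I - J" for a t
  proof -
    have "t \<in> L" "a \<noteq> t"
      using that I_pairs ij_I by (auto simp: L_def pairs_def insert_commute)
    then have "{a, t} \<in> H" using that by (auto simp: H star_pairs_def L_def)
    then show ?thesis using fg that ucoord_star_nonzero by auto
  qed
qed

text \<open>The generators are variables up to sign, hence nonzero, and the point has them as its
  own coordinates, so \<open>\<phi>\<close> fixes them. As \<open>{i, j}\<close> is not in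
  \<open>H\<close>, their classes are among those inverted on the left.\<close>

definition M :: "'k mpoly set" where
  "M = mult_closure R {ucoord i j k l | k l. {k, l} \<in> H - J}"

lemma M_one: "1 \<in> M"
  using mult_closure.one[of R] by (simp add: M_def)

lemma M_mult: "m \<in> M \<Longrightarrow> m' \<in> M \<Longrightarrow> m * m' \<in> M"
  using mult_closure.mult[of m R _ m'] by (simp add: M_def)

lemma M_ucoord: "{k, l} \<in> H - J \<Longrightarrow> ucoord i j k l \<in> M"
  by (auto simp: M_def intro!: mult_closure.incl)

lemma pairs_in_R: "{k, l} \<in> pairs n \<Longrightarrow> ucoord i j k l \<in> carrier R"
  by (rule ucoord_in_chart_ring) (auto simp: pairs_def)

lemma M_props:
  assumes "m \<in> M"
  shows "m \<in> carrier R" "\<phi> m = to_frac m" "m \<noteq> 0"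
proof -
  have "m \<in> carrier R \<and> \<phi> m = to_frac m \<and> m \<noteq> 0"
    using assms unfolding M_def
  proof induction
    case one
    show ?case using chart_ring_closed(2) by simp
  next
    case (incl m)
    then obtain k l where m: "m = ucoord i j k l" "{k, l} \<in> H - J" by blast
    then show ?case using pairs_in_R[of k l] H_pairs fg[of k l] ucoord_star_nonzero[of k l]
      by (auto simp: \<phi>_ucoord)
  next
    case (mult a b)
    then show ?case using chart_ring_closed(5)[of a n i j b] by simp
  qed
  then show "m \<in> carrier R" "\<phi> m = to_frac m" "m \<noteq> 0" by auto
qed

text \<open>\<open>rows_in_subring\<close> is applied to the generic point, whose entries are the
  variables and whose minors are the coordinates \<open>ucoord\<close> themselves.\<close>

lemma to_frac_in_BI:
  assumes "p \<in> carrier R"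
  shows "to_frac p \<in> carrier BI"
proof -
  have rows: "to_frac (row_i i j k) \<in> carrier BI \<and> to_frac (row_j i j k) \<in> carrier BI" if "k \<in> L" for k
  proof -
    define f' g' where "f' k = to_frac (row_i i j k :: 'k mpoly)" and "g' k = to_frac (row_j i j k :: 'k mpoly)" for k
    have minor: "minor i j f' g' k l = to_frac (ucoord i j k l)" for k l
    proof -
      have "row1 i j f' k = to_frac (row_i i j k)" "row2 i j g' k = to_frac (row_j i j k)" for k
        using ij(3) by (auto simp: row1_def row2_def f'_def g'_def row_i_def row_j_def)
      then show ?thesis by (simp add: minor_def ucoord_def)
    qed
    have "f' k \<in> carrier BI \<and> g' k \<in> carrier BI"
    proof (rule rows_in_subring[OF _ _ _ _ _ that])
      fix a t assume at: "a \<in> {i, j}" "{a, t} \<in> I - J"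
      then have "t \<in> L" using I_pairs ij_I by (auto simp: L_def pairs_def insert_commute)
      then have "{a, t} \<in> H - J" using at by (auto simp: H star_pairs_def L_def)
      then show "minor i j f' g' a t \<noteq> 0 \<and> inverse (minor i j f' g' a t) \<in> carrier BI"
        unfolding minor using ucoord_star_nonzero laurent_closed(3)[of a t "H - J"] by auto
    qed (auto simp: minor intro!: laurent_closed)
    then show ?thesis by (simp add: f'_def g'_def)
  qed
  have "poly_eval frac_var p \<in> carrier BI"
  proof (rule poly_eval_in_subring[OF _ _ _ _ assms])
    fix v assume "v \<in> chart_vars n i j"
    then obtain a l where v: "v = prod_encode (a, l)" "a \<in> {i, j}" "l \<in> L"
      by (auto simp: chart_vars_def L_def)
    then have "frac_var v = to_frac (row_i i j l :: 'k mpoly) \<or> frac_var v = to_frac (row_j i j l :: 'k mpoly)"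
      by (auto simp: frac_var_def row_i_def row_j_def mvar_def L_def)
    then show "(frac_var v :: 'k mpoly fract) \<in> carrier BI" using rows[OF v(3)] by auto
  qed (auto intro: laurent_closed)
  then show ?thesis by (simp add: poly_eval_frac_var)
qed

section \<open>Fractions, and setting coordinates to zero\<close>

definition is_frac :: "'k mpoly fract \<Rightarrow> 'k mpoly \<Rightarrow> 'k mpoly \<Rightarrow> bool" where
  "is_frac b p m \<longleftrightarrow> p \<in> carrier R \<and> m \<in> M \<and> b * to_frac m = to_frac p"

lemma is_frac_to_frac: "p \<in> carrier R \<Longrightarrow> is_frac (to_frac p) p 1"
  using M_one by (simp add: is_frac_def)

lemma is_frac_uminus: "is_frac b p m \<Longrightarrow> is_frac (- b) (- p) m"
  using chart_ring_closed(3) by (auto simp: is_frac_def)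

lemma is_frac_add:
  assumes "is_frac b p m" "is_frac b' p' m'"
  shows "is_frac (b + b') (p * m' + p' * m) (m * m')"
proof -
  have *: "p \<in> carrier R" "m \<in> M" "b * to_frac m = to_frac p"
    "p' \<in> carrier R" "m' \<in> M" "b' * to_frac m' = to_frac p'"
    using assms by (auto simp: is_frac_def)
  have "(b + b') * to_frac (m * m') = b * to_frac m * to_frac m' + b' * to_frac m' * to_frac m"
    by (simp add: algebra_simps)
  then show ?thesis
    unfolding is_frac_def using * M_props(1)[OF *(2)] M_props(1)[OF *(5)]
    by (auto intro!: chart_ring_closed M_mult)
qed

lemma is_frac_mult:
  assumes "is_frac b p m" "is_frac b' p' m'"
  shows "is_frac (b * b') (p * p') (m * m')"
proof -
  have *: "p \<in> carrier R" "m \<in> M" "b * to_frac m = to_frac p"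
    "p' \<in> carrier R" "m' \<in> M" "b' * to_frac m' = to_frac p'"
    using assms by (auto simp: is_frac_def)
  have "b * b' * to_frac (m * m') = (b * to_frac m) * (b' * to_frac m')"
    by (simp add: algebra_simps)
  then show ?thesis
    unfolding is_frac_def using * by (auto intro!: chart_ring_closed M_mult)
qed

lemma is_frac_inverse: "{k, l} \<in> H - J \<Longrightarrow> is_frac (inverse (to_frac (ucoord i j k l))) 1 (ucoord i j k l)"
  using M_ucoord M_props(3)[OF M_ucoord] chart_ring_closed(2) by (auto simp: is_frac_def)

lemma BI_is_frac: "b \<in> carrier BI \<Longrightarrow> \<exists>p m. is_frac b p m"
proof (induction rule: laurent_induct)
  case (const c)
  then show ?case using is_frac_to_frac[OF chart_ring_closed(1)] by blast
next
  case (coord k l)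
  then show ?case using is_frac_to_frac[OF pairs_in_R] I_pairs by blast
next
  case (inverse_coord k l)
  then show ?case using is_frac_inverse by blast
qed (use is_frac_uminus is_frac_add is_frac_mult in blast)+

definition \<sigma> :: "'k mpoly fract \<Rightarrow> 'k mpoly fract" where
  "\<sigma> b = (THE c. \<exists>p m. is_frac b p m \<and> c = \<phi> p / to_frac m)"

text \<open>Two fractions for \<open>b\<close> satisfy a polynomial identity
  \<open>p * m' = p' * m\<close>. Applying the multiplicative map \<open>\<phi>\<close>, which fixes
  \<open>m\<close> and \<open>m'\<close>, gives equal values.\<close>

lemma \<sigma>_eq:
  assumes "is_frac b p m"
  shows "\<sigma> b = \<phi> p / to_frac m"
  unfolding \<sigma>_def
proof (rule the_equality)
  show "\<exists>p' m'. is_frac b p' m' \<and> \<phi> p / to_frac m = \<phi> p' / to_frac m'" using assms by blast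
next
  fix c assume "\<exists>p' m'. is_frac b p' m' \<and> c = \<phi> p' / to_frac m'"
  then obtain p' m' where b': "is_frac b p' m'" "c = \<phi> p' / to_frac m'" by blast
  have m: "m \<in> M" "m' \<in> M" using assms b' by (auto simp: is_frac_def)
  have "to_frac p * to_frac m' = to_frac p' * to_frac m"
  proof -
    have "to_frac p * to_frac m' = (b * to_frac m) * to_frac m'" using assms by (simp add: is_frac_def)
    also have "\<dots> = (b * to_frac m') * to_frac m" by (simp only: mult_ac)
    also have "\<dots> = to_frac p' * to_frac m" using b'(1) by (simp add: is_frac_def)
    finally show ?thesis .
  qed
  then have "p * m' = p' * m" by (simp flip: to_frac_simps(5))
  then have "\<phi> (p * m') = \<phi> (p' * m)" by simp
  then show "c = \<phi> p / to_frac m" using M_props[OF m(1)] M_props[OF m(2)] by (simp add: b'(2) field_simps)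
qed

lemma \<sigma>_to_frac: "p \<in> carrier R \<Longrightarrow> \<sigma> (to_frac p) = \<phi> p"
  using \<sigma>_eq[OF is_frac_to_frac] by simp

lemma \<sigma>_uminus: "b \<in> carrier BI \<Longrightarrow> \<sigma> (- b) = - \<sigma> b"
  using BI_is_frac \<sigma>_eq is_frac_uminus by (metis \<phi>_simps(5) minus_divide_left)

lemma \<sigma>_add:
  assumes "b \<in> carrier BI" "b' \<in> carrier BI"
  shows "\<sigma> (b + b') = \<sigma> b + \<sigma> b'"
proof -
  obtain p m p' m' where b: "is_frac b p m" "is_frac b' p' m'" using BI_is_frac assms by metis
  then have "m \<in> M" "m' \<in> M" by (auto simp: is_frac_def)
  then have "to_frac m \<noteq> 0" "to_frac m' \<noteq> 0" "\<phi> m = to_frac m" "\<phi> m' = to_frac m'"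
    using M_props by auto
  then show ?thesis
    unfolding \<sigma>_eq[OF b(1)] \<sigma>_eq[OF b(2)] \<sigma>_eq[OF is_frac_add[OF b]]
    by (simp add: add_frac_eq mult_ac)
qed

lemma \<sigma>_mult:
  assumes "b \<in> carrier BI" "b' \<in> carrier BI"
  shows "\<sigma> (b * b') = \<sigma> b * \<sigma> b'"
proof -
  obtain p m p' m' where b: "is_frac b p m" "is_frac b' p' m'" using BI_is_frac assms by metis
  then show ?thesis
    using \<sigma>_eq[OF b(1)] \<sigma>_eq[OF b(2)] \<sigma>_eq[OF is_frac_mult[OF b]] by simp
qed

lemma \<sigma>_const: "\<sigma> (to_frac (mconst c)) = to_frac (mconst c)"
  using \<sigma>_to_frac[OF chart_ring_closed(1)] by simp

lemma \<sigma>_coord: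
  assumes "{k, l} \<in> I"
  shows "\<sigma> (to_frac (ucoord i j k l)) = (if {k, l} \<in> J then 0 else to_frac (ucoord i j k l))"
  using \<sigma>_to_frac[OF pairs_in_R] assms I_pairs fg by (auto simp: \<phi>_ucoord)

lemma \<sigma>_inverse_coord:
  "{k, l} \<in> H - J \<Longrightarrow> \<sigma> (inverse (to_frac (ucoord i j k l))) = inverse (to_frac (ucoord i j k l))"
  using \<sigma>_eq[OF is_frac_inverse] by (simp add: inverse_eq_divide)

lemma B_subset: "carrier B \<subseteq> carrier BI"
  by (rule laurent_ring_mono) auto

lemma \<sigma>_in_B: "b \<in> carrier BI \<Longrightarrow> \<sigma> b \<in> carrier B"
proof (induction rule: laurent_induct)
  case (coord k l)
  then show ?case using laurent_closed(1)[of 0 i j "I - J" "H - J"] laurent_closed(2)[of k l "I - J"]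
    by (auto simp: \<sigma>_coord)
qed (auto simp: \<sigma>_const \<sigma>_inverse_coord \<sigma>_uminus \<sigma>_add \<sigma>_mult intro: laurent_closed)

lemma \<sigma>_on_B: "b \<in> carrier B \<Longrightarrow> \<sigma> b = b"
proof (induction rule: laurent_induct)
  case (coord k l)
  then show ?case by (auto simp: \<sigma>_coord)
qed (use B_subset in \<open>auto simp: \<sigma>_const \<sigma>_inverse_coord \<sigma>_uminus \<sigma>_add \<sigma>_mult subset_iff\<close>)

text \<open>Uniqueness is checked on generators: those indexed by \<open>I - J\<close> and the
  inverses lie in \<open>B\<close>, where every candidate is the identity, and the remaining ones
  are sent to 0.\<close>

lemma set_zero_eq: "set_zero i j I H J = restrict \<sigma> (carrier BI)"
  unfolding set_zero_def
proof (rule the_equality)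
  have "\<sigma> 1 = 1" using \<sigma>_const[of 1] by simp
  then have "restrict \<sigma> (carrier BI) \<in> ring_hom BI B"
    using \<sigma>_in_B \<sigma>_add \<sigma>_mult
    by (intro ring_hom_memI) (auto simp: laurent_closed)
  then show "restrict \<sigma> (carrier BI) \<in> extensional (carrier BI) \<and>
      restrict \<sigma> (carrier BI) \<in> ring_hom BI B \<and> (\<forall>b\<in>carrier B. restrict \<sigma> (carrier BI) b = b) \<and>
      (\<forall>k l. {k, l} \<in> I \<inter> J \<longrightarrow> restrict \<sigma> (carrier BI) (to_frac (ucoord i j k l)) = 0)"
    using B_subset \<sigma>_on_B by (auto simp: \<sigma>_coord laurent_closed(2))
next
  fix \<tau> assume \<tau>: "\<tau> \<in> extensional (carrier BI) \<and> \<tau> \<in> ring_hom BI B \<and> (\<forall>b\<in>carrier B. \<tau> b = b) \<and>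
      (\<forall>k l. {k, l} \<in> I \<inter> J \<longrightarrow> \<tau> (to_frac (ucoord i j k l)) = 0)"
  then have hom: "\<tau> \<in> ring_hom BI B" and id: "\<And>b. b \<in> carrier B \<Longrightarrow> \<tau> b = b"
    and zero: "\<And>k l. {k, l} \<in> I \<inter> J \<Longrightarrow> \<tau> (to_frac (ucoord i j k l)) = 0" by blast+
  have add: "\<tau> (x + y) = \<tau> x + \<tau> y" and mult: "\<tau> (x * y) = \<tau> x * \<tau> y"
    if "x \<in> carrier BI" "y \<in> carrier BI" for x y
    using ring_hom_add[OF hom that] ring_hom_mult[OF hom that] by simp_all
  have "\<tau> b = \<sigma> b" if "b \<in> carrier BI" for b
    using that
  proof (induction rule: laurent_induct)
    case (const c)
    then show ?case using id[OF laurent_closed(1)] by (simp add: \<sigma>_const)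
  next
    case (coord k l)
    then show ?case using zero id[OF laurent_closed(2)] by (auto simp: \<sigma>_coord)
  next
    case (inverse_coord k l)
    then show ?case using id[OF laurent_closed(3)] by (simp add: \<sigma>_inverse_coord)
  next
    case (uminus x)
    have "\<tau> 0 = 0" using id[of 0] laurent_closed(1)[of "0 :: 'k"] by simp
    then have "\<tau> x + \<tau> (- x) = 0" using add[OF uminus(1) laurent_closed(5)[OF uminus(1)]] by simp
    then have "\<tau> (- x) = - \<tau> x" by (simp add: eq_neg_iff_add_eq_0 add.commute)
    then show ?case using uminus by (simp add: \<sigma>_uminus)
  qed (simp_all add: add mult \<sigma>_add \<sigma>_mult)
  then show "\<tau> = restrict \<sigma> (carrier BI)"
    using \<tau> by (auto simp: fun_eq_iff extensional_def)
qed

lemma set_zero_to_frac: "p \<in> carrier R \<Longrightarrow> set_zero i j I H J (to_frac p) = \<phi> p"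
  using to_frac_in_BI by (simp add: set_zero_eq \<sigma>_to_frac)

section \<open>The coordinate ideal and the kernel of the evaluation\<close>

sublocale R: cring R
  by (rule cring_chart_ring)

lemma J_ucoord_subset: "{ucoord i j k l | k l. {k, l} \<in> J} \<subseteq> carrier R"
  using pairs_in_R J_pairs by blast

lemma ideal_\<aa>: "ideal \<aa> R"
  unfolding coord_ideal_def by (rule R.genideal_ideal[OF J_ucoord_subset])

lemma \<aa>_ucoord: "{k, l} \<in> J \<Longrightarrow> ucoord i j k l \<in> \<aa>"
  unfolding coord_ideal_def using R.genideal_self[OF J_ucoord_subset] by blast

lemma \<phi>_hom: "\<phi> \<in> ring_hom R ring_of_type_algebra"
  by (rule ring_hom_memI) auto

text \<open>The kernel of \<open>\<phi>\<close> is an ideal containing the generators, by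
  \<open>minor_J_zero\<close>.\<close>

lemma \<phi>_\<aa>:
  assumes "p \<in> \<aa>"
  shows "\<phi> p = 0"
proof -
  let ?N = "a_kernel R ring_of_type_algebra \<phi>"
  have hom: "ring_hom_ring R ring_of_type_algebra \<phi>"
    by (intro ring_hom_ringI2 ring_from_type_algebra R.ring_axioms \<phi>_hom)
  have "\<aa> \<subseteq> ?N"
    unfolding coord_ideal_def
  proof (rule R.genideal_minimal[OF ring_hom_ring.kernel_is_ideal[OF hom]], rule subsetI)
    fix u assume u: "u \<in> {ucoord i j k l :: 'k mpoly | k l. {k, l} \<in> J}"
    then have "u \<in> carrier R" "\<phi> u = 0" using J_ucoord_subset \<phi>_ucoord_J by blast+
    then show "u \<in> ?N" by (simp add: a_kernel_def')
  qed
  with assms have "p \<in> ?N" by blast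
  then show ?thesis by (simp add: a_kernel_def')
qed

lemma \<aa>_closed:
  "p \<in> \<aa> \<Longrightarrow> p \<in> carrier R" "0 \<in> \<aa>" "p \<in> \<aa> \<Longrightarrow> - p \<in> \<aa>" "p \<in> \<aa> \<Longrightarrow> q \<in> \<aa> \<Longrightarrow> p + q \<in> \<aa>"
  "p \<in> \<aa> \<Longrightarrow> q \<in> carrier R \<Longrightarrow> p * q \<in> \<aa>"
proof -
  interpret ideal \<aa> R by (rule ideal_\<aa>)
  show car: "p \<in> \<aa> \<Longrightarrow> p \<in> carrier R" using a_subset by blast
  show "0 \<in> \<aa>" using additive_subgroup.zero_closed[OF additive_subgroup_axioms] by simp
  show mult: "p \<in> \<aa> \<Longrightarrow> q \<in> carrier R \<Longrightarrow> p * q \<in> \<aa>" for p q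
    using I_r_closed[of p q] by simp
  show "p \<in> \<aa> \<Longrightarrow> - p \<in> \<aa>"
  proof -
    have "- 1 \<in> carrier R" by (intro chart_ring_closed)
    then show "p \<in> \<aa> \<Longrightarrow> - p \<in> \<aa>" using mult[of p "- 1"] by simp
  qed
  show "p \<in> \<aa> \<Longrightarrow> q \<in> \<aa> \<Longrightarrow> p + q \<in> \<aa>"
    using additive_subgroup.a_closed[OF additive_subgroup_axioms, of p q] by simp
qed

text \<open>Setting coordinates to zero changes an element only by a fraction with numerator in
  \<open>\<aa>\<close>. On generators the change is 0 or a coordinate in \<open>J\<close>, and the
  property is inherited by sums and products.\<close>

lemma \<sigma>_diff:
  assumes "b \<in> carrier BI"
  shows "\<exists>q\<in>\<aa>. \<exists>m\<in>M. (b - \<sigma> b) * to_frac m = to_frac q"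
  using assms
proof (induction rule: laurent_induct)
  case (const c)
  then show ?case using M_one \<aa>_closed(2) by (auto simp: \<sigma>_const)
next
  case (coord k l)
  show ?case
  proof (cases "{k, l} \<in> J")
    case True
    then show ?thesis using M_one coord
      by (intro bexI[of _ "ucoord i j k l"] bexI[of _ 1]) (auto simp: \<sigma>_coord \<aa>_ucoord)
  qed (use M_one \<aa>_closed(2) coord in \<open>auto simp: \<sigma>_coord\<close>)
next
  case (inverse_coord k l)
  then show ?case using M_one \<aa>_closed(2) by (auto simp: \<sigma>_inverse_coord)
next
  case (uminus x)
  then obtain q m where "q \<in> \<aa>" "m \<in> M" "(x - \<sigma> x) * to_frac m = to_frac q" by blast
  then have "- q \<in> \<aa>" "m \<in> M" "(- x - \<sigma> (- x)) * to_frac m = to_frac (- q)"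
    using uminus \<aa>_closed(3) by (auto simp: \<sigma>_uminus algebra_simps)
  then show ?case by blast
next
  case (add x y)
  then obtain q m q' m' where *: "q \<in> \<aa>" "m \<in> M" "(x - \<sigma> x) * to_frac m = to_frac q"
    "q' \<in> \<aa>" "m' \<in> M" "(y - \<sigma> y) * to_frac m' = to_frac q'" by blast
  have "(x + y - \<sigma> (x + y)) * to_frac (m * m') =
      (x - \<sigma> x) * to_frac m * to_frac m' + (y - \<sigma> y) * to_frac m' * to_frac m"
    using add by (simp add: \<sigma>_add algebra_simps)
  also have "\<dots> = to_frac (q * m' + q' * m)" by (simp add: *)
  finally show ?case using * M_mult \<aa>_closed(4,5) M_props(1) by blast
next
  case (mult x y)
  then obtain q m q' m' where *: "q \<in> \<aa>" "m \<in> M" "(x - \<sigma> x) * to_frac m = to_frac q"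
    "q' \<in> \<aa>" "m' \<in> M" "(y - \<sigma> y) * to_frac m' = to_frac q'" by blast
  obtain p s p' s' where y: "is_frac y p s" and x: "is_frac (\<sigma> x) p' s'"
    using BI_is_frac[of y] BI_is_frac[of "\<sigma> x"] \<sigma>_in_B[of x] B_subset mult(1,2) by blast
  \<comment> \<open>The difference is split as
    \<open>(x - \<sigma> x) * y + \<sigma> x * (y - \<sigma> y)\<close>. The factors
    \<open>y\<close> and \<open>\<sigma> x\<close> are no polynomials in general, so their
    denominators \<open>s\<close> and \<open>s'\<close> are cleared too.\<close>
  have "(x * y - \<sigma> (x * y)) * to_frac ((m * s) * (m' * s')) =
      ((x - \<sigma> x) * to_frac m) * (y * to_frac s) * to_frac (m' * s') +
      ((y - \<sigma> y) * to_frac m') * (\<sigma> x * to_frac s') * to_frac (m * s)"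
    using mult by (simp add: \<sigma>_mult algebra_simps)
  also have "\<dots> = to_frac (q * p * (m' * s') + q' * p' * (m * s))"
    using x y by (simp add: * is_frac_def)
  finally have "(x * y - \<sigma> (x * y)) * to_frac ((m * s) * (m' * s')) =
      to_frac (q * p * (m' * s') + q' * p' * (m * s))" .
  moreover have "s \<in> M" "s' \<in> M" "p \<in> carrier R" "p' \<in> carrier R" using x y by (auto simp: is_frac_def)
  moreover from this have "(m * s) * (m' * s') \<in> M" "q * p * (m' * s') + q' * p' * (m * s) \<in> \<aa>"
    using * by (auto intro!: M_mult \<aa>_closed M_props)
  ultimately show ?case by blast
qed

lemma \<phi>_kernel:
  assumes "p \<in> carrier R" "\<phi> p = 0"
  shows "\<exists>m\<in>M. m * p \<in> \<aa>"
proof -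
  obtain q m where q: "q \<in> \<aa>" and m: "m \<in> M" and eq: "(to_frac p - \<sigma> (to_frac p)) * to_frac m = to_frac q"
    using \<sigma>_diff[OF to_frac_in_BI[OF assms(1)]] by blast
  have "to_frac (m * p) = to_frac q"
    using eq assms by (simp add: \<sigma>_to_frac mult.commute)
  then have "m * p = q" by (simp only: to_frac_simps(7))
  then show ?thesis using q m by blast
qed

section \<open>The induced map on the quotient and its localization\<close>

abbreviation "Q \<equiv> R Quot \<aa>"
abbreviation "cls p \<equiv> \<aa> +>\<^bsub>R\<^esub> p"
abbreviation "\<mu> \<equiv> mu_bar i j I H J :: 'k mpoly set \<Rightarrow> 'k mpoly fract"

lemma cls_hom: "cls \<in> ring_hom R Q"
  using ideal.rcos_ring_hom[OF ideal_\<aa>] .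

lemma carrier_Q: "carrier Q = cls ` carrier R"
  by (auto simp: FactRing_def A_RCOSETS_def')

text \<open>\<open>mu_bar\<close> selects the unique element of the image of a coset; the image is a
  singleton because \<open>\<phi>\<close> vanishes on \<open>\<aa>\<close>.\<close>

lemma \<mu>_cls:
  assumes "p \<in> carrier R"
  shows "\<mu> (cls p) = \<phi> p"
proof -
  have "(\<lambda>p. set_zero i j I H J (to_frac p)) ` cls p = {\<phi> p}"
  proof -
    have "cls p = (\<lambda>h. h + p) ` \<aa>" by (auto simp: a_r_coset_def')
    moreover have "set_zero i j I H J (to_frac (h + p)) = \<phi> p" if "h \<in> \<aa>" for h
      using set_zero_to_frac[of "h + p"] chart_ring_closed(4)[OF \<aa>_closed(1)[OF that] assms] \<phi>_\<aa>[OF that]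
      by simp
    ultimately show ?thesis using \<aa>_closed(2) by (auto simp: image_image)
  qed
  then show ?thesis by (simp add: mu_bar_def)
qed

lemma \<mu>_hom: "\<mu> \<in> ring_hom Q B"
proof (rule ring_hom_memI)
  fix Z assume "Z \<in> carrier Q"
  then obtain p where p: "Z = cls p" "p \<in> carrier R" by (auto simp: carrier_Q)
  then show "\<mu> Z \<in> carrier B"
    using \<sigma>_in_B[OF to_frac_in_BI] by (simp add: \<mu>_cls \<sigma>_to_frac)
  fix Z' assume "Z' \<in> carrier Q"
  then obtain q where q: "Z' = cls q" "q \<in> carrier R" by (auto simp: carrier_Q)
  show "\<mu> (Z \<otimes>\<^bsub>Q\<^esub> Z') = \<mu> Z \<otimes>\<^bsub>B\<^esub> \<mu> Z'"
    using p q chart_ring_closed(5)[OF p(2) q(2)]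
    by (simp add: ring_hom_mult[OF cls_hom p(2) q(2), symmetric] \<mu>_cls)
  show "\<mu> (Z \<oplus>\<^bsub>Q\<^esub> Z') = \<mu> Z \<oplus>\<^bsub>B\<^esub> \<mu> Z'"
    using p q chart_ring_closed(4)[OF p(2) q(2)]
    by (simp add: ring_hom_add[OF cls_hom p(2) q(2), symmetric] \<mu>_cls)
next
  show "\<mu> \<one>\<^bsub>Q\<^esub> = \<one>\<^bsub>B\<^esub>"
    using \<mu>_cls[OF chart_ring_closed(2)] by (simp add: ring_hom_one[OF cls_hom, symmetric])
qed

abbreviation "U \<equiv> {u_class n i j J k l :: 'k mpoly set | k l. {k, l} \<in> pairs n - (J \<union> {{i, j}})}"

lemma U_carrier: "U \<subseteq> carrier Q"
  using pairs_in_R by (auto simp: u_class_def carrier_Q)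

lemma cls_M: "m \<in> M \<Longrightarrow> cls m \<in> mult_closure Q U"
  unfolding M_def
proof (induction rule: mult_closure.induct)
  case one
  show ?case using ring_hom_one[OF cls_hom] mult_closure.one[of Q U] by simp
next
  case (incl m)
  then obtain k l where "m = ucoord i j k l" "{k, l} \<in> H - J" by blast
  then have "cls m \<in> U" using H_pairs(2) unfolding u_class_def by blast
  then show ?case by (rule mult_closure.incl)
next
  case (mult a b)
  then have "a \<in> carrier R" "b \<in> carrier R" using M_props(1) unfolding M_def by auto
  from ring_hom_mult[OF cls_hom this] show ?case
    using mult_closure.mult[OF mult(3,4)] by simp
qed

lemma loc_map_\<mu>_iso:
  "loc_map B (mult_closure B (\<mu> ` U)) \<mu> \<in>
    ring_iso (localization Q (mult_closure Q U)) (localization B (mult_closure B (\<mu> ` U)))"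
proof (rule loc_map_ring_iso[OF _ cring_laurent_ring \<mu>_hom U_carrier])
  show "cring Q" by (rule ideal.quotient_is_cring[OF ideal_\<aa> R.cring_axioms])
next
  fix Z assume "Z \<in> carrier Q" and zero: "\<mu> Z = \<zero>\<^bsub>B\<^esub>"
  then obtain p where p: "Z = cls p" "p \<in> carrier R" by (auto simp: carrier_Q)
  then obtain m where m: "m \<in> M" "m * p \<in> \<aa>" using \<phi>_kernel zero \<mu>_cls by auto
  have "cls m \<otimes>\<^bsub>Q\<^esub> Z = cls (m * p)"
    using ring_hom_mult[OF cls_hom M_props(1)[OF m(1)] p(2)] p(1) by simp
  also have "\<dots> = \<zero>\<^bsub>Q\<^esub>"
    using m(2) ideal.axioms(1)[OF ideal_\<aa>] R.a_coset_join2[OF \<aa>_closed(1)]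
    by (simp add: FactRing_def abelian_subgroup.a_rcos_const abelian_subgroupI3 additive_subgroup.a_subgroup R.is_abelian_group)
  finally show "\<exists>w\<in>mult_closure Q U. w \<otimes>\<^bsub>Q\<^esub> Z = \<zero>\<^bsub>Q\<^esub>" using cls_M[OF m(1)] by blast
next
  fix b assume b: "b \<in> carrier B"
  then obtain p m where pm: "is_frac b p m" using BI_is_frac B_subset by blast
  then have m: "m \<in> M" and p: "p \<in> carrier R" by (auto simp: is_frac_def)
  \<comment> \<open>Since \<open>\<sigma>\<close> is the identity on \<open>B\<close>, replacing the
    numerator of any fraction for \<open>b\<close> by its value under \<open>\<phi>\<close>
    represents \<open>b\<close> again, now with numerator and denominator in the image of
    \<open>\<mu>\<close>.\<close>
  have "b = \<phi> p / to_frac m" using \<sigma>_eq[OF pm] \<sigma>_on_B[OF b] by simp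
  then have "b * \<mu> (cls m) = \<mu> (cls p)"
    using M_props[OF m] p by (simp add: \<mu>_cls)
  then show "\<exists>a\<in>carrier Q. \<exists>s\<in>mult_closure Q U. b \<otimes>\<^bsub>B\<^esub> \<mu> s = \<mu> a"
    using cls_M[OF m] p by (auto simp: carrier_Q)
qed

end

section \<open>From the tree to the abstract conditions\<close>

lemma compatible_iiD:
  assumes comp: "compatible_ii r Jij I A a b k" and k: "k \<in> A"
    and Jij: "\<And>t. t \<in> A \<Longrightarrow> ({a, t} \<in> Jij \<longleftrightarrow> {a, t} \<in> J) \<and> ({b, t} \<in> Jij \<longleftrightarrow> {b, t} \<in> J)"
    and below: "\<And>s. (s, k) \<in> r \<Longrightarrow> s \<in> A"
  shows "\<exists>t. pivot r J I a b k t"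
proof -
  define N where "N = {t \<in> A. (t, k) \<in> r \<and> t \<noteq> k \<and> {a, t} \<notin> Jij \<and> {b, t} \<notin> Jij}"
  have N: "s \<in> N \<longleftrightarrow> (s, k) \<in> r \<and> s \<noteq> k \<and> {a, s} \<notin> J \<and> {b, s} \<notin> J" for s
    using Jij below unfolding N_def by blast
  have ak: "{a, k} \<notin> I" and b: "\<And>l. l \<in> A \<Longrightarrow> {b, l} \<in> I"
    and "\<exists>t\<in>N. (\<forall>s\<in>N. (s, t) \<in> r) \<and> {k, t} \<in> I"
    using comp unfolding compatible_ii_def Let_def N_def by auto
  then obtain t where t: "t \<in> N" "\<forall>s\<in>N. (s, t) \<in> r" "{k, t} \<in> I" by blast
  then have "t \<in> A" by (simp add: N_def)
  then have "pivot r J I a b k t"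
    unfolding pivot_def using ak b[OF k] b[of t] t N by auto
  then show ?thesis ..
qed

context leaf_labeled_tree
begin

text \<open>Every label lies in some part. As labels of different parts are incomparable and the
  order is total on each part, comparability of distinct labels means attachment at the same vertex,
  so the quartet lemmas apply to both cases.\<close>

lemma compatible_imp_compatible_set:
  assumes ij: "i \<in> {1..n}" "j \<in> {1..n}" "i \<noteq> j" "{i, j} \<notin> infinite_pairs n \<xi>"
    and \<xi>: "\<xi> \<in> tp_topology n closure_of tree_cone n V E lab"
    and ord: "partial_order_on ({1..n} - {i, j}) r"
    and cherry: "cherry_property n E lab i j r"
    and comp: "compatible n E lab i j r (infinite_pairs n \<xi> \<inter> star_pairs n i j) I"
  shows "compatible_set n i j r (infinite_pairs n \<xi>) I"
proof -
  let ?J = "infinite_pairs n \<xi>" and ?L = "{1..n} - {i, j}"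
  let ?part = "part n E lab i j"
  note four_point = quartet_imp_four_point_infinite[OF \<xi>]
  have r_L: "k \<in> ?L" "l \<in> ?L" if "(k, l) \<in> r" for k l
    using partial_order_onD(4)[OF ord] that by auto
  have r_antisym: "k = l" if "(k, l) \<in> r" "(l, k) \<in> r" for k l
    using partial_order_onD(3)[OF ord] that by (auto dest: antisymD)
  have part_ex: "\<exists>v\<in>spine E lab i j. k \<in> ?part v" if "k \<in> ?L" for k
    using part_exists[OF ij(1-3) that] .
  have part_sub: "k \<in> ?L" if "k \<in> ?part v" for k v
    using that by (simp add: part_def)
  have same: "v = w" if "(k, l) \<in> r" "v \<in> spine E lab i j" "w \<in> spine E lab i j"
    "k \<in> ?part v" "l \<in> ?part w" for k l v w
    using cherry that unfolding cherry_property_def by blast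
  have star: "{i, t} \<in> star_pairs n i j" "{j, t} \<in> star_pairs n i j" if "t \<in> ?L" for t
    using that by (auto simp: star_pairs_def)
  show ?thesis
  proof (unfold_locales)
    show "i \<in> {1..n}" "j \<in> {1..n}" "i \<noteq> j" "{i, j} \<notin> ?J" by (fact ij)+
    show "partial_order_on ?L r" by fact
    show "I \<subseteq> pairs n" "card I = 2 * (n - 2)" "{i, j} \<notin> I"
      using comp by (auto simp: compatible_def)
    show "?J \<subseteq> pairs n" by (auto simp: infinite_pairs_def)
  next
    fix k assume "k \<in> ?L"
    then obtain v where v: "v \<in> spine E lab i j" "k \<in> ?part v" using part_ex by blast
    have below: "s \<in> ?part v" if "(s, k) \<in> r" for s
      using part_ex[OF r_L(1)[OF that]] same[OF that _ v(1) _ v(2)] by blast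
    have Jij: "({i, t} \<in> ?J \<inter> star_pairs n i j \<longleftrightarrow> {i, t} \<in> ?J) \<and>
        ({j, t} \<in> ?J \<inter> star_pairs n i j \<longleftrightarrow> {j, t} \<in> ?J)" if "t \<in> ?part v" for t
      using star[OF part_sub[OF that]] by blast
    have "compatible_i r (?J \<inter> star_pairs n i j) I i j k \<or>
        compatible_ii r (?J \<inter> star_pairs n i j) I (?part v) i j k \<or>
        compatible_ii r (?J \<inter> star_pairs n i j) I (?part v) j i k"
      using comp v unfolding compatible_def exactly_one_def by blast
    then show "{i, k} \<in> I \<and> {j, k} \<in> I \<and> (\<forall>l. (l, k) \<in> r \<and> l \<noteq> k \<longrightarrow> {i, l} \<in> ?J \<or> {j, l} \<in> ?J) \<or>
        (\<exists>t. pivot r ?J I i j k t) \<or> (\<exists>t. pivot r ?J I j i k t)"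
    proof (elim disjE)
      assume "compatible_i r (?J \<inter> star_pairs n i j) I i j k"
      then show ?thesis unfolding compatible_i_def by blast
    next
      assume "compatible_ii r (?J \<inter> star_pairs n i j) I (?part v) i j k"
      from compatible_iiD[OF this v(2) Jij below] show ?thesis by blast
    next
      assume "compatible_ii r (?J \<inter> star_pairs n i j) I (?part v) j i k"
      from compatible_iiD[OF this v(2) _ below] Jij show ?thesis by blast
    qed
  next
    fix k l assume kl: "(k, l) \<in> r" "k \<noteq> l"
    obtain v w where v: "v \<in> spine E lab i j" "k \<in> ?part v" and w: "w \<in> spine E lab i j" "l \<in> ?part w"
      using part_ex r_L[OF kl(1)] by blast
    have "l \<in> ?part v" using same[OF kl(1) v(1) w(1) v(2) w(2)] w by simp
    from same_part_quartet[OF ij(1-3) v(1) v(2) this]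
    show "four_point_infinite ?J i j k l"
      using r_L[OF kl(1)] kl(2) ij by (intro four_point) auto
  next
    fix k l assume kl: "k \<in> ?L" "l \<in> ?L" "(k, l) \<notin> r" "(l, k) \<notin> r"
    have "k \<noteq> l" using kl partial_order_onD(1)[OF ord] by (auto simp: refl_on_def)
    obtain v w where v: "v \<in> spine E lab i j" "k \<in> ?part v" and w: "w \<in> spine E lab i j" "l \<in> ?part w"
      using part_ex kl by blast
    have "v \<noteq> w"
    proof
      assume "v = w"
      moreover have "total_on (?part v) r" using cherry v unfolding cherry_property_def by blast
      ultimately show False using v w kl \<open>k \<noteq> l\<close> by (auto simp: total_on_def)
    qed
    from different_part_quartet[OF ij(1-3) v(1) w(1) this v(2) w(2)]
    show "four_point_infinite ?J i k j l \<or> four_point_infinite ?J i l j k"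
      using four_point[of i k j l] four_point[of i l j k] kl \<open>k \<noteq> l\<close> ij by auto
  next
    fix k l m assume klm: "(k, l) \<in> r" "k \<noteq> l" "(l, m) \<in> r" "l \<noteq> m"
    have L: "k \<in> ?L" "l \<in> ?L" "m \<in> ?L" using r_L klm by blast+
    have "k \<noteq> m" using klm r_antisym by blast
    then have dist: "distinct [k, l, i, m]" "distinct [l, m, i, k]" using L klm by auto
    then have dist': "distinct [lab k, lab l, lab i, lab m]" "distinct [lab l, lab m, lab i, lab k]"
      using L ij lab_inject by auto
    have leaf: "{lab k, lab l, lab i, lab m} \<subseteq> leaves V E" "{lab l, lab m, lab i, lab k} \<subseteq> leaves V E"
      using L ij lab_leaf by auto
    \<comment> \<open>The spanned subtree depends only on the set of leaves, so the quadruple may be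
      reordered to put the cherry first, as \<open>cherry_imp_quartet\<close> expects.\<close>
    have eq: "{lab i, lab k, lab l, lab m} = {lab k, lab l, lab i, lab m}"
      "{lab i, lab k, lab l, lab m} = {lab l, lab m, lab i, lab k}" by auto
    have "is_cherry (suppress2 (spanned_edges E {lab i, lab k, lab l, lab m})) (lab k) (lab l) \<or>
        is_cherry (suppress2 (spanned_edges E {lab i, lab k, lab l, lab m})) (lab l) (lab m)"
      using cherry klm unfolding cherry_property_def Let_def by blast
    then have "quartet (lab k) (lab l) (lab i) (lab m) \<or> quartet (lab l) (lab m) (lab i) (lab k)"
      using cherry_imp_quartet[OF leaf(1) dist'(1)] cherry_imp_quartet[OF leaf(2) dist'(2)]
      unfolding eq(1)[symmetric] eq(2)[symmetric] by blast
    then show "four_point_infinite ?J k l i m \<or> four_point_infinite ?J l m i k"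
      using four_point[of k l i m] four_point[of l m i k] dist L ij by auto
  qed
qed

end

theorem lemma5p3:
  fixes av :: "'k::field \<Rightarrow> real"
    and n i j :: nat
    and \<xi> :: "(nat set \<Rightarrow> ereal) set"
    and V :: "'v set" and E :: "'v set set" and lab :: "nat \<Rightarrow> 'v"
    and r :: "nat rel"
    and I J H :: "nat set set"
  assumes K: "complete_nonarch av"
    and x: "\<xi> \<in> trop_gr av n"
    and J: "J = infinite_pairs n \<xi>"
    and ij: "i \<in> {1..n}" "j \<in> {1..n}" "i \<noteq> j" "{i, j} \<notin> J"
    and T: "labeled_tree n V E lab"
    and x_in: "\<xi> \<in> tp_topology n closure_of tree_cone n V E lab"
    and ord: "partial_order_on ({1..n} - {i, j}) r"
    and cherry: "cherry_property n E lab i j r"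
    and comp: "compatible n E lab i j r (J \<inter> star_pairs n i j) I"
    and H: "H = I \<inter> star_pairs n i j"
  shows "let R = chart_ring n i j :: 'k mpoly ring;
             Q = R Quot coord_ideal n i j J;
             B = laurent_ring i j (I - J) (H - J);
             \<mu> = mu_bar i j I H J;
             U = {u_class n i j J k l | k l. {k, l} \<in> pairs n - (J \<union> {{i, j}})};
             S' = mult_closure Q U;
             S = mult_closure B (\<mu> ` U)
         in \<mu> \<in> ring_hom Q B \<and>
            loc_map B S \<mu> \<in> ring_iso (localization Q S') (localization B S)"
proof -
  interpret leaf_labeled_tree V E n lab
    by unfold_locales (use T in \<open>simp_all add: labeled_tree_def\<close>)
  have cs: "compatible_set n i j r J I"
    using compatible_imp_compatible_set[of i j \<xi> r I] ij x_in ord cherry comp unfolding J by blast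
  interpret compatible_set n i j r J I "{1..n} - {i, j}"
    by (rule cs)
  \<comment> \<open>The prescription is antisymmetric like the coordinates themselves; at a star
    pair outside \<open>J\<close> it is a variable, hence nonzero.\<close>
  let ?z = "\<lambda>k l. if {k, l} \<in> J then 0 else to_frac (ucoord i j k l :: 'k mpoly)"
  have "\<exists>f g. \<forall>k l. {k, l} \<in> I \<longrightarrow> minor i j f g k l = ?z k l"
  proof (rule exists_minors)
    show "?z l k = - ?z k l" for k l
      by (simp add: ucoord_swap[of i j l k] insert_commute)
    fix a t assume at: "a \<in> {i, j}" "{a, t} \<in> I - J"
    then have "{a, t} \<in> pairs n" "{a, t} \<noteq> {i, j}" using I_pairs ij_I by auto
    then have "t \<in> {1..n} - {i, j}" using at(1) by (auto simp: pairs_def)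
    then have "ucoord i j a t = (mvar a t :: 'k mpoly)" using at ij(3) ucoord_row[of t i j] by auto
    then show "?z a t \<noteq> 0" using at mvar_nonzero by simp
  qed
  then obtain f g :: "nat \<Rightarrow> 'k mpoly fract"
    where fg: "\<And>k l. {k, l} \<in> I \<Longrightarrow> minor i j f g k l = ?z k l" by blast
  interpret comparison n i j r J I "{1..n} - {i, j}" H f g
    by unfold_locales (use H fg in auto)
  show ?thesis
    unfolding Let_def using \<mu>_hom loc_map_\<mu>_iso by blast
qed

end
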